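(* Let $C$ be a weakly unital dg category over a field $\Bbbk$, with structure $A_\infty$ functor $p\colon C\oplus\Bbbk_C\to C$, and let $C^{\mathrm{pretr}}$ be the non-unital dg category of one-sided twisted complexes over $C$ defined in the context. Taken for all $n\ge1$ and all $\phi^1,\dots,\phi^n$, the morphisms $P_n(\phi^n,\dots,\phi^1)$ defined in the context are the Taylor components of an $A_\infty$ functor $P\colon C^{\mathrm{pretr}}\oplus\Bbbk_{C^{\mathrm{pretr}}}\to C^{\mathrm{pretr}}$, making $C^{\mathrm{pretr}}$ a weakly unital dg category, with $\mathrm{id}_X:=P_1(1_X)$.
   Context: $A_\infty$ functors. For non-unital dg categories $C,D$ over $\Bbbk$, an $A_\infty$ functor $F\colon C\to D$ is a map $F_0$ on objects together with Taylor components $F_n\colon C(x_{n-1},x_n)\otimes\dots\otimes C(x_0,x_1)\to D(F_0(x_0),F_0(x_n))$ of degree $1-n$, $n\ge1$, such that $$d(F_n(f_n\otimes\dots\otimes f_1))+\sum_{a+b=n}(-1)^{b-1+(a-1)(|f_1|+\dots+|f_b|)}F_a(f_n\otimes\dots\otimes f_{b+1})\cdot F_b(f_b\otimes\dots\otimes f_1)$$ $$=\sum_{k=0}^{n-1}(-1)^{n-1+|f_1|+\dots+|f_k|}F_n(f_n\otimes\dots\otimes f_{k+2}\otimes d(f_{k+1})\otimes f_k\otimes\dots\otimes f_1)+\sum_{k=0}^{n-2}(-1)^kF_{n-1}(f_n\otimes\dots\otimes f_{k+3}\otimes(f_{k+2}\circ f_{k+1})\otimes f_k\otimes\dots\otimes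 f_1).$$ Weakly unital dg categories (Kontsevich–Soibelman). For a non-unital dg category $A$, let $A\oplus\Bbbk_A$ be the strictly unital dg category with the same objects, $\mathrm{Hom}(x,y)=A(x,y)$ for $x\neq y$ and $\mathrm{Hom}(x,x)=A(x,x)\oplus\Bbbk 1_x$, with $1_x$ the strict unit; $i\colon A\to A\oplus\Bbbk_A$ is the natural embedding. A weakly unital dg category is a non-unital dg category $A$ with a distinguished closed element $\mathrm{id}_x\in A^0(x,x)$ for every object $x$, such that there exists an $A_\infty$ functor $p\colon A\oplus\Bbbk_A\to A$ (the structure functor), the identity on objects, with $p\circ i=\mathrm{id}_A$, $p_1(1_x)=\mathrm{id}_x$ for all $x$, and $p_n(f_1,\dots,f_n)=0$ for $n\ge2$ whenever all $f_k$ lie in $i(A)$. The category $C^{\mathrm{pretr}}$. Objects are formal expressions $X=(\bigoplus_{i=1}^nX_i[r_i],q_{ij})$ with $X_i\in C$, $r_i\in\mathbb Z$, $q_{ij}\in C^{1+r_j-r_i}(X_i,X_j)=C^1(X_i[r_i],X_j[r_j])$, $q_{ij}=0$ if $i\ge j$, and $dq+q\circ q=0$. (In general $C^k(X[r],Y[r'])=C^{k+r'-r}(X,Y)$.) The degree $k$ morphisms from $X$ to $X'=(\bigoplus X'_j[r'_j],q'_{ij})$ are the matrices $\phi=(\phi_{ij})$ with $\phi_{ij}\in C^k(X_i[r_i],X'_j[r'_j])$; composition is matrix multiplication, and $d\phi=d_C\phi+q'\circ\phi-(-1)^k\phi\circ q$. The maps $P_n$. Let $X^0,\dots,X^n$ be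 objects of $C^{\mathrm{pretr}}$, $X^s=(\bigoplus_kX^s_k[r^s_k],q^s_{kl})$, and for $1\le s\le n$ let $\phi^s\colon X^{s-1}\to X^s$ be either a (homogeneous) morphism of $C^{\mathrm{pretr}}$ or $1_{X^{s-1}}$ (in which case $X^s=X^{s-1}$, and the components of $\phi^s$ are $1_{X^{s-1}_k}$ on the diagonal and $0$ off it). The components $q^s_{kl}$ are called horizontal arrows, the components of the $\phi^s$ essential arrows. For indices $a,b$, let $\mathrm{Paths}_{ab}$ be the set of all paths from $X^0_a$ to $X^n_b$: a path is a composable sequence of arrows $\kappa=(\kappa_1,\dots,\kappa_\ell)$ ($\kappa_1$ first), each horizontal or essential, starting at $X^0_a$ and ending at $X^n_b$, containing for each $1\le s\le n$ exactly one essential arrow that is a component of $\phi^s$, these $n$ arrows occurring in the order $s=1,\dots,n$; the arrows between the components of $\phi^s$ and $\phi^{s+1}$ are horizontal arrows in $X^s$ (those before the component of $\phi^1$ are horizontal in $X^0$, those after the component of $\phi^n$ are horizontal in $X^n$), any number of horizontal arrows, including none, being allowed at each stage. The $(a,b)$-component of $P_n(\phi^n,\dots,\phi^1)\colon X^0\to X^n$ is $$P_n^{ab}(\phi^n,\dots,\phi^1)=\sum_{\kappa\in\mathrm{Paths}_{ab}}(-1)^{|\kappa|}p_\ell(\kappa_\ell,\dots,\kappa_1),\qquad |\kappa|=\sum_{s=1}^n(\deg\phi^s+t_s+1)N_s.$$ Here $N_s$ is the number of horizontal arrows standing to the left of the $s$-th essential arrow in the sequence $(\kappa_1,\dots,\kappa_\ell)$;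 and if the $s$-th essential arrow is a morphism from $X^{s-1}_k[r]$ to $X^s_l[r']$ then $t_s=r'-r$ (with $t_s=0$ if this arrow is some $1_X$). For $n\ge2$, if no $\phi^s$ equals $1_{X^{s-1}}$, then $P_n(\phi^n,\dots,\phi^1)=0$. The morphism $P_n(\phi^n,\dots,\phi^1)$ has degree $\sum_s\deg\phi^s-n+1$.
   Formalization: Signs corrected: the A∞ equation counts degrees of the left factors f_{k+2},…,f_n, with (-1)^{(b-1)(a+|f_{b+1}|+…+|f_n|)} on F_a·F_b; t_s is dropped from |κ| and p_ℓ gets (-1)^{(ℓ-1)r}, r the shift of the path's last object; d_C on C(X[r],Y[r']) is (-1)^{r'}d. *)

theory Defs
  imports Complex_Main "HOL-Library.Function_Algebras" "HOL-Library.Product_Plus"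
begin

definition sg :: "int \<Rightarrow> 'a::ab_group_add \<Rightarrow> 'a" where
  "sg e x = (if even e then x else - x)"

section \<open>Non-unital dg categories\<close>

text \<open>
  A homogeneous morphism is stored together with its source, target and degree. The graded
  pieces of all Hom-complexes are subspaces of one ambient vector space \<open>'m\<close>; they may overlap,
  as differential and composition are given on morphisms together with their source, target
  and degree.
\<close>

datatype ('o, 'm) arr = Arr (src: 'o) (tgt: 'o) (deg: int) (val: 'm)

record ('k, 'o, 'm) dg =
  scl :: "'k \<Rightarrow> 'm \<Rightarrow> 'm"
  obs :: "'o set"
  Hom :: "'o \<Rightarrow> 'o \<Rightarrow> int \<Rightarrow> 'm set"
  dif :: "('o, 'm) arr \<Rightarrow> 'm"
  cmp :: "('o, 'm) arr \<Rightarrow> ('o, 'm) arr \<Rightarrow> 'm"  \<comment> \<open>\<open>cmp C g f\<close> is \<open>g \<circ> f\<close>\<close>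

definition is_arr :: "('k, 'o, 'm) dg \<Rightarrow> ('o, 'm) arr \<Rightarrow> bool" where
  "is_arr C f \<longleftrightarrow> src f \<in> obs C \<and> tgt f \<in> obs C \<and> val f \<in> Hom C (src f) (tgt f) (deg f)"

definition d_arr :: "('k, 'o, 'm) dg \<Rightarrow> ('o, 'm) arr \<Rightarrow> ('o, 'm) arr" where
  "d_arr C f = Arr (src f) (tgt f) (deg f + 1) (dif C f)"

definition cmp_arr :: "('k, 'o, 'm) dg \<Rightarrow> ('o, 'm) arr \<Rightarrow> ('o, 'm) arr \<Rightarrow> ('o, 'm) arr" where
  "cmp_arr C g f = Arr (src f) (tgt g) (deg g + deg f) (cmp C g f)"

text \<open>The Leibniz rule is \<open>d(g \<circ> f) = dg \<circ> f + (-1)^|g| g \<circ> df\<close>.\<close>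

locale nonunital_dg_category =
  fixes C :: "('k::field, 'o, 'm::ab_group_add) dg"
  assumes vector_space: "vector_space (scl C)"
    and subspace_Hom: "x \<in> obs C \<Longrightarrow> y \<in> obs C \<Longrightarrow> module.subspace (scl C) (Hom C x y k)"
    and dif_arr: "is_arr C f \<Longrightarrow> is_arr C (d_arr C f)"
    and dif_add: "is_arr C (Arr x y k u) \<Longrightarrow> is_arr C (Arr x y k v) \<Longrightarrow>
      dif C (Arr x y k (u + v)) = dif C (Arr x y k u) + dif C (Arr x y k v)"
    and dif_scl: "is_arr C (Arr x y k u) \<Longrightarrow>
      dif C (Arr x y k (scl C c u)) = scl C c (dif C (Arr x y k u))"
    and dif_dif: "is_arr C f \<Longrightarrow> dif C (d_arr C f) = 0"
    and cmp_arr: "is_arr C f \<Longrightarrow> is_arr C g \<Longrightarrow> tgt f = src g \<Longrightarrow> is_arr C (cmp_arr C g f)"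
    and cmp_add_left: "is_arr C f \<Longrightarrow> is_arr C (Arr (tgt f) z k u) \<Longrightarrow> is_arr C (Arr (tgt f) z k v) \<Longrightarrow>
      cmp C (Arr (tgt f) z k (u + v)) f = cmp C (Arr (tgt f) z k u) f + cmp C (Arr (tgt f) z k v) f"
    and cmp_scl_left: "is_arr C f \<Longrightarrow> is_arr C (Arr (tgt f) z k u) \<Longrightarrow>
      cmp C (Arr (tgt f) z k (scl C c u)) f = scl C c (cmp C (Arr (tgt f) z k u) f)"
    and cmp_add_right: "is_arr C g \<Longrightarrow> is_arr C (Arr x (src g) k u) \<Longrightarrow> is_arr C (Arr x (src g) k v) \<Longrightarrow>
      cmp C g (Arr x (src g) k (u + v)) = cmp C g (Arr x (src g) k u) + cmp C g (Arr x (src g) k v)"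
    and cmp_scl_right: "is_arr C g \<Longrightarrow> is_arr C (Arr x (src g) k u) \<Longrightarrow>
      cmp C g (Arr x (src g) k (scl C c u)) = scl C c (cmp C g (Arr x (src g) k u))"
    and cmp_assoc: "is_arr C f \<Longrightarrow> is_arr C g \<Longrightarrow> is_arr C h \<Longrightarrow> tgt f = src g \<Longrightarrow> tgt g = src h \<Longrightarrow>
      cmp C h (cmp_arr C g f) = cmp C (cmp_arr C h g) f"
    and Leibniz: "is_arr C f \<Longrightarrow> is_arr C g \<Longrightarrow> tgt f = src g \<Longrightarrow>
      dif C (cmp_arr C g f) = cmp C (d_arr C g) f + sg (deg g) (cmp C g (d_arr C f))"

section \<open>A-infinity functors\<close>

text \<open>
  Composable sequences are lists \<open>[f_1, ..., f_n]\<close> in path order, \<open>f_1\<close> being applied first, and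
  \<open>F [f_1, ..., f_n]\<close> stands for \<open>F_n(f_n, ..., f_1)\<close>.
\<close>

definition composable :: "('k, 'o, 'm) dg \<Rightarrow> ('o, 'm) arr list \<Rightarrow> bool" where
  "composable C fs \<longleftrightarrow> fs \<noteq> [] \<and> (\<forall>f\<in>set fs. is_arr C f) \<and>
     (\<forall>i. Suc i < length fs \<longrightarrow> tgt (fs ! i) = src (fs ! Suc i))"

definition degs :: "('o, 'm) arr list \<Rightarrow> int" where
  "degs fs = (\<Sum>f\<leftarrow>fs. deg f)"

definition taylor_arr :: "('o \<Rightarrow> 'p) \<Rightarrow> (('o, 'm) arr list \<Rightarrow> 'l) \<Rightarrow> ('o, 'm) arr list \<Rightarrow> ('p, 'l) arr" where
  "taylor_arr F0 F fs =
     Arr (F0 (src (hd fs))) (F0 (tgt (last fs))) (degs fs + 1 - int (length fs)) (F fs)"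

text \<open>
  The last clause is, for all \<open>n \<ge> 1\<close> and composable \<open>f_1, ..., f_n\<close>,

  \<open>d F_n(f_n,...,f_1) + \<Sum>_{a+b=n} (-1)^((b-1)(a + |f_{b+1}| + ... + |f_n|)) F_a(f_n,...,f_{b+1}) \<circ> F_b(f_b,...,f_1)\<close>

  \<open>= \<Sum>_{k<n} (-1)^(n-1 + |f_{k+2}| + ... + |f_n|) F_n(f_n,...,d f_{k+1},...,f_1) + \<Sum>_{k<n-1} (-1)^k F_{n-1}(f_n,...,f_{k+2} \<circ> f_{k+1},...,f_1)\<close>.

  The Koszul signs count the factors to the left of the one acted on, in accordance with the
  Leibniz rule \<open>d(g \<circ> f) = dg \<circ> f + (-1)^|g| g \<circ> df\<close>; counting \<open>f_1, ..., f_k\<close> instead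
  would require \<open>d(g \<circ> f) = g \<circ> df + (-1)^|f| dg \<circ> f\<close>. The remaining freedom
  \<open>F_n \<mapsto> \<plusminus>F_n\<close> (signs depending on \<open>n\<close> only, \<open>F_1\<close> fixed) is normalized so that, for
  Maurer-Cartan elements \<open>dq + q \<circ> q = 0\<close> of degree 1, \<open>\<Sum>_n F_n(q,...,q)\<close> without signs is
  again Maurer-Cartan.
\<close>

definition ainf_functor ::
  "('k::field, 'o, 'm::ab_group_add) dg \<Rightarrow> ('k, 'p, 'l::ab_group_add) dg \<Rightarrow>
   ('o \<Rightarrow> 'p) \<Rightarrow> (('o, 'm) arr list \<Rightarrow> 'l) \<Rightarrow> bool" where
  "ainf_functor C D F0 F \<longleftrightarrow>
     (\<forall>x\<in>obs C. F0 x \<in> obs D) \<and>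
     (\<forall>fs. composable C fs \<longrightarrow> is_arr D (taylor_arr F0 F fs)) \<and>
     (\<forall>us x y k u v vs.
        composable C (us @ Arr x y k u # vs) \<longrightarrow> composable C (us @ Arr x y k v # vs) \<longrightarrow>
        F (us @ Arr x y k (u + v) # vs) = F (us @ Arr x y k u # vs) + F (us @ Arr x y k v # vs)) \<and>
     (\<forall>us x y k u c vs.
        composable C (us @ Arr x y k u # vs) \<longrightarrow>
        F (us @ Arr x y k (scl C c u) # vs) = scl D c (F (us @ Arr x y k u # vs))) \<and>
     (\<forall>fs. composable C fs \<longrightarrow>
        (let n = length fs in
          dif D (taylor_arr F0 F fs)
          + (\<Sum>b\<in>{1..<n}. sg ((int b - 1) * (int (n - b) + degs (drop b fs)))
               (cmp D (taylor_arr F0 F (drop b fs)) (taylor_arr F0 F (take b fs))))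
          = (\<Sum>k<n. sg (int n - 1 + degs (drop (Suc k) fs))
               (F (take k fs @ d_arr C (fs ! k) # drop (Suc k) fs)))
          + (\<Sum>k<n - 1. sg (int k)
               (F (take k fs @ cmp_arr C (fs ! Suc k) (fs ! k) # drop (Suc (Suc k)) fs)))))"

section \<open>Weakly unital dg categories\<close>

text \<open>
  In \<open>aug C\<close>, which is \<open>C \<oplus> k_C\<close>, the pair \<open>(f, a)\<close> stands for \<open>f + a 1_x\<close>, where \<open>a \<noteq> 0\<close> is
  allowed only for endomorphisms of degree 0.
\<close>

definition proj_arr :: "('o, 'm \<times> 'k) arr \<Rightarrow> ('o, 'm) arr" where
  "proj_arr f = Arr (src f) (tgt f) (deg f) (fst (val f))"

definition aug :: "('k::field, 'o, 'm::ab_group_add) dg \<Rightarrow> ('k, 'o, 'm \<times> 'k) dg" where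
  "aug C = \<lparr> scl = (\<lambda>c u. (scl C c (fst u), c * snd u)),
     obs = obs C,
     Hom = (\<lambda>x y k. {u. fst u \<in> Hom C x y k \<and> (snd u \<noteq> 0 \<longrightarrow> x = y \<and> k = 0)}),
     dif = (\<lambda>f. (dif C (proj_arr f), 0)),
     cmp = (\<lambda>g f. (cmp C (proj_arr g) (proj_arr f)
                     + scl C (snd (val g)) (fst (val f)) + scl C (snd (val f)) (fst (val g)),
                   snd (val g) * snd (val f))) \<rparr>"

definition incl_arr :: "('o, 'm) arr \<Rightarrow> ('o, 'm \<times> 'k::field) arr" where
  "incl_arr f = Arr (src f) (tgt f) (deg f) (val f, 0)"

definition unit_arr :: "'o \<Rightarrow> ('o, 'm::ab_group_add \<times> 'k::field) arr" where
  "unit_arr x = Arr x x 0 (0, 1)"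

definition id_functor :: "('o, 'm::ab_group_add) arr list \<Rightarrow> 'm" where
  "id_functor fs = (if length fs = 1 then val (hd fs) else 0)"

text \<open>
  The embedding \<open>i\<close> has the single Taylor component \<open>incl_arr\<close>, so that
  \<open>(p \<circ> i)_n(f_n,...,f_1) = p_n(i f_n,...,i f_1)\<close>.
\<close>

definition structure_functor ::
  "('k::field, 'o, 'm::ab_group_add) dg \<Rightarrow> ('o \<Rightarrow> 'm) \<Rightarrow> (('o, 'm \<times> 'k) arr list \<Rightarrow> 'm) \<Rightarrow> bool" where
  "structure_functor C idt p \<longleftrightarrow>
     ainf_functor (aug C) C (\<lambda>x. x) p \<and>
     (\<forall>fs. composable C fs \<longrightarrow> p (map incl_arr fs) = id_functor fs) \<and>
     (\<forall>x\<in>obs C. p [unit_arr x] = idt x) \<and>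
     (\<forall>fs. composable C fs \<and> length fs \<ge> 2 \<longrightarrow> p (map incl_arr fs) = 0)"

definition weakly_unital :: "('k::field, 'o, 'm::ab_group_add) dg \<Rightarrow> ('o \<Rightarrow> 'm) \<Rightarrow> bool" where
  "weakly_unital C idt \<longleftrightarrow>
     nonunital_dg_category C \<and>
     (\<forall>x\<in>obs C. idt x \<in> Hom C x x 0 \<and> dif C (Arr x x 0 (idt x)) = 0) \<and>
     (\<exists>p. structure_functor C idt p)"

section \<open>One-sided twisted complexes\<close>

text \<open>
  A twisted complex is a list of pairs \<open>(X_i, r_i)\<close> with a matrix \<open>q\<close>. Indices start at 0, the
  matrix entry \<open>\<phi> i j\<close> goes from the \<open>i\<close>-th to the \<open>j\<close>-th summand, and matrices are 0 outside
  their index range. The empty list, i.e. the zero object, is allowed.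
\<close>

type_synonym ('o, 'm) twisted = "('o \<times> int) list \<times> (nat \<Rightarrow> nat \<Rightarrow> 'm)"

definition len :: "('o, 'm) twisted \<Rightarrow> nat" where "len X = length (fst X)"
definition ob :: "('o, 'm) twisted \<Rightarrow> nat \<Rightarrow> 'o" where "ob X i = fst (fst X ! i)"
definition sh :: "('o, 'm) twisted \<Rightarrow> nat \<Rightarrow> int" where "sh X i = snd (fst X ! i)"
definition tw :: "('o, 'm) twisted \<Rightarrow> nat \<Rightarrow> nat \<Rightarrow> 'm" where "tw X = snd X"

text \<open>A degree \<open>k\<close> morphism \<open>X[r] \<rightarrow> Y[r']\<close>, as an element of \<open>C^(k+r'-r)(X,Y)\<close>.\<close>

definition entry ::
  "('o, 'm) twisted \<Rightarrow> ('o, 'm) twisted \<Rightarrow> int \<Rightarrow> (nat \<Rightarrow> nat \<Rightarrow> 'm) \<Rightarrow> nat \<Rightarrow> nat \<Rightarrow> ('o, 'm) arr" where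
  "entry X Y k \<phi> i j = Arr (ob X i) (ob Y j) (k + sh Y j - sh X i) (\<phi> i j)"

definition matrices ::
  "('k, 'o, 'm::ab_group_add) dg \<Rightarrow> ('o, 'm) twisted \<Rightarrow> ('o, 'm) twisted \<Rightarrow> int \<Rightarrow> (nat \<Rightarrow> nat \<Rightarrow> 'm) set" where
  "matrices C X Y k = {\<phi>. \<forall>i j.
     if i < len X \<and> j < len Y then \<phi> i j \<in> Hom C (ob X i) (ob Y j) (k + sh Y j - sh X i)
     else \<phi> i j = 0}"

definition mat_mult ::
  "('k, 'o, 'm::ab_group_add) dg \<Rightarrow> ('o, 'm) twisted \<Rightarrow> ('o, 'm) twisted \<Rightarrow> ('o, 'm) twisted \<Rightarrow>
   int \<Rightarrow> int \<Rightarrow> (nat \<Rightarrow> nat \<Rightarrow> 'm) \<Rightarrow> (nat \<Rightarrow> nat \<Rightarrow> 'm) \<Rightarrow> nat \<Rightarrow> nat \<Rightarrow> 'm" where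
  "mat_mult C X Y Z kg kf g f = (\<lambda>i j.
     if i < len X \<and> j < len Z
     then \<Sum>l<len Y. cmp C (entry Y Z kg g l j) (entry X Y kf f i l) else 0)"

text \<open>
  The differential of \<open>C(X[r],Y[r'])\<close> is \<open>(-1)^r' d\<close>. As composition in \<open>C^*(X[r],Y[r'])\<close> is that
  of \<open>C\<close> without sign, this is what the Leibniz rule in the degrees of \<open>C^*(X[r],Y[r'])\<close> requires.
\<close>

definition mat_dif ::
  "('k, 'o, 'm::ab_group_add) dg \<Rightarrow> ('o, 'm) twisted \<Rightarrow> ('o, 'm) twisted \<Rightarrow>
   int \<Rightarrow> (nat \<Rightarrow> nat \<Rightarrow> 'm) \<Rightarrow> nat \<Rightarrow> nat \<Rightarrow> 'm" where
  "mat_dif C X Y k \<phi> = (\<lambda>i j.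
     if i < len X \<and> j < len Y then sg (sh Y j) (dif C (entry X Y k \<phi> i j)) else 0)"

definition pretr ::
  "('k::field, 'o, 'm::ab_group_add) dg \<Rightarrow> ('k, ('o, 'm) twisted, nat \<Rightarrow> nat \<Rightarrow> 'm) dg" where
  "pretr C = \<lparr> scl = (\<lambda>c \<phi> i j. scl C c (\<phi> i j)),
     obs = {X. (\<forall>(x, r)\<in>set (fst X). x \<in> obs C) \<and> tw X \<in> matrices C X X 1 \<and>
               (\<forall>i j. i \<ge> j \<longrightarrow> tw X i j = 0) \<and>
               mat_dif C X X 1 (tw X) + mat_mult C X X X 1 1 (tw X) (tw X) = 0},
     Hom = matrices C,
     dif = (\<lambda>f. mat_dif C (src f) (tgt f) (deg f) (val f)
              + mat_mult C (src f) (tgt f) (tgt f) 1 (deg f) (tw (tgt f)) (val f)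
              - sg (deg f) (mat_mult C (src f) (src f) (tgt f) (deg f) 1 (val f) (tw (src f)))),
     cmp = (\<lambda>g f. mat_mult C (src f) (tgt f) (tgt g) (deg g) (deg f) (val g) (val f)) \<rparr>"

section \<open>The maps \<open>P_n\<close>\<close>

text \<open>
  Horizontal and essential arrows as morphisms of \<open>aug C\<close>. A morphism \<open>(\<phi>, c)\<close> of
  \<open>aug (pretr C)\<close> has components \<open>\<phi>_kl + c \<delta>_kl 1\<close>.
\<close>

definition hor :: "('o, 'm) twisted \<Rightarrow> nat \<Rightarrow> nat \<Rightarrow> ('o, 'm \<times> 'k::field) arr" where
  "hor X k l = Arr (ob X k) (ob X l) (1 + sh X l - sh X k) (tw X k l, 0)"

definition ess ::
  "(('o, 'm) twisted, (nat \<Rightarrow> nat \<Rightarrow> 'm) \<times> 'k::field) arr \<Rightarrow> nat \<Rightarrow> nat \<Rightarrow> ('o, 'm \<times> 'k) arr" where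
  "ess f k l = Arr (ob (src f) k) (ob (tgt f) l) (deg f + sh (tgt f) l - sh (src f) k)
     (fst (val f) k l, if k = l then snd (val f) else 0)"

text \<open>
  Let \<open>fs = [\<phi>^1, ..., \<phi>^n]\<close> with \<open>\<phi>^s : X^{s-1} \<rightarrow> X^s\<close>. A path is encoded by the list of the
  \<open>n + 1\<close> nonempty lists \<open>w ! s\<close> of the indices of the summands of \<open>X^s\<close> it visits. Only
  horizontal arrows \<open>q_kl\<close> with \<open>k < l\<close> are taken, the other ones being 0. Of the \<open>s\<close>-th essential
  arrow, the source is the last index of \<open>w ! (s-1)\<close> and the target is the first one of \<open>w ! s\<close>.
\<close>

definition stage :: "('x, 'n) arr list \<Rightarrow> nat \<Rightarrow> 'x" where
  "stage fs s = (if s = 0 then src (hd fs) else tgt (fs ! (s - 1)))"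

definition paths ::
  "(('o, 'm) twisted, (nat \<Rightarrow> nat \<Rightarrow> 'm) \<times> 'k::field) arr list \<Rightarrow> nat \<Rightarrow> nat \<Rightarrow> nat list list set" where
  "paths fs a b = {w. length w = length fs + 1 \<and>
     (\<forall>s\<le>length fs. w ! s \<noteq> [] \<and> sorted_wrt (<) (w ! s) \<and> set (w ! s) \<subseteq> {..<len (stage fs s)}) \<and>
     hd (w ! 0) = a \<and> last (w ! length fs) = b}"

definition hors :: "('o, 'm) twisted \<Rightarrow> nat list \<Rightarrow> ('o, 'm \<times> 'k::field) arr list" where
  "hors X ks = map (\<lambda>(k, l). hor X k l) (zip ks (tl ks))"

definition path_arrows ::
  "(('o, 'm) twisted, (nat \<Rightarrow> nat \<Rightarrow> 'm) \<times> 'k::field) arr list \<Rightarrow> nat list list \<Rightarrow> ('o, 'm \<times> 'k) arr list" where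
  "path_arrows fs w = hors (stage fs 0) (w ! 0) @
     concat (map (\<lambda>s. ess (fs ! s) (last (w ! s)) (hd (w ! Suc s)) # hors (stage fs (Suc s)) (w ! Suc s))
       [0..<length fs])"

text \<open>
  The exponent is \<open>\<Sum>_s (deg \<phi>^s + 1) N_s\<close>, where \<open>deg \<phi>^s\<close> is the degree in \<open>C^*(X[r],Y[r'])\<close>
  and \<open>N_s\<close> is the number of horizontal arrows preceding the \<open>s\<close>-th essential one in path order.
\<close>

definition path_exponent ::
  "(('o, 'm) twisted, (nat \<Rightarrow> nat \<Rightarrow> 'm) \<times> 'k::field) arr list \<Rightarrow> nat list list \<Rightarrow> int" where
  "path_exponent fs w =
     (\<Sum>s<length fs. (deg (fs ! s) + 1) * int (\<Sum>t\<le>s. length (w ! t) - 1))"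

text \<open>
  The extension of \<open>p\<close> to morphisms \<open>X_0[r_0] \<rightarrow> ... \<rightarrow> X_l[r_l]\<close> between shifted objects, with
  \<open>r = r_l\<close>: moving \<open>p_l\<close>, of degree \<open>1 - l\<close>, past the shift by \<open>r_l\<close> on the left gives the sign
  \<open>(-1)^((l-1) r_l)\<close>. For \<open>l = 1\<close> there is no sign.
\<close>

definition shifted :: "(('o, 'm \<times> 'k::field) arr list \<Rightarrow> 'm::ab_group_add) \<Rightarrow> int \<Rightarrow> ('o, 'm \<times> 'k) arr list \<Rightarrow> 'm" where
  "shifted p r ks = sg ((int (length ks) - 1) * r) (p ks)"

definition P_pretr ::
  "(('o, 'm \<times> 'k::field) arr list \<Rightarrow> 'm::ab_group_add) \<Rightarrow>
   (('o, 'm) twisted, (nat \<Rightarrow> nat \<Rightarrow> 'm) \<times> 'k) arr list \<Rightarrow> nat \<Rightarrow> nat \<Rightarrow> 'm" where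
  "P_pretr p fs = (\<lambda>a b.
     if a < len (stage fs 0) \<and> b < len (stage fs (length fs))
     then \<Sum>w\<in>paths fs a b.
       sg (path_exponent fs w) (shifted p (sh (stage fs (length fs)) b) (path_arrows fs w))
     else 0)"

end

theory Submission
  imports Defs
begin

text \<open>
  Shifts, matrices and twisting are separated: \<open>pretr C\<close> is the twisting, by Maurer-Cartan
  elements, of the category of matrices over the category \<open>shifts C\<close> of shifted objects, and the
  signs of \<open>shifted\<close> turn the structure functor of \<open>C\<close> into one of \<open>shifts C\<close>.

  In the reduced degrees \<open>deg + 1\<close> the right-hand side of the A-infinity equation is a recursively
  computable operator \<open>bar_diff\<close> on functions of words, and the sign of a path is a product of signs,
  one for each horizontal arrow. An induction along paths shows that summation over signed paths
  intertwines \<open>bar_diff\<close> over \<open>C\<close> with \<open>bar_diff\<close> over \<open>pretr C\<close>: two consecutive horizontal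
  arrows cancel against the differential of one by the Maurer-Cartan equation, and a horizontal arrow next
  to an essential one supplies the twisting terms of the differential of \<open>pretr C\<close>. On the other side
  of the equation, a product of values on the two parts of a word is a cut of the path. Cuts with essential
  arrows on both sides give the products of the \<open>P_n\<close>. If one part is purely horizontal, then
  \<open>p\<close> is nonzero on it only if it is a single arrow, and the product is a twisting term of the
  differential of \<open>P_n\<close>.
\<close>

section \<open>Reduced degrees and the bar differential\<close>

text \<open>The signs of paths are forced by \<open>bar_diff\<close>. Stripping the first letter off
  a word reverses the sign of the terms acting on later letters. A leading horizontal arrow is a
  letter of the word over \<open>C\<close> but not of the word over \<open>pretr C\<close>, so the
  reversal has to come from its own sign: \<open>sg (rdegs fs)\<close> provides it, as differential
  and composition change the reduced degree by one. Between shifted objects horizontal arrows have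
  degree 1, hence even reduced degree, and do not affect the Koszul signs at other arrows.

  The intertwining is proved for all multilinear functions on words: after the first arrow
  \<open>h\<close> is stripped, \<open>p\<close> has become \<open>\<lambda>w. p (h # w)\<close>,
  for which no A-infinity equation is available. The equation of \<open>p\<close> enters afterwards,
  once for each path.

  Units are treated together with morphisms: the components of \<open>1_X\<close> are units on the
  diagonal, and the twisting terms \<open>q 1\<close> and \<open>1 q\<close> cancel, in agreement
  with \<open>d 1_X = 0\<close>. One-sidedness makes indices increase along horizontal arrows, so
  there are finitely many paths and induction along them is possible.\<close>

lemma sg_0 [simp]: "sg 0 x = x"
  by (simp add: sg_def)

lemma sg_zero [simp]: "sg e 0 = 0"
  by (simp add: sg_def)

lemma sg_sg: "sg a (sg b x) = sg (a + b) x"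
  by (auto simp: sg_def)

lemma sg_add: "sg e (x + y) = sg e x + sg e y"
  by (simp add: sg_def)

lemma sg_diff: "sg e (x - y) = sg e x - sg e y"
  by (simp add: sg_def)

lemma sg_minus: "sg e (- x) = - sg e x"
  by (simp add: sg_def)

lemma sg_sum: "sg e (sum f A) = (\<Sum>x\<in>A. sg e (f x))"
  by (simp add: sg_def sum_negf)

lemma sg_parity: "even (a + b) \<Longrightarrow> sg a x = sg b x"
  by (auto simp: sg_def)

lemma sg_parity_minus: "odd (a + b) \<Longrightarrow> sg a x = - sg b x"
  by (auto simp: sg_def)

lemma sg_apply: "sg e f i = sg e (f i)"
  by (simp add: sg_def)

lemma fst_sg: "fst (sg e x) = sg e (fst x)"
  by (simp add: sg_def)

lemma snd_sg: "snd (sg e x) = sg e (snd x)"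
  by (simp add: sg_def)

text \<open>The degrees of the bar construction. Only their parity matters, so
  \<open>deg + 1\<close> serves in place of the usual \<open>deg - 1\<close>.\<close>

definition rdegs :: "('o, 'm) arr list \<Rightarrow> int" where
  "rdegs fs = (\<Sum>f\<leftarrow>fs. deg f + 1)"

lemma rdegs_simps [simp]:
  "rdegs [] = 0" "rdegs (f # fs) = deg f + 1 + rdegs fs" "rdegs (us @ vs) = rdegs us + rdegs vs"
  by (simp_all add: rdegs_def)

lemma degs_simps [simp]:
  "degs [] = 0" "degs (f # fs) = deg f + degs fs" "degs (us @ vs) = degs us + degs vs"
  by (simp_all add: degs_def)

lemma rdegs_eq: "rdegs fs = degs fs + int (length fs)"
  by (induction fs) auto

text \<open>Unlike \<open>composable\<close>, this admits the empty word, which occurs as the tail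
  in inductions and as one side of a cut.\<close>

fun seg :: "('k, 'o, 'm) dg \<Rightarrow> 'o \<Rightarrow> 'o \<Rightarrow> ('o, 'm) arr list \<Rightarrow> bool" where
  "seg A x y [] \<longleftrightarrow> x = y"
| "seg A x y (f # fs) \<longleftrightarrow> is_arr A f \<and> src f = x \<and> seg A (tgt f) y fs"

lemma seg_append: "seg A x y (us @ vs) \<longleftrightarrow> (\<exists>z. seg A x z us \<and> seg A z y vs)"
  by (induction us arbitrary: x) auto

lemma composable_single [simp]: "composable A [f] \<longleftrightarrow> is_arr A f"
  by (simp add: composable_def)

lemma composable_Cons_Cons [simp]:
  "composable A (f # g # fs) \<longleftrightarrow> is_arr A f \<and> tgt f = src g \<and> composable A (g # fs)"
  by (auto simp: composable_def nth_Cons split: nat.splits)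

lemma composable_imp_seg: "composable A fs \<Longrightarrow> seg A (src (hd fs)) (tgt (last fs)) fs"
proof (induction fs)
  case (Cons f fs)
  then show ?case by (cases fs) auto
qed (simp add: composable_def)

lemma seg_imp_composable: "seg A x y fs \<Longrightarrow> fs \<noteq> [] \<Longrightarrow> composable A fs"
proof (induction fs arbitrary: x)
  case (Cons f fs)
  then show ?case by (cases fs) auto
qed simp

lemma seg_ends: "seg A x y fs \<Longrightarrow> fs \<noteq> [] \<Longrightarrow> src (hd fs) = x \<and> tgt (last fs) = y"
proof (induction fs arbitrary: x)
  case (Cons f fs)
  then show ?case by (cases fs) auto
qed simp

lemma seg_take_drop:
  "seg A x y fs \<Longrightarrow> i \<le> length fs \<Longrightarrow> \<exists>z. seg A x z (take i fs) \<and> seg A z y (drop i fs)"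
  by (metis append_take_drop_id seg_append)

text \<open>Augmentations \<open>aug A\<close> enter only through these properties.\<close>

locale linear_dg =
  fixes A :: "('k::field, 'o, 'm::ab_group_add) dg"
  assumes vec: "vector_space (scl A)"
    and sub: "x \<in> obs A \<Longrightarrow> y \<in> obs A \<Longrightarrow> module.subspace (scl A) (Hom A x y k)"
    and d_closed: "is_arr A f \<Longrightarrow> is_arr A (d_arr A f)"
    and c_closed: "is_arr A f \<Longrightarrow> is_arr A g \<Longrightarrow> tgt f = src g \<Longrightarrow> is_arr A (cmp_arr A g f)"
begin

sublocale vector_space "scl A" by (rule vec)

lemma Hom_add: "x \<in> obs A \<Longrightarrow> y \<in> obs A \<Longrightarrow> u \<in> Hom A x y k \<Longrightarrow> v \<in> Hom A x y k \<Longrightarrow> u + v \<in> Hom A x y k"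
  using sub subspace_add by blast

lemma Hom_zero: "x \<in> obs A \<Longrightarrow> y \<in> obs A \<Longrightarrow> 0 \<in> Hom A x y k"
  using sub subspace_0 by blast

lemma Hom_scl: "x \<in> obs A \<Longrightarrow> y \<in> obs A \<Longrightarrow> u \<in> Hom A x y k \<Longrightarrow> scl A c u \<in> Hom A x y k"
  using sub subspace_scale by blast

lemma Hom_minus: "x \<in> obs A \<Longrightarrow> y \<in> obs A \<Longrightarrow> u \<in> Hom A x y k \<Longrightarrow> - u \<in> Hom A x y k"
  using sub subspace_neg by blast

lemma Hom_sg: "x \<in> obs A \<Longrightarrow> y \<in> obs A \<Longrightarrow> u \<in> Hom A x y k \<Longrightarrow> sg e u \<in> Hom A x y k"
  by (simp add: sg_def Hom_minus)

lemma Hom_diff: "x \<in> obs A \<Longrightarrow> y \<in> obs A \<Longrightarrow> u \<in> Hom A x y k \<Longrightarrow> v \<in> Hom A x y k \<Longrightarrow> u - v \<in> Hom A x y k"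
  using sub subspace_diff by blast

lemma Hom_sum: "x \<in> obs A \<Longrightarrow> y \<in> obs A \<Longrightarrow> (\<And>i. i \<in> I \<Longrightarrow> u i \<in> Hom A x y k) \<Longrightarrow> sum u I \<in> Hom A x y k"
  using sub subspace_sum by blast

lemma scl_sg: "scl A c (sg e u) = sg e (scl A c u)"
  by (simp add: sg_def)

end

context nonunital_dg_category
begin

sublocale linear_dg C
  by unfold_locales
    (use vector_space subspace_Hom dif_arr cmp_arr in \<open>auto simp: vector_space_def\<close>)

end

section \<open>Multilinear functions on words and the right-hand side of the A-infinity
  equation\<close>

definition multilinear ::
  "('k, 'o, 'm::ab_group_add) dg \<Rightarrow> ('k \<Rightarrow> 'l \<Rightarrow> 'l) \<Rightarrow> 'o \<Rightarrow> 'o \<Rightarrow> (('o, 'm) arr list \<Rightarrow> 'l::ab_group_add) \<Rightarrow> bool" where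
  "multilinear A s x y G \<longleftrightarrow> (\<forall>us x' y' k u v vs a b.
     seg A x y (us @ Arr x' y' k u # vs) \<longrightarrow> seg A x y (us @ Arr x' y' k v # vs) \<longrightarrow>
     G (us @ Arr x' y' k (scl A a u + scl A b v) # vs)
       = s a (G (us @ Arr x' y' k u # vs)) + s b (G (us @ Arr x' y' k v # vs)))"

text \<open>
  The right-hand side of the A-infinity equation (see \<open>bar_diff_eq\<close>), in a form recursive along the word.
\<close>

fun bar_diff :: "('k, 'o, 'm) dg \<Rightarrow> (('o, 'm) arr list \<Rightarrow> 'l) \<Rightarrow> ('o, 'm) arr list \<Rightarrow> 'l::ab_group_add" where
  "bar_diff A G [] = 0"
| "bar_diff A G (f # fs) = sg (rdegs fs) (G (d_arr A f # fs))
     + (case fs of [] \<Rightarrow> 0 | g # gs \<Rightarrow> G (cmp_arr A g f # gs)) - bar_diff A (\<lambda>gs. G (f # gs)) fs"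

text \<open>A letter put in front raises both the length \<open>n\<close> and the position
  \<open>k\<close> by one, which reverses the signs \<open>n - 1 + ...\<close> and \<open>k\<close>
  of all old terms; this is the minus sign in the recursion. At position 0 the exponent
  \<open>n - 1 + |f_2| + ... + |f_n|\<close> is the reduced degree of the tail.\<close>

lemma bar_diff_eq:
  fixes F :: "('b, 'c) arr list \<Rightarrow> 'd::ab_group_add"
  shows "(\<Sum>k<length fs. sg (int (length fs) - 1 + degs (drop (Suc k) fs))
      (F (take k fs @ d_arr A (fs ! k) # drop (Suc k) fs)))
    + (\<Sum>k<length fs - 1. sg (int k)
      (F (take k fs @ cmp_arr A (fs ! Suc k) (fs ! k) # drop (Suc (Suc k)) fs)))
    = bar_diff A F fs"
proof (induction fs arbitrary: F)
  case (Cons f fs)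
  have 1: "(\<Sum>k<length (f # fs). sg (int (length (f # fs)) - 1 + degs (drop (Suc k) (f # fs)))
      (F (take k (f # fs) @ d_arr A ((f # fs) ! k) # drop (Suc k) (f # fs))))
    = sg (rdegs fs) (F (d_arr A f # fs)) - (\<Sum>k<length fs. sg (int (length fs) - 1 + degs (drop (Suc k) fs))
      (F (f # take k fs @ d_arr A (fs ! k) # drop (Suc k) fs)))"
  proof -
    have *: "sg (int (length fs) + degs (drop (Suc k) fs)) z
        = - sg (int (length fs) - 1 + degs (drop (Suc k) fs)) z" for k and z :: 'd
      by (rule sg_parity_minus) auto
    show ?thesis
      unfolding list.size(4) add.right_neutral add_Suc_right sum.lessThan_Suc_shift
      by (simp add: rdegs_eq add.commute * sum_negf)
  qed
  have 2: "(\<Sum>k<length (f # fs) - 1. sg (int k)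
      (F (take k (f # fs) @ cmp_arr A ((f # fs) ! Suc k) ((f # fs) ! k) # drop (Suc (Suc k)) (f # fs))))
    = (case fs of [] \<Rightarrow> 0 | g # gs \<Rightarrow> F (cmp_arr A g f # gs)) - (\<Sum>k<length fs - 1. sg (int k)
      (F (f # take k fs @ cmp_arr A (fs ! Suc k) (fs ! k) # drop (Suc (Suc k)) fs)))"
  proof (cases fs)
    case (Cons g gs)
    have *: "sg (1 + int k) z = - sg (int k) z" for k and z :: 'd
      by (rule sg_parity_minus) auto
    have len: "length (f # fs) - 1 = Suc (length fs - 1)"
      using Cons by simp
    show ?thesis
      unfolding len sum.lessThan_Suc_shift using Cons by (simp add: * sum_negf)
  qed simp
  show ?case
    unfolding 1 2 using Cons.IH[of "\<lambda>gs. F (f # gs)"] by (simp add: algebra_simps)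
qed simp

lemma bar_diff_add: "bar_diff A (\<lambda>gs. G gs + H gs) fs = bar_diff A G fs + bar_diff A H fs"
  by (induction fs arbitrary: G H) (auto simp: sg_add split: list.splits)

lemma bar_diff_0 [simp]: "bar_diff A (\<lambda>gs. 0) fs = 0"
  by (induction fs) (auto split: list.splits)

lemma bar_diff_sum: "bar_diff A (\<lambda>gs. \<Sum>i\<in>I. G i gs) fs = (\<Sum>i\<in>I. bar_diff A (G i) fs)"
  by (induction I rule: infinite_finite_induct) (simp_all add: bar_diff_add)

text \<open>Both \<open>d_arr\<close> and \<open>cmp_arr\<close> change the total reduced degree by one.\<close>

lemma bar_diff_sg:
  fixes G :: "('b, 'c) arr list \<Rightarrow> 'd::ab_group_add"
  shows "bar_diff A (\<lambda>gs. sg (c + rdegs gs) (G gs)) fs = - sg (c + rdegs fs) (bar_diff A G fs)"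
proof (induction fs arbitrary: c G)
  case (Cons f fs)
  have 1: "sg (rdegs fs) (sg (c + rdegs (d_arr A f # fs)) z) = - sg (c + rdegs (f # fs)) (sg (rdegs fs) z)" for z :: 'd
    unfolding sg_sg by (rule sg_parity_minus) (simp add: d_arr_def)
  have 2: "sg (c + rdegs (cmp_arr A g f # gs)) z = - sg (c + rdegs (f # g # gs)) z" for g gs and z :: 'd
    by (rule sg_parity_minus) (simp add: cmp_arr_def)
  have 3: "bar_diff A (\<lambda>gs. sg (c + rdegs (f # gs)) (G (f # gs))) fs
      = - sg (c + rdegs (f # fs)) (bar_diff A (\<lambda>gs. G (f # gs)) fs)"
    using Cons.IH[of "c + deg f + 1" "\<lambda>gs. G (f # gs)"] by (simp add: algebra_simps)
  show ?case
    unfolding bar_diff.simps 1 3 by (cases fs) (simp_all add: 2 sg_add sg_diff del: rdegs_simps)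
qed simp

text \<open>The form in which A-infinity functors are used below: length and degrees in the sign of
  a product combine to one reduced degree, additivity and homogeneity to one condition on linear
  combinations.\<close>

lemma ainf_functor_iff:
  assumes "linear_dg A" "linear_dg D"
  shows "ainf_functor A D F0 F \<longleftrightarrow>
    (\<forall>x\<in>obs A. F0 x \<in> obs D) \<and>
    (\<forall>fs. composable A fs \<longrightarrow> is_arr D (taylor_arr F0 F fs)) \<and>
    (\<forall>x y. multilinear A (scl D) x y F) \<and>
    (\<forall>fs. composable A fs \<longrightarrow>
      dif D (taylor_arr F0 F fs) + (\<Sum>b\<in>{1..<length fs}. sg ((int b - 1) * rdegs (drop b fs))
        (cmp D (taylor_arr F0 F (drop b fs)) (taylor_arr F0 F (take b fs)))) = bar_diff A F fs)"
proof -
  interpret A: linear_dg A by fact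
  interpret D: linear_dg D by fact
  have lin: "(\<forall>us x y k u v vs.
        composable A (us @ Arr x y k u # vs) \<longrightarrow> composable A (us @ Arr x y k v # vs) \<longrightarrow>
        F (us @ Arr x y k (u + v) # vs) = F (us @ Arr x y k u # vs) + F (us @ Arr x y k v # vs)) \<and>
     (\<forall>us x y k u c vs.
        composable A (us @ Arr x y k u # vs) \<longrightarrow>
        F (us @ Arr x y k (scl A c u) # vs) = scl D c (F (us @ Arr x y k u # vs)))
     \<longleftrightarrow> (\<forall>x y. multilinear A (scl D) x y F)" (is "?l1 \<and> ?l2 \<longleftrightarrow> ?r")
  proof
    assume l: "?l1 \<and> ?l2"
    show ?r
      unfolding multilinear_def
    proof (intro allI impI)
      fix x y us x' y' k u v vs a b
      assume *: "seg A x y (us @ Arr x' y' k u # vs)" "seg A x y (us @ Arr x' y' k v # vs)"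
      have "seg A x y (us @ Arr x' y' k (scl A a u) # vs)" "seg A x y (us @ Arr x' y' k (scl A b v) # vs)"
        using * by (auto simp: seg_append is_arr_def intro!: A.Hom_scl)
      with * l show "F (us @ Arr x' y' k (scl A a u + scl A b v) # vs)
        = scl D a (F (us @ Arr x' y' k u # vs)) + scl D b (F (us @ Arr x' y' k v # vs))"
        using seg_imp_composable[of A x y "us @ _ # vs"] by simp
    qed
  next
    assume r: ?r
    show "?l1 \<and> ?l2"
    proof (intro conjI allI impI)
      fix us x' y' k u v vs
      assume *: "composable A (us @ Arr x' y' k u # vs)" "composable A (us @ Arr x' y' k v # vs)"
      \<comment> \<open>The two words differ only in the value of one letter, so they have the same
        ends, even if that letter is the first or the last.\<close>
      define x y where "x = src (hd (us @ Arr x' y' k u # vs))" "y = tgt (last (us @ Arr x' y' k u # vs))"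
      have "x = src (hd (us @ Arr x' y' k v # vs))" "y = tgt (last (us @ Arr x' y' k v # vs))"
        by (cases us; cases vs; simp add: x_y_def)+
      then have "seg A x y (us @ Arr x' y' k u # vs)" "seg A x y (us @ Arr x' y' k v # vs)"
        using *[THEN composable_imp_seg] by (auto simp: x_y_def)
      with r[unfolded multilinear_def, rule_format, of x y us x' y' k u vs v 1 1]
      show "F (us @ Arr x' y' k (u + v) # vs) = F (us @ Arr x' y' k u # vs) + F (us @ Arr x' y' k v # vs)"
        by simp
    next
      fix us x' y' k u c vs
      assume *: "composable A (us @ Arr x' y' k u # vs)"
      from r[unfolded multilinear_def, rule_format, OF composable_imp_seg[OF *] composable_imp_seg[OF *], of c 0]
      show "F (us @ Arr x' y' k (scl A c u) # vs) = scl D c (F (us @ Arr x' y' k u # vs))"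
        by simp
    qed
  qed
  have sgn: "sg ((int b - 1) * (int (length fs - b) + degs (drop b fs))) = sg ((int b - 1) * rdegs (drop b fs))"
    for b and fs :: "('b, 'c) arr list"
    by (simp add: rdegs_eq add.commute)
  show ?thesis
    unfolding ainf_functor_def Let_def bar_diff_eq sgn lin[symmetric] by blast
qed

text \<open>This is what keeps the hypothesis of inductions along words alive: with its first letter
  fixed, \<open>G\<close> stays multilinear, with the left end moved to the target of that letter.
  For this reason \<open>multilinear\<close> carries the ends as arguments.\<close>

lemma multilinear_Cons:
  assumes "multilinear A s x y G" "is_arr A f" "src f = x" "tgt f = z"
  shows "multilinear A s z y (\<lambda>fs. G (f # fs))"
  unfolding multilinear_def
proof (intro allI impI)
  fix us x' y' k u v vs a b
  assume *: "seg A z y (us @ Arr x' y' k u # vs)" "seg A z y (us @ Arr x' y' k v # vs)"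
  show "G (f # us @ Arr x' y' k (scl A a u + scl A b v) # vs)
      = s a (G (f # us @ Arr x' y' k u # vs)) + s b (G (f # us @ Arr x' y' k v # vs))"
    using assms(1)[unfolded multilinear_def, rule_format, of "f # us" x' y' k u vs v a b] * assms(2-4)
    by simp
qed

text \<open>Inductions along paths decompose only the first letter of a word, so linearity is made
  available in that slot.\<close>

lemma (in linear_dg) multilinear_head:
  assumes G: "multilinear A s x y G" and s: "vector_space s"
    and w: "seg A t y w" and xt: "x \<in> obs A" "t \<in> obs A"
  shows multilinear_add: "u \<in> Hom A x t k \<Longrightarrow> v \<in> Hom A x t k \<Longrightarrow>
      G (Arr x t k (u + v) # w) = G (Arr x t k u # w) + G (Arr x t k v # w)"
    and multilinear_scl: "u \<in> Hom A x t k \<Longrightarrow> G (Arr x t k (scl A c u) # w) = s c (G (Arr x t k u # w))"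
    and multilinear_zero: "G (Arr x t k 0 # w) = 0"
    and multilinear_sg: "u \<in> Hom A x t k \<Longrightarrow> G (Arr x t k (sg e u) # w) = sg e (G (Arr x t k u # w))"
    and multilinear_sum: "(\<And>i. i \<in> I \<Longrightarrow> h i \<in> Hom A x t k) \<Longrightarrow>
      G (Arr x t k (sum h I) # w) = (\<Sum>i\<in>I. G (Arr x t k (h i) # w))"
proof -
  interpret s: vector_space s by fact
  note ml = G[unfolded multilinear_def, rule_format, of "[]" x t k _ w]
  show add: "G (Arr x t k (u + v) # w) = G (Arr x t k u # w) + G (Arr x t k v # w)"
    if "u \<in> Hom A x t k" "v \<in> Hom A x t k" for u v
    using ml[of u v 1 1] that w xt by (simp add: is_arr_def)
  show sc: "G (Arr x t k (scl A c u) # w) = s c (G (Arr x t k u # w))"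
    if "u \<in> Hom A x t k" for c u
    using ml[of u u c 0] that w xt by (simp add: is_arr_def)
  show z: "G (Arr x t k 0 # w) = 0"
    using sc[of 0 0] Hom_zero[OF xt] by simp
  show "G (Arr x t k (sg e u) # w) = sg e (G (Arr x t k u # w))" if "u \<in> Hom A x t k"
    using sc[of u "-1"] that by (simp add: sg_def)
  show "G (Arr x t k (sum h I) # w) = (\<Sum>i\<in>I. G (Arr x t k (h i) # w))"
    if "\<And>i. i \<in> I \<Longrightarrow> h i \<in> Hom A x t k"
    using that
    by (induction I rule: infinite_finite_induct) (simp_all add: z add Hom_sum[OF xt])
qed

section \<open>Augmentations and shifts\<close>
lemma proj_arr_simps [simp]:
  "src (proj_arr f) = src f" "tgt (proj_arr f) = tgt f" "deg (proj_arr f) = deg f" "val (proj_arr f) = fst (val f)"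
  by (simp_all add: proj_arr_def)

lemma d_arr_simps [simp]:
  "src (d_arr A f) = src f" "tgt (d_arr A f) = tgt f" "deg (d_arr A f) = deg f + 1" "val (d_arr A f) = dif A f"
  by (simp_all add: d_arr_def)

lemma cmp_arr_simps [simp]:
  "src (cmp_arr A g f) = src f" "tgt (cmp_arr A g f) = tgt g" "deg (cmp_arr A g f) = deg g + deg f"
  "val (cmp_arr A g f) = cmp A g f"
  by (simp_all add: cmp_arr_def)

lemma Arr_collapse: "src f = x \<Longrightarrow> tgt f = y \<Longrightarrow> deg f = k \<Longrightarrow> Arr x y k (val f) = f"
  by auto

context nonunital_dg_category
begin

lemma arr_obs: "is_arr C f \<Longrightarrow> src f \<in> obs C \<and> tgt f \<in> obs C"
  by (simp add: is_arr_def)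

lemma arr_add: "is_arr C (Arr x y k u) \<Longrightarrow> is_arr C (Arr x y k v) \<Longrightarrow> is_arr C (Arr x y k (u + v))"
  by (auto simp: is_arr_def intro: Hom_add)

lemma arr_diff: "is_arr C (Arr x y k u) \<Longrightarrow> is_arr C (Arr x y k v) \<Longrightarrow> is_arr C (Arr x y k (u - v))"
  by (auto simp: is_arr_def intro: Hom_diff)

lemma arr_sg: "is_arr C (Arr x y k u) \<Longrightarrow> is_arr C (Arr x y k (sg e u))"
  by (auto simp: is_arr_def intro: Hom_sg)

lemma arr_zero: "x \<in> obs C \<Longrightarrow> y \<in> obs C \<Longrightarrow> is_arr C (Arr x y k 0)"
  by (auto simp: is_arr_def intro: Hom_zero)

lemma arr_sum: "x \<in> obs C \<Longrightarrow> y \<in> obs C \<Longrightarrow> (\<And>i. i \<in> I \<Longrightarrow> is_arr C (Arr x y k (u i))) \<Longrightarrow>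
    is_arr C (Arr x y k (sum u I))"
  by (auto simp: is_arr_def intro: Hom_sum)

lemma arr_cmp: "is_arr C (Arr x y k u) \<Longrightarrow> is_arr C (Arr y z l v) \<Longrightarrow> m = l + k \<Longrightarrow>
    is_arr C (Arr x z m (cmp C (Arr y z l v) (Arr x y k u)))"
  using cmp_arr[of "Arr x y k u" "Arr y z l v"] by (simp add: cmp_arr_def)

lemma arr_dif: "is_arr C (Arr x y k u) \<Longrightarrow> is_arr C (Arr x y (k + 1) (dif C (Arr x y k u)))"
  using dif_arr[of "Arr x y k u"] by (simp add: d_arr_def)

lemma dif_zero: "x \<in> obs C \<Longrightarrow> y \<in> obs C \<Longrightarrow> dif C (Arr x y k 0) = 0"
  using dif_scl[of x y k 0 0] arr_zero[of x y k] by simp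

lemma dif_sg: "is_arr C (Arr x y k u) \<Longrightarrow> dif C (Arr x y k (sg e u)) = sg e (dif C (Arr x y k u))"
  using dif_scl[of x y k u "-1"] by (simp add: sg_def)

lemma dif_diff: "is_arr C (Arr x y k u) \<Longrightarrow> is_arr C (Arr x y k v) \<Longrightarrow>
    dif C (Arr x y k (u - v)) = dif C (Arr x y k u) - dif C (Arr x y k v)"
  using dif_add[of x y k u "sg 1 v"] arr_sg[of x y k v 1] dif_sg[of x y k v 1]
  by (simp add: sg_def)

lemma dif_sum: "x \<in> obs C \<Longrightarrow> y \<in> obs C \<Longrightarrow> (\<And>i. i \<in> I \<Longrightarrow> is_arr C (Arr x y k (u i))) \<Longrightarrow>
    dif C (Arr x y k (sum u I)) = (\<Sum>i\<in>I. dif C (Arr x y k (u i)))"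
  by (induction I rule: infinite_finite_induct) (simp_all add: dif_zero dif_add arr_sum)

lemma cmp_add_left': "is_arr C (Arr x y l v) \<Longrightarrow> is_arr C (Arr y z k u) \<Longrightarrow> is_arr C (Arr y z k u') \<Longrightarrow>
    cmp C (Arr y z k (u + u')) (Arr x y l v) = cmp C (Arr y z k u) (Arr x y l v) + cmp C (Arr y z k u') (Arr x y l v)"
  using cmp_add_left[of "Arr x y l v" z k u u'] by simp

lemma cmp_scl_left': "is_arr C (Arr x y l v) \<Longrightarrow> is_arr C (Arr y z k u) \<Longrightarrow>
    cmp C (Arr y z k (scl C c u)) (Arr x y l v) = scl C c (cmp C (Arr y z k u) (Arr x y l v))"
  using cmp_scl_left[of "Arr x y l v" z k u c] by simp

lemma cmp_add_right': "is_arr C (Arr y z l v) \<Longrightarrow> is_arr C (Arr x y k u) \<Longrightarrow> is_arr C (Arr x y k u') \<Longrightarrow>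
    cmp C (Arr y z l v) (Arr x y k (u + u')) = cmp C (Arr y z l v) (Arr x y k u) + cmp C (Arr y z l v) (Arr x y k u')"
  using cmp_add_right[of "Arr y z l v" x k u u'] by simp

lemma cmp_scl_right': "is_arr C (Arr y z l v) \<Longrightarrow> is_arr C (Arr x y k u) \<Longrightarrow>
    cmp C (Arr y z l v) (Arr x y k (scl C c u)) = scl C c (cmp C (Arr y z l v) (Arr x y k u))"
  using cmp_scl_right[of "Arr y z l v" x k u c] by simp

lemma cmp_zero_left: "is_arr C (Arr x y l v) \<Longrightarrow> z \<in> obs C \<Longrightarrow> cmp C (Arr y z k 0) (Arr x y l v) = 0"
  using cmp_scl_left'[of x y l v z k 0 0] arr_zero[of y z k] arr_obs[of "Arr x y l v"] by simp

lemma cmp_zero_right: "is_arr C (Arr y z l v) \<Longrightarrow> x \<in> obs C \<Longrightarrow> cmp C (Arr y z l v) (Arr x y k 0) = 0"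
  using cmp_scl_right'[of y z l v x k 0 0] arr_zero[of x y k] arr_obs[of "Arr y z l v"] by simp

lemma cmp_sg_left: "is_arr C f \<Longrightarrow> tgt f = y \<Longrightarrow> is_arr C (Arr y z k u) \<Longrightarrow>
    cmp C (Arr y z k (sg e u)) f = sg e (cmp C (Arr y z k u) f)"
  using cmp_scl_left[of f z k u "-1"] by (auto simp: sg_def)

lemma cmp_sg_right: "is_arr C g \<Longrightarrow> src g = y \<Longrightarrow> is_arr C (Arr x y k u) \<Longrightarrow>
    cmp C g (Arr x y k (sg e u)) = sg e (cmp C g (Arr x y k u))"
  using cmp_scl_right[of g x k u "-1"] by (auto simp: sg_def)

lemma cmp_diff_left: "is_arr C (Arr x y l v) \<Longrightarrow> is_arr C (Arr y z k u) \<Longrightarrow> is_arr C (Arr y z k u') \<Longrightarrow>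
    cmp C (Arr y z k (u - u')) (Arr x y l v) = cmp C (Arr y z k u) (Arr x y l v) - cmp C (Arr y z k u') (Arr x y l v)"
  using cmp_add_left'[of x y l v z k u "sg 1 u'"] cmp_sg_left[of "Arr x y l v" y z k u' 1] arr_sg[of y z k u' 1]
  by (simp add: sg_def)

lemma cmp_diff_right: "is_arr C (Arr y z l v) \<Longrightarrow> is_arr C (Arr x y k u) \<Longrightarrow> is_arr C (Arr x y k u') \<Longrightarrow>
    cmp C (Arr y z l v) (Arr x y k (u - u')) = cmp C (Arr y z l v) (Arr x y k u) - cmp C (Arr y z l v) (Arr x y k u')"
  using cmp_add_right'[of y z l v x k u "sg 1 u'"] cmp_sg_right[of "Arr y z l v" y x k u' 1] arr_sg[of x y k u' 1]
  by (simp add: sg_def)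

lemma cmp_sum_left: "is_arr C (Arr x y l v) \<Longrightarrow> z \<in> obs C \<Longrightarrow> (\<And>i. i \<in> I \<Longrightarrow> is_arr C (Arr y z k (u i))) \<Longrightarrow>
    cmp C (Arr y z k (sum u I)) (Arr x y l v) = (\<Sum>i\<in>I. cmp C (Arr y z k (u i)) (Arr x y l v))"
proof (induction I rule: infinite_finite_induct)
  case (insert i I)
  then show ?case
    using arr_obs[of "Arr x y l v"] by (simp add: cmp_add_left' arr_sum)
qed (simp_all add: cmp_zero_left)

lemma cmp_sum_right: "is_arr C (Arr y z l v) \<Longrightarrow> x \<in> obs C \<Longrightarrow> (\<And>i. i \<in> I \<Longrightarrow> is_arr C (Arr x y k (u i))) \<Longrightarrow>
    cmp C (Arr y z l v) (Arr x y k (sum u I)) = (\<Sum>i\<in>I. cmp C (Arr y z l v) (Arr x y k (u i)))"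
proof (induction I rule: infinite_finite_induct)
  case (insert i I)
  then show ?case
    using arr_obs[of "Arr y z l v"] by (simp add: cmp_add_right' arr_sum)
qed (simp_all add: cmp_zero_right)

lemma Leibniz': "is_arr C (Arr x y k u) \<Longrightarrow> is_arr C (Arr y z l v) \<Longrightarrow> m = l + k \<Longrightarrow>
    dif C (Arr x z m (cmp C (Arr y z l v) (Arr x y k u)))
    = cmp C (Arr y z (l + 1) (dif C (Arr y z l v))) (Arr x y k u)
      + sg l (cmp C (Arr y z l v) (Arr x y (k + 1) (dif C (Arr x y k u))))"
  using Leibniz[of "Arr x y k u" "Arr y z l v"] by (simp add: cmp_arr_def d_arr_def)

lemma cmp_assoc': "is_arr C (Arr w x k u) \<Longrightarrow> is_arr C (Arr x y l v) \<Longrightarrow> is_arr C (Arr y z m t) \<Longrightarrow>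
    a = l + k \<Longrightarrow> b = m + l \<Longrightarrow>
    cmp C (Arr x z b (cmp C (Arr y z m t) (Arr x y l v))) (Arr w x k u)
    = cmp C (Arr y z m t) (Arr w y a (cmp C (Arr x y l v) (Arr w x k u)))"
  using cmp_assoc[of "Arr w x k u" "Arr x y l v" "Arr y z m t"] by (simp add: cmp_arr_def)

lemma dif_dif': "is_arr C (Arr x y k u) \<Longrightarrow> dif C (Arr x y (k + 1) (dif C (Arr x y k u))) = 0"
  using dif_dif[of "Arr x y k u"] by (simp add: d_arr_def)

lemma is_arr_aug: "is_arr (aug C) f \<longleftrightarrow> is_arr C (proj_arr f) \<and> (snd (val f) \<noteq> 0 \<longrightarrow> src f = tgt f \<and> deg f = 0)"
  by (auto simp: is_arr_def aug_def)

lemma proj_d_arr_aug: "proj_arr (d_arr (aug C) f) = d_arr C (proj_arr f)"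
  by (simp add: proj_arr_def d_arr_def aug_def)

lemma aug_linear: "linear_dg (aug C)"
proof (rule linear_dg.intro)
  interpret p: vector_space "scl (aug C)"
    by unfold_locales (simp_all add: aug_def scale_left_distrib scale_right_distrib distrib_left distrib_right)
  show "vector_space (scl (aug C))"
    by (rule p.vector_space_axioms)
  show "module.subspace (scl (aug C)) (Hom (aug C) x y k)" if "x \<in> obs (aug C)" "y \<in> obs (aug C)" for x y k
  proof -
    have xy: "x \<in> obs C" "y \<in> obs C"
      using that by (simp_all add: aug_def)
    show ?thesis
      unfolding p.subspace_def
      by (auto simp: aug_def intro!: Hom_zero Hom_add Hom_scl xy)
  qed
  show "is_arr (aug C) (d_arr (aug C) f)" if "is_arr (aug C) f" for f
    using that d_closed[of "proj_arr f"] unfolding is_arr_aug proj_d_arr_aug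
    by (simp add: aug_def)
  show "is_arr (aug C) (cmp_arr (aug C) g f)" if "is_arr (aug C) f" "is_arr (aug C) g" "tgt f = src g" for f g
  proof -
    have f: "is_arr C (proj_arr f)" and g: "is_arr C (proj_arr g)"
      and units: "snd (val f) \<noteq> 0 \<Longrightarrow> src f = tgt f \<and> deg f = 0" "snd (val g) \<noteq> 0 \<Longrightarrow> src g = tgt g \<and> deg g = 0"
      using that(1,2) unfolding is_arr_aug by blast+
    have obs: "src f \<in> obs C" "tgt g \<in> obs C"
      and vals: "fst (val f) \<in> Hom C (src f) (tgt f) (deg f)" "fst (val g) \<in> Hom C (src g) (tgt g) (deg g)"
      using f g by (auto simp: is_arr_def)
    have "fst (cmp (aug C) g f) \<in> Hom C (src f) (tgt g) (deg g + deg f)"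
    proof -
      have "cmp C (proj_arr g) (proj_arr f) \<in> Hom C (src f) (tgt g) (deg g + deg f)"
        using c_closed[OF f g] that by (auto simp: is_arr_def)
      \<comment> \<open>A nonzero unit coefficient of \<open>g\<close> forces \<open>g\<close> to be
        an endomorphism of degree 0, which places the multiple of \<open>f\<close> in the right
        graded piece.\<close>
      moreover have "scl C (snd (val g)) (fst (val f)) \<in> Hom C (src f) (tgt g) (deg g + deg f)"
        using that(3) obs vals units by (cases "snd (val g) = 0") (auto intro: Hom_scl Hom_zero)
      moreover have "scl C (snd (val f)) (fst (val g)) \<in> Hom C (src f) (tgt g) (deg g + deg f)"
        using that(3) obs vals units by (cases "snd (val f) = 0") (auto intro: Hom_scl Hom_zero)
      ultimately show ?thesis
        using obs by (simp add: aug_def Hom_add)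
    qed
    moreover have "snd (cmp (aug C) g f) = snd (val g) * snd (val f)"
      by (simp add: aug_def)
    ultimately show ?thesis
      unfolding is_arr_aug using that(3) obs units by (auto simp: is_arr_def)
  qed
qed

end

text \<open>The category with shifts: an object \<open>(x, r)\<close> stands for \<open>x[r]\<close>.\<close>

definition unshift :: "('o \<times> int, 'm) arr \<Rightarrow> ('o, 'm) arr" where
  "unshift f = Arr (fst (src f)) (fst (tgt f)) (deg f + snd (tgt f) - snd (src f)) (val f)"

definition shifts :: "('k, 'o, 'm::ab_group_add) dg \<Rightarrow> ('k, 'o \<times> int, 'm) dg" where
  "shifts C = \<lparr> scl = scl C, obs = obs C \<times> UNIV,
     Hom = (\<lambda>x y k. Hom C (fst x) (fst y) (k + snd y - snd x)),
     dif = (\<lambda>f. sg (snd (tgt f)) (dif C (unshift f))),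
     cmp = (\<lambda>g f. cmp C (unshift g) (unshift f)) \<rparr>"

lemma unshift_simps [simp]:
  "src (unshift f) = fst (src f)" "tgt (unshift f) = fst (tgt f)"
  "deg (unshift f) = deg f + snd (tgt f) - snd (src f)" "val (unshift f) = val f"
  by (simp_all add: unshift_def)

lemma shifts_simps:
  "scl (shifts C) = scl C" "obs (shifts C) = obs C \<times> UNIV"
  "Hom (shifts C) x y k = Hom C (fst x) (fst y) (k + snd y - snd x)"
  "dif (shifts C) f = sg (snd (tgt f)) (dif C (unshift f))"
  "cmp (shifts C) g f = cmp C (unshift g) (unshift f)"
  by (simp_all add: shifts_def)

lemma is_arr_shifts: "is_arr (shifts C) f \<longleftrightarrow> is_arr C (unshift f)"
  by (auto simp: is_arr_def shifts_simps mem_Times_iff)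

lemma unshift_cmp_arr: "tgt f = src g \<Longrightarrow> unshift (cmp_arr (shifts C) g f) = cmp_arr C (unshift g) (unshift f)"
  by (simp add: cmp_arr_def unshift_def shifts_simps)

lemma unshift_d_arr: "unshift (d_arr (shifts C) f)
    = Arr (fst (src f)) (fst (tgt f)) (deg (unshift f) + 1) (sg (snd (tgt f)) (dif C (unshift f)))"
  by (simp add: d_arr_def unshift_def shifts_simps)

lemma unshift_Arr: "unshift (Arr x y k u) = Arr (fst x) (fst y) (k + snd y - snd x) u"
  by (simp add: unshift_def)

text \<open>For the Leibniz rule with \<open>f : x[r] -> y[r']\<close> and
  \<open>g : y[r'] -> z[r'']\<close>: the degree of \<open>g\<close> in \<open>C\<close> exceeds its
  degree between shifted objects by \<open>r'' - r'\<close>. Together with the factor (-1)^r'' of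
  the differential of the composite this leaves (-1)^r', the factor in the differential of
  \<open>f\<close>.\<close>

lemma (in nonunital_dg_category) shifts_dg: "nonunital_dg_category (shifts C)"
proof (rule nonunital_dg_category.intro)
  fix f :: "('o \<times> int, 'm) arr"
  assume f: "is_arr (shifts C) f"
  then have f': "is_arr C (unshift f)"
    by (simp add: is_arr_shifts)
  note uf = arr_dif[of "src (unshift f)" "tgt (unshift f)" "deg (unshift f)" "val (unshift f)", unfolded arr.collapse, OF f']
  show "is_arr (shifts C) (d_arr (shifts C) f)"
    unfolding is_arr_shifts unshift_d_arr using arr_sg[OF uf] by simp
  show "dif (shifts C) (d_arr (shifts C) f) = 0"
    unfolding shifts_simps unshift_d_arr using dif_sg[OF uf] dif_dif[OF f'] by (simp add: d_arr_def)
  fix g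
  assume g: "is_arr (shifts C) g" and fg: "tgt f = src g"
  then have g': "is_arr C (unshift g)"
    by (simp add: is_arr_shifts)
  note ug = arr_dif[of "src (unshift g)" "tgt (unshift g)" "deg (unshift g)" "val (unshift g)", unfolded arr.collapse, OF g']
  have fg': "tgt (unshift f) = src (unshift g)"
    using fg by simp
  show "is_arr (shifts C) (cmp_arr (shifts C) g f)"
    unfolding is_arr_shifts unshift_cmp_arr[OF fg] by (rule cmp_arr[OF f' g' fg'])
  have 1: "cmp C (unshift (d_arr (shifts C) g)) (unshift f) = sg (snd (tgt g)) (cmp C (d_arr C (unshift g)) (unshift f))"
    unfolding unshift_d_arr using cmp_sg_left[OF f' fg' ug] by (simp add: d_arr_def)
  have 2: "cmp C (unshift g) (unshift (d_arr (shifts C) f)) = sg (snd (tgt f)) (cmp C (unshift g) (d_arr C (unshift f)))"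
    unfolding unshift_d_arr using cmp_sg_right[OF g' fg'[symmetric] uf] fg by (simp add: d_arr_def)
  show "dif (shifts C) (cmp_arr (shifts C) g f)
      = cmp (shifts C) (d_arr (shifts C) g) f + sg (deg g) (cmp (shifts C) g (d_arr (shifts C) f))"
    unfolding shifts_simps unshift_cmp_arr[OF fg] Leibniz[OF f' g' fg'] 1 2 sg_add sg_sg
    using fg by (auto intro!: sg_parity arg_cong2[of _ _ _ _ "(+)"])
  fix h
  assume h: "is_arr (shifts C) h" and gh: "tgt g = src h"
  show "cmp (shifts C) h (cmp_arr (shifts C) g f) = cmp (shifts C) (cmp_arr (shifts C) h g) f"
    using cmp_assoc[OF f' g'] h fg gh
    by (simp add: shifts_simps unshift_cmp_arr is_arr_shifts)
qed (auto simp: shifts_simps is_arr_shifts unshift_Arr vector_space dif_add dif_scl sg_add scl_sg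
  intro!: subspace_Hom cmp_add_left[of "unshift _", simplified] cmp_add_right[of "unshift _", simplified]
    cmp_scl_left[of "unshift _", simplified] cmp_scl_right[of "unshift _", simplified])

section \<open>Matrices and twisting\<close>
definition ent :: "('s list, nat \<Rightarrow> nat \<Rightarrow> 'm) arr \<Rightarrow> nat \<Rightarrow> nat \<Rightarrow> ('s, 'm) arr" where
  "ent f i j = Arr (src f ! i) (tgt f ! j) (deg f) (val f i j)"

text \<open>In a composition the left factor is given the source \<open>tgt f\<close> instead of
  \<open>src g\<close>, as in \<open>pretr\<close>. Thus \<open>pretr_eq\<close> is an equality of
  records that holds on all pairs of arguments, composable or not.\<close>

definition mat :: "('k, 's, 'm::ab_group_add) dg \<Rightarrow> ('k, 's list, nat \<Rightarrow> nat \<Rightarrow> 'm) dg" where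
  "mat S = \<lparr> scl = (\<lambda>c \<phi> i j. scl S c (\<phi> i j)),
     obs = {X. set X \<subseteq> obs S},
     Hom = (\<lambda>X Y k. {\<phi>. \<forall>i j. if i < length X \<and> j < length Y then \<phi> i j \<in> Hom S (X ! i) (Y ! j) k else \<phi> i j = 0}),
     dif = (\<lambda>f i j. if i < length (src f) \<and> j < length (tgt f) then dif S (ent f i j) else 0),
     cmp = (\<lambda>g f i j. if i < length (src f) \<and> j < length (tgt g)
       then \<Sum>l<length (tgt f). cmp S (Arr (tgt f ! l) (tgt g ! j) (deg g) (val g l j)) (ent f i l) else 0) \<rparr>"

lemma scl_mat: "scl (mat S) c \<phi> i j = scl S c (\<phi> i j)"
  by (simp add: mat_def)

lemma dif_mat: "dif (mat S) f i j = (if i < length (src f) \<and> j < length (tgt f) then dif S (ent f i j) else 0)"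
  by (simp add: mat_def)

lemma cmp_mat: "tgt f = src g \<Longrightarrow> cmp (mat S) g f i j = (if i < length (src f) \<and> j < length (tgt g)
    then \<Sum>l<length (tgt f). cmp S (ent g l j) (ent f i l) else 0)"
  by (simp add: mat_def ent_def)

lemma is_arr_mat: "is_arr (mat S) f \<longleftrightarrow> set (src f) \<subseteq> obs S \<and> set (tgt f) \<subseteq> obs S \<and>
    (\<forall>i j. if i < length (src f) \<and> j < length (tgt f) then is_arr S (ent f i j) else val f i j = 0)"
  by (auto simp: is_arr_def mat_def ent_def subset_iff)

lemma is_arr_ent: "is_arr (mat S) f \<Longrightarrow> i < length (src f) \<Longrightarrow> j < length (tgt f) \<Longrightarrow> is_arr S (ent f i j)"
  unfolding is_arr_mat by meson

lemma ent_d_arr: "i < length (src f) \<Longrightarrow> j < length (tgt f) \<Longrightarrow> ent (d_arr (mat S) f) i j = d_arr S (ent f i j)"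
  by (simp add: ent_def d_arr_def mat_def)

lemma ent_cmp_arr: "tgt f = src g \<Longrightarrow> i < length (src f) \<Longrightarrow> j < length (tgt g) \<Longrightarrow> ent (cmp_arr (mat S) g f) i j
    = Arr (src f ! i) (tgt g ! j) (deg g + deg f) (\<Sum>l<length (tgt f). cmp S (ent g l j) (ent f i l))"
  by (simp add: ent_def cmp_arr_def cmp_mat)

lemma ent_simps [simp]:
  "src (ent f i j) = src f ! i" "tgt (ent f i j) = tgt f ! j" "deg (ent f i j) = deg f" "val (ent f i j) = val f i j"
  by (simp_all add: ent_def)

lemma ent_Arr: "ent (Arr X Y k \<phi>) i j = Arr (X ! i) (Y ! j) k (\<phi> i j)"
  by (simp add: ent_def)

lemma sum_apply2: "sum f A i j = (\<Sum>x\<in>A. f x i j)"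
  by (induction A rule: infinite_finite_induct) (simp_all add: plus_fun_def zero_fun_def)

context nonunital_dg_category
begin

lemma cmp_sum_left_ent:
  "is_arr C f \<Longrightarrow> tgt f = y \<Longrightarrow> z \<in> obs C \<Longrightarrow> (\<And>i. i \<in> I \<Longrightarrow> is_arr C (Arr y z k (u i))) \<Longrightarrow>
    cmp C (Arr y z k (sum u I)) f = (\<Sum>i\<in>I. cmp C (Arr y z k (u i)) f)"
  using cmp_sum_left[of "src f" y "deg f" "val f" z I k u] by (simp add: Arr_collapse)

lemma cmp_sum_right_ent:
  "is_arr C g \<Longrightarrow> src g = y \<Longrightarrow> x \<in> obs C \<Longrightarrow> (\<And>i. i \<in> I \<Longrightarrow> is_arr C (Arr x y k (u i))) \<Longrightarrow>
    cmp C g (Arr x y k (sum u I)) = (\<Sum>i\<in>I. cmp C g (Arr x y k (u i)))"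
  using cmp_sum_right[of y "tgt g" "deg g" "val g" x I k u] by (simp add: Arr_collapse)

lemma mat_dg: "nonunital_dg_category (mat C)"
proof (rule nonunital_dg_category.intro)
  show "vector_space (scl (mat C))"
    by unfold_locales (auto simp: mat_def fun_eq_iff scale_left_distrib scale_right_distrib)
  then interpret v: vector_space "scl (mat C)" .
  show "module.subspace (scl (mat C)) (Hom (mat C) x y k)" if "x \<in> obs (mat C)" "y \<in> obs (mat C)" for x y k
    using that unfolding v.subspace_def
    by (auto simp: mat_def subset_iff Hom_zero Hom_add Hom_scl)
  fix f
  assume f: "is_arr (mat C) f"
  have obf: "i < length (src f) \<Longrightarrow> src f ! i \<in> obs C" "i < length (tgt f) \<Longrightarrow> tgt f ! i \<in> obs C" for i
    using f by (auto simp: is_arr_mat subset_iff)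
  show "is_arr (mat C) (d_arr (mat C) f)"
    using f d_closed unfolding is_arr_mat
    by (auto simp: ent_d_arr) (auto simp: mat_def)
  show "dif (mat C) (d_arr (mat C) f) = 0"
  proof (intro ext)
    fix i j
    show "dif (mat C) (d_arr (mat C) f) i j = 0 i j"
      using dif_dif[OF is_arr_ent[OF f]] ent_d_arr[of i f j C] by (auto simp: mat_def)
  qed
  fix g
  assume g: "is_arr (mat C) g" and fg: "tgt f = src g"
  have obg: "i < length (src g) \<Longrightarrow> src g ! i \<in> obs C" "i < length (tgt g) \<Longrightarrow> tgt g ! i \<in> obs C" for i
    using g by (auto simp: is_arr_mat subset_iff)
  have gf: "is_arr C (cmp_arr C (ent g l j) (ent f i l))"
    if "i < length (src f)" "j < length (tgt g)" "l < length (tgt f)" for i j l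
    using that fg by (intro c_closed is_arr_ent f g) auto
  have gf': "is_arr C (Arr (src f ! i) (tgt g ! j) (deg g + deg f) (cmp C (ent g l j) (ent f i l)))"
    if "i < length (src f)" "j < length (tgt g)" "l < length (tgt f)" for i j l
    using gf[OF that] by (simp add: cmp_arr_def)
  show "is_arr (mat C) (cmp_arr (mat C) g f)"
    using f g unfolding is_arr_mat
    by (auto simp: ent_cmp_arr[OF fg] intro!: arr_sum obf obg gf') (auto simp: mat_def)
  show "dif (mat C) (cmp_arr (mat C) g f)
      = cmp (mat C) (d_arr (mat C) g) f + sg (deg g) (cmp (mat C) g (d_arr (mat C) f))"
  proof (intro ext)
    fix i j
    show "dif (mat C) (cmp_arr (mat C) g f) i j
      = (cmp (mat C) (d_arr (mat C) g) f + sg (deg g) (cmp (mat C) g (d_arr (mat C) f))) i j"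
    proof (cases "i < length (src f) \<and> j < length (tgt g)")
      case True
      have L: "dif C (Arr (src f ! i) (tgt g ! j) (deg g + deg f) (cmp C (ent g l j) (ent f i l)))
         = cmp C (d_arr C (ent g l j)) (ent f i l) + sg (deg g) (cmp C (ent g l j) (d_arr C (ent f i l)))"
        if "l < length (tgt f)" for l
        using Leibniz[of "ent f i l" "ent g l j"] is_arr_ent[OF f, of i l] is_arr_ent[OF g, of l j] True that fg
        by (simp add: cmp_arr_def)
      have "dif (mat C) (cmp_arr (mat C) g f) i j
         = (\<Sum>l<length (tgt f). cmp C (d_arr C (ent g l j)) (ent f i l) + sg (deg g) (cmp C (ent g l j) (d_arr C (ent f i l))))"
        using True fg by (simp add: dif_mat ent_cmp_arr)
          (subst dif_sum, auto simp: L intro!: obf obg gf')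
      also have "\<dots> = (cmp (mat C) (d_arr (mat C) g) f + sg (deg g) (cmp (mat C) g (d_arr (mat C) f))) i j"
        using True fg by (simp add: cmp_mat sg_apply ent_d_arr sum.distrib sg_sum)
      finally show ?thesis .
    qed (auto simp: mat_def sg_apply)
  qed
  fix h
  assume h: "is_arr (mat C) h" and gh: "tgt g = src h"
  have obh: "i < length (tgt h) \<Longrightarrow> tgt h ! i \<in> obs C" for i
    using h by (auto simp: is_arr_mat subset_iff)
  have hg': "is_arr C (Arr (src g ! i) (tgt h ! j) (deg h + deg g) (cmp C (ent h l j) (ent g i l)))"
    if "i < length (src g)" "j < length (tgt h)" "l < length (tgt g)" for i j l
    using c_closed[of "ent g i l" "ent h l j"] that gh is_arr_ent[OF g, of i l] is_arr_ent[OF h, of l j] by (simp add: cmp_arr_def)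
  show "cmp (mat C) h (cmp_arr (mat C) g f) = cmp (mat C) (cmp_arr (mat C) h g) f"
  proof (intro ext)
    fix i j
    show "cmp (mat C) h (cmp_arr (mat C) g f) i j = cmp (mat C) (cmp_arr (mat C) h g) f i j"
    proof (cases "i < length (src f) \<and> j < length (tgt h)")
      case True
      have *: "cmp C (ent h l j) (Arr (src f ! i) (tgt g ! l) (deg g + deg f) (cmp C (ent g m l) (ent f i m)))
          = cmp C (Arr (src g ! m) (tgt h ! j) (deg h + deg g) (cmp C (ent h l j) (ent g m l))) (ent f i m)"
        if "m < length (tgt f)" "l < length (tgt g)" for l m
        using cmp_assoc[of "ent f i m" "ent g m l" "ent h l j"] that True fg gh
        by (simp add: cmp_arr_def is_arr_ent f g h)
      have "cmp (mat C) h (cmp_arr (mat C) g f) i j = (\<Sum>l<length (tgt g). \<Sum>m<length (tgt f).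
          cmp C (ent h l j) (Arr (src f ! i) (tgt g ! l) (deg g + deg f) (cmp C (ent g m l) (ent f i m))))"
        using True gh
        by (simp add: fg[symmetric] gh[symmetric] cmp_mat ent_cmp_arr)
          (intro sum.cong refl cmp_sum_right_ent is_arr_ent h, auto simp: gh[symmetric] intro!: obf gf')
      also have "\<dots> = (\<Sum>m<length (tgt f). \<Sum>l<length (tgt g).
          cmp C (Arr (src g ! m) (tgt h ! j) (deg h + deg g) (cmp C (ent h l j) (ent g m l))) (ent f i m))"
        using * by (subst sum.swap) (auto intro!: sum.cong)
      also have "\<dots> = cmp (mat C) (cmp_arr (mat C) h g) f i j"
        using True
        by (simp add: fg gh[symmetric] cmp_mat ent_cmp_arr)
          (intro sum.cong refl cmp_sum_left_ent[symmetric] is_arr_ent f, auto simp: fg intro!: obh hg')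
      finally show ?thesis .
    qed (auto simp: mat_def)
  qed
next
  fix x y k u v
  assume u: "is_arr (mat C) (Arr x y k u)" and v: "is_arr (mat C) (Arr x y k v)"
  show "dif (mat C) (Arr x y k (u + v)) = dif (mat C) (Arr x y k u) + dif (mat C) (Arr x y k v)"
    using is_arr_ent[OF u] is_arr_ent[OF v]
    by (auto simp: fun_eq_iff mat_def ent_Arr dif_add)
next
  fix x y k u c
  assume u: "is_arr (mat C) (Arr x y k u)"
  show "dif (mat C) (Arr x y k (scl (mat C) c u)) = scl (mat C) c (dif (mat C) (Arr x y k u))"
    using is_arr_ent[OF u]
    by (auto simp: fun_eq_iff mat_def ent_Arr dif_scl)
next
  fix f z k u v
  assume f: "is_arr (mat C) f" and u: "is_arr (mat C) (Arr (tgt f) z k u)" and v: "is_arr (mat C) (Arr (tgt f) z k v)"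
  have "cmp C (Arr (tgt f ! l) (z ! j) k (u l j + v l j)) (ent f i l)
      = cmp C (Arr (tgt f ! l) (z ! j) k (u l j)) (ent f i l) + cmp C (Arr (tgt f ! l) (z ! j) k (v l j)) (ent f i l)"
    if "i < length (src f)" "j < length z" "l < length (tgt f)" for i j l
    using cmp_add_left[of "ent f i l" "z ! j" k "u l j" "v l j"] is_arr_ent[OF f] is_arr_ent[OF u] is_arr_ent[OF v] that
    by (simp add: ent_Arr)
  then show "cmp (mat C) (Arr (tgt f) z k (u + v)) f
      = cmp (mat C) (Arr (tgt f) z k u) f + cmp (mat C) (Arr (tgt f) z k v) f"
    by (auto simp: fun_eq_iff cmp_mat ent_Arr sum.distrib)
next
  fix f z k u c
  assume f: "is_arr (mat C) f" and u: "is_arr (mat C) (Arr (tgt f) z k u)"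
  have "cmp C (Arr (tgt f ! l) (z ! j) k (scl C c (u l j))) (ent f i l)
      = scl C c (cmp C (Arr (tgt f ! l) (z ! j) k (u l j)) (ent f i l))"
    if "i < length (src f)" "j < length z" "l < length (tgt f)" for i j l
    using cmp_scl_left[of "ent f i l" "z ! j" k "u l j" c] is_arr_ent[OF f] is_arr_ent[OF u] that
    by (simp add: ent_Arr)
  then show "cmp (mat C) (Arr (tgt f) z k (scl (mat C) c u)) f = scl (mat C) c (cmp (mat C) (Arr (tgt f) z k u) f)"
    by (auto simp: fun_eq_iff cmp_mat ent_Arr scl_mat scale_sum_right)
next
  fix g x k u v
  assume g: "is_arr (mat C) g" and u: "is_arr (mat C) (Arr x (src g) k u)" and v: "is_arr (mat C) (Arr x (src g) k v)"
  have "cmp C (ent g l j) (Arr (x ! i) (src g ! l) k (u i l + v i l))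
      = cmp C (ent g l j) (Arr (x ! i) (src g ! l) k (u i l)) + cmp C (ent g l j) (Arr (x ! i) (src g ! l) k (v i l))"
    if "i < length x" "j < length (tgt g)" "l < length (src g)" for i j l
    using cmp_add_right[of "ent g l j" "x ! i" k "u i l" "v i l"] is_arr_ent[OF g] is_arr_ent[OF u] is_arr_ent[OF v] that
    by (simp add: ent_Arr)
  then show "cmp (mat C) g (Arr x (src g) k (u + v))
      = cmp (mat C) g (Arr x (src g) k u) + cmp (mat C) g (Arr x (src g) k v)"
    by (auto simp: fun_eq_iff cmp_mat ent_Arr sum.distrib)
next
  fix g x k u c
  assume g: "is_arr (mat C) g" and u: "is_arr (mat C) (Arr x (src g) k u)"
  have "cmp C (ent g l j) (Arr (x ! i) (src g ! l) k (scl C c (u i l)))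
      = scl C c (cmp C (ent g l j) (Arr (x ! i) (src g ! l) k (u i l)))"
    if "i < length x" "j < length (tgt g)" "l < length (src g)" for i j l
    using cmp_scl_right[of "ent g l j" "x ! i" k "u i l" c] is_arr_ent[OF g] is_arr_ent[OF u] that
    by (simp add: ent_Arr)
  then show "cmp (mat C) g (Arr x (src g) k (scl (mat C) c u)) = scl (mat C) c (cmp (mat C) g (Arr x (src g) k u))"
    by (auto simp: fun_eq_iff cmp_mat ent_Arr scl_mat scale_sum_right)
qed

end

section \<open>Twisting by Maurer-Cartan elements\<close>

definition untwist :: "('x \<times> 'q, 'm) arr \<Rightarrow> ('x, 'm) arr" where
  "untwist f = Arr (fst (src f)) (fst (tgt f)) (deg f) (val f)"

definition mc_arr :: "'x \<times> 'm \<Rightarrow> ('x, 'm) arr" where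
  "mc_arr X = Arr (fst X) (fst X) 1 (snd X)"

text \<open>The set \<open>Q\<close> of objects is a parameter, so that one-sided twisted complexes
  can be selected among all Maurer-Cartan elements.\<close>

definition twist :: "('k, 'x, 'm::ab_group_add) dg \<Rightarrow> ('x \<times> 'm) set \<Rightarrow> ('k, 'x \<times> 'm, 'm) dg" where
  "twist A Q = \<lparr> scl = scl A, obs = Q, Hom = (\<lambda>X Y. Hom A (fst X) (fst Y)),
     dif = (\<lambda>f. dif A (untwist f) + cmp A (mc_arr (tgt f)) (untwist f)
       - sg (deg f) (cmp A (untwist f) (mc_arr (src f)))),
     cmp = (\<lambda>g f. cmp A (untwist g) (untwist f)) \<rparr>"

definition mc_set :: "('k, 'x, 'm::ab_group_add) dg \<Rightarrow> ('x \<times> 'm) set" where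
  "mc_set A = {X. is_arr A (mc_arr X) \<and> dif A (mc_arr X) + cmp A (mc_arr X) (mc_arr X) = 0}"

lemma untwist_simps [simp]:
  "src (untwist f) = fst (src f)" "tgt (untwist f) = fst (tgt f)" "deg (untwist f) = deg f" "val (untwist f) = val f"
  by (simp_all add: untwist_def)

lemma cmp_twist: "cmp (twist A Q) g f = cmp A (untwist g) (untwist f)"
  by (simp add: twist_def)

lemma scl_twist: "scl (twist A Q) = scl A"
  by (simp add: twist_def)

lemma untwist_Arr: "untwist (Arr X Y k u) = Arr (fst X) (fst Y) k u"
  by (simp add: untwist_def)

lemma untwist_cmp_arr: "untwist (cmp_arr (twist A Q) g f) = cmp_arr A (untwist g) (untwist f)"
  by (simp add: untwist_def cmp_arr_def twist_def)

lemma mc_arr_simps [simp]: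
  "src (mc_arr X) = fst X" "tgt (mc_arr X) = fst X" "deg (mc_arr X) = 1" "val (mc_arr X) = snd X"
  by (simp_all add: mc_arr_def)

context nonunital_dg_category
begin

lemma is_arr_twist: "Q \<subseteq> mc_set C \<Longrightarrow> is_arr (twist C Q) f \<longleftrightarrow> src f \<in> Q \<and> tgt f \<in> Q \<and> is_arr C (untwist f)"
  by (auto simp: is_arr_def twist_def mc_set_def)

text \<open>In the square of the twisted differential, \<open>d q' = - q' q'\<close> removes the
  terms with two factors \<open>q'\<close> on the left, likewise for \<open>q\<close> on the right,
  and the two copies of \<open>q' f q\<close> have opposite signs. In the Leibniz rule the
  Maurer-Cartan element of the middle object occurs in \<open>(g q') f\<close> and in
  \<open>g (q' f)\<close>, again with opposite signs.\<close>

lemma twist_dg: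
  assumes Q: "Q \<subseteq> mc_set C"
  shows "nonunital_dg_category (twist C Q)"
proof (rule nonunital_dg_category.intro)
  have mc: "is_arr C (mc_arr X)" "dif C (mc_arr X) + cmp C (mc_arr X) (mc_arr X) = 0" if "X \<in> Q" for X
    using that Q by (auto simp: mc_set_def)
  have ob: "fst X \<in> obs C" if "X \<in> Q" for X
    using mc[OF that] by (simp add: is_arr_def)
  note arr = is_arr_twist[OF Q]
  show "vector_space (scl (twist C Q))"
    using vec by (simp add: twist_def)
  show "module.subspace (scl (twist C Q)) (Hom (twist C Q) x y k)"
    if "x \<in> obs (twist C Q)" "y \<in> obs (twist C Q)" for x y k
    using that sub ob by (simp add: twist_def)
  fix f
  assume f: "is_arr (twist C Q) f"
  define x y X Y k u where xy: "x = fst (src f)" "y = fst (tgt f)" "X = src f" "Y = tgt f" "k = deg f" "u = val f"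
  have uf: "untwist f = Arr x y k u"
    by (simp add: untwist_def xy)
  have F: "is_arr C (Arr x y k u)" and XY: "X \<in> Q" "Y \<in> Q"
    using f unfolding arr uf by (auto simp: xy)
  define q q' where "q = snd X" and "q' = snd Y"
  have q: "mc_arr X = Arr x x 1 q" "mc_arr Y = Arr y y 1 q'"
    by (auto simp: mc_arr_def xy q_def q'_def)
  have qa: "is_arr C (Arr x x 1 q)" "is_arr C (Arr y y 1 q')"
    using mc[OF XY(1)] mc[OF XY(2)] by (auto simp: q)
  have dq: "dif C (Arr x x 1 q) = - cmp C (Arr x x 1 q) (Arr x x 1 q)"
      "dif C (Arr y y 1 q') = - cmp C (Arr y y 1 q') (Arr y y 1 q')"
    using mc[OF XY(1)] mc[OF XY(2)] by (auto simp: q eq_neg_iff_add_eq_0)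
  have dtw: "dif (twist C Q) f = dif C (Arr x y k u) + cmp C (Arr y y 1 q') (Arr x y k u)
      - sg k (cmp C (Arr x y k u) (Arr x x 1 q))"
    by (simp add: twist_def uf q[unfolded xy(3,4)]) (simp add: xy)
  have parts: "is_arr C (Arr x y (k + 1) (dif C (Arr x y k u)))"
      "is_arr C (Arr x y (k + 1) (cmp C (Arr y y 1 q') (Arr x y k u)))"
      "is_arr C (Arr x y (k + 1) (sg k (cmp C (Arr x y k u) (Arr x x 1 q))))"
      "is_arr C (Arr x y (k + 1) (cmp C (Arr x y k u) (Arr x x 1 q)))"
    using F qa by (auto intro!: arr_dif arr_sg arr_cmp)
  have dF: "is_arr C (Arr x y (k + 1) (dif (twist C Q) f))"
    unfolding dtw using parts by (intro arr_add arr_diff)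
  have ud: "untwist (d_arr (twist C Q) f) = Arr x y (k + 1) (dif (twist C Q) f)"
    by (simp add: untwist_def d_arr_def xy)
  show "is_arr (twist C Q) (d_arr (twist C Q) f)"
    using dF XY unfolding arr ud by (simp add: xy)
  have e1: "dif C (Arr x y (k + 1) (cmp C (Arr y y 1 q') (Arr x y k u)))
      = - cmp C (Arr y y 1 q') (Arr x y (k + 1) (cmp C (Arr y y 1 q') (Arr x y k u)))
        - cmp C (Arr y y 1 q') (Arr x y (k + 1) (dif C (Arr x y k u)))"
  proof -
    have "cmp C (Arr y y 2 (- cmp C (Arr y y 1 q') (Arr y y 1 q'))) (Arr x y k u)
        = - cmp C (Arr y y 2 (cmp C (Arr y y 1 q') (Arr y y 1 q'))) (Arr x y k u)"
      using cmp_sg_left[OF F, of y y 2 "cmp C (Arr y y 1 q') (Arr y y 1 q')" 1] arr_cmp[OF qa(2) qa(2)]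
      by (simp add: sg_def)
    then show ?thesis
      using Leibniz'[OF F qa(2), of "k + 1"] cmp_assoc'[OF F qa(2) qa(2), of "k + 1" 2]
      by (simp add: dq sg_def)
  qed
  have e2: "dif C (Arr x y (k + 1) (cmp C (Arr x y k u) (Arr x x 1 q)))
      = cmp C (Arr x y (k + 1) (dif C (Arr x y k u))) (Arr x x 1 q)
        - sg k (cmp C (Arr x y (k + 1) (cmp C (Arr x y k u) (Arr x x 1 q))) (Arr x x 1 q))"
  proof -
    have "cmp C (Arr x y k u) (Arr x x 2 (- cmp C (Arr x x 1 q) (Arr x x 1 q)))
        = - cmp C (Arr x y k u) (Arr x x 2 (cmp C (Arr x x 1 q) (Arr x x 1 q)))"
      using cmp_sg_right[OF F, of x x 2 "cmp C (Arr x x 1 q) (Arr x x 1 q)" 1] arr_cmp[OF qa(1) qa(1)]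
      by (simp add: sg_def)
    then show ?thesis
      using Leibniz'[OF qa(1) F, of "k + 1"] cmp_assoc'[OF qa(1) qa(1) F, of 2 "k + 1"]
      by (simp add: dq sg_minus)
  qed
  have e3: "cmp C (Arr x y (k + 1) (cmp C (Arr y y 1 q') (Arr x y k u))) (Arr x x 1 q)
      = cmp C (Arr y y 1 q') (Arr x y (k + 1) (cmp C (Arr x y k u) (Arr x x 1 q)))"
    using cmp_assoc'[OF qa(1) F qa(2), of "k + 1" "k + 1"] by simp
  show "dif (twist C Q) (d_arr (twist C Q) f) = 0"
  proof -
    have "dif (twist C Q) (d_arr (twist C Q) f)
        = dif C (Arr x y (k + 1) (dif (twist C Q) f)) + cmp C (Arr y y 1 q') (Arr x y (k + 1) (dif (twist C Q) f))
          - sg (k + 1) (cmp C (Arr x y (k + 1) (dif (twist C Q) f)) (Arr x x 1 q))"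
      unfolding twist_def dg.simps ud[unfolded twist_def dg.simps]
      by (simp add: q[unfolded xy(3,4)] del: d_arr_simps(4)) (simp add: xy)
    also have "\<dots> = 0"
    proof -
      have 1: "dif C (Arr x y (k + 1) (dif (twist C Q) f))
          = dif C (Arr x y (k + 1) (cmp C (Arr y y 1 q') (Arr x y k u)))
            - sg k (dif C (Arr x y (k + 1) (cmp C (Arr x y k u) (Arr x x 1 q))))"
        unfolding dtw using parts F by (simp add: dif_add dif_diff arr_add dif_sg dif_dif')
      have 2: "cmp C (Arr y y 1 q') (Arr x y (k + 1) (dif (twist C Q) f))
          = cmp C (Arr y y 1 q') (Arr x y (k + 1) (dif C (Arr x y k u)))
            + cmp C (Arr y y 1 q') (Arr x y (k + 1) (cmp C (Arr y y 1 q') (Arr x y k u)))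
            - sg k (cmp C (Arr y y 1 q') (Arr x y (k + 1) (cmp C (Arr x y k u) (Arr x x 1 q))))"
        unfolding dtw using parts qa by (simp add: cmp_add_right' cmp_diff_right arr_add cmp_sg_right)
      have 3: "cmp C (Arr x y (k + 1) (dif (twist C Q) f)) (Arr x x 1 q)
          = cmp C (Arr x y (k + 1) (dif C (Arr x y k u))) (Arr x x 1 q)
            + cmp C (Arr x y (k + 1) (cmp C (Arr y y 1 q') (Arr x y k u))) (Arr x x 1 q)
            - sg k (cmp C (Arr x y (k + 1) (cmp C (Arr x y k u) (Arr x x 1 q))) (Arr x x 1 q))"
        unfolding dtw using parts qa by (simp add: cmp_add_left' cmp_diff_left arr_add cmp_sg_left)
      show ?thesis
        unfolding 1 2 3 e1 e2 e3 by (simp add: sg_def)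
    qed
    finally show ?thesis .
  qed
  fix g
  assume g: "is_arr (twist C Q) g" and fg: "tgt f = src g"
  define Z z l v q'' where zs: "Z = tgt g" "z = fst Z" "l = deg g" "v = val g" "q'' = snd Z"
  have ug: "untwist g = Arr y z l v"
    using fg by (simp add: untwist_def xy zs)
  have G: "is_arr C (Arr y z l v)" and Z: "Z \<in> Q"
    using g unfolding arr ug by (auto simp: zs)
  have q'': "mc_arr Z = Arr z z 1 q''"
    by (auto simp: mc_arr_def zs)
  have qa'': "is_arr C (Arr z z 1 q'')"
    using mc[OF Z] by (auto simp: q'')
  show "is_arr (twist C Q) (cmp_arr (twist C Q) g f)"
    using c_closed[OF F G] XY Z unfolding arr untwist_cmp_arr uf ug by (simp add: xy zs)
  have dtw': "dif (twist C Q) g = dif C (Arr y z l v) + cmp C (Arr z z 1 q'') (Arr y z l v)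
      - sg l (cmp C (Arr y z l v) (Arr y y 1 q'))"
    using fg q''[unfolded zs(1)] q[unfolded xy(3,4)] by (simp add: twist_def ug) (simp add: zs)
  have ud': "untwist (d_arr (twist C Q) g) = Arr y z (l + 1) (dif (twist C Q) g)"
    using fg by (simp add: untwist_def d_arr_def zs xy)
  have parts': "is_arr C (Arr y z (l + 1) (dif C (Arr y z l v)))"
      "is_arr C (Arr y z (l + 1) (cmp C (Arr z z 1 q'') (Arr y z l v)))"
      "is_arr C (Arr y z (l + 1) (sg l (cmp C (Arr y z l v) (Arr y y 1 q'))))"
      "is_arr C (Arr y z (l + 1) (cmp C (Arr y z l v) (Arr y y 1 q')))"
    using G qa qa'' by (auto intro!: arr_dif arr_sg arr_cmp)
  show "dif (twist C Q) (cmp_arr (twist C Q) g f)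
      = cmp (twist C Q) (d_arr (twist C Q) g) f + sg (deg g) (cmp (twist C Q) g (d_arr (twist C Q) f))"
  proof -
    have 0: "dif (twist C Q) (cmp_arr (twist C Q) g f)
      = dif C (Arr x z (l + k) (cmp C (Arr y z l v) (Arr x y k u)))
        + cmp C (Arr z z 1 q'') (Arr x z (l + k) (cmp C (Arr y z l v) (Arr x y k u)))
        - sg (l + k) (cmp C (Arr x z (l + k) (cmp C (Arr y z l v) (Arr x y k u))) (Arr x x 1 q))"
      unfolding twist_def dg.simps untwist_cmp_arr[unfolded twist_def]
      by (simp add: q[unfolded xy(3,4)] q''[unfolded zs(1)] uf ug del: cmp_arr_simps(4))
        (simp add: cmp_arr_def xy zs)
    have 1: "cmp (twist C Q) (d_arr (twist C Q) g) f
        = cmp C (Arr y z (l + 1) (dif C (Arr y z l v))) (Arr x y k u)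
          + cmp C (Arr y z (l + 1) (cmp C (Arr z z 1 q'') (Arr y z l v))) (Arr x y k u)
          - sg l (cmp C (Arr y z (l + 1) (cmp C (Arr y z l v) (Arr y y 1 q'))) (Arr x y k u))"
      unfolding twist_def dg.simps ud'[unfolded twist_def dg.simps] uf
      unfolding dtw'[unfolded twist_def dg.simps]
      using F parts' by (simp add: cmp_add_left' cmp_diff_left arr_add cmp_sg_left)
    have 2: "cmp (twist C Q) g (d_arr (twist C Q) f)
        = cmp C (Arr y z l v) (Arr x y (k + 1) (dif C (Arr x y k u)))
          + cmp C (Arr y z l v) (Arr x y (k + 1) (cmp C (Arr y y 1 q') (Arr x y k u)))
          - sg k (cmp C (Arr y z l v) (Arr x y (k + 1) (cmp C (Arr x y k u) (Arr x x 1 q))))"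
      unfolding twist_def dg.simps ud[unfolded twist_def dg.simps] ug
      unfolding dtw[unfolded twist_def dg.simps]
      using G parts by (simp add: cmp_add_right' cmp_diff_right arr_add cmp_sg_right)
    have 3: "cmp C (Arr y z (l + 1) (cmp C (Arr z z 1 q'') (Arr y z l v))) (Arr x y k u)
        = cmp C (Arr z z 1 q'') (Arr x z (l + k) (cmp C (Arr y z l v) (Arr x y k u)))"
      using cmp_assoc'[OF F G qa'' refl, of "l + 1"] by simp
    have 4: "cmp C (Arr y z (l + 1) (cmp C (Arr y z l v) (Arr y y 1 q'))) (Arr x y k u)
        = cmp C (Arr y z l v) (Arr x y (k + 1) (cmp C (Arr y y 1 q') (Arr x y k u)))"
      using cmp_assoc'[OF F qa(2) G, of "k + 1" "l + 1"] by simp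
    have 5: "cmp C (Arr x z (l + k) (cmp C (Arr y z l v) (Arr x y k u))) (Arr x x 1 q)
        = cmp C (Arr y z l v) (Arr x y (k + 1) (cmp C (Arr x y k u) (Arr x x 1 q)))"
      using cmp_assoc'[OF qa(1) F G, of "k + 1" "l + k"] by simp
    show ?thesis
      unfolding 0 1 2 Leibniz'[OF F G refl] 3 4 5 zs(3)[symmetric] by (simp add: sg_def)
  qed
  fix h
  assume h: "is_arr (twist C Q) h" and gh: "tgt g = src h"
  show "cmp (twist C Q) h (cmp_arr (twist C Q) g f) = cmp (twist C Q) (cmp_arr (twist C Q) h g) f"
    using cmp_assoc[of "untwist f" "untwist g" "untwist h"] f g h fg gh unfolding arr
    by (simp add: untwist_cmp_arr[unfolded twist_def] twist_def)
next
  note arr = is_arr_twist[OF Q]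
  have mc: "is_arr C (mc_arr X)" if "X \<in> Q" for X
    using that Q by (auto simp: mc_set_def)
  fix x y k u
  assume u: "is_arr (twist C Q) (Arr x y k u)"
  then have u': "is_arr C (Arr (fst x) (fst y) k u)" and xy: "is_arr C (mc_arr x)" "is_arr C (mc_arr y)"
    unfolding arr untwist_Arr by (auto intro: mc)
  show "dif (twist C Q) (Arr x y k (scl (twist C Q) c u)) = scl (twist C Q) c (dif (twist C Q) (Arr x y k u))" for c
    using u' xy
    by (simp add: twist_def untwist_Arr dif_scl cmp_scl_left' cmp_scl_right' mc_arr_def scl_sg scale_right_distrib scale_right_diff_distrib)
  fix v
  assume v: "is_arr (twist C Q) (Arr x y k v)"
  then have v': "is_arr C (Arr (fst x) (fst y) k v)"
    unfolding arr untwist_Arr by auto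
  show "dif (twist C Q) (Arr x y k (u + v)) = dif (twist C Q) (Arr x y k u) + dif (twist C Q) (Arr x y k v)"
    using u' v' xy
    by (simp add: twist_def untwist_Arr dif_add cmp_add_left' cmp_add_right' mc_arr_def sg_add)
qed (auto simp: is_arr_twist[OF Q] untwist_Arr cmp_twist scl_twist
  intro!: cmp_add_left[of "untwist _", simplified] cmp_add_right[of "untwist _", simplified]
    cmp_scl_left[of "untwist _", simplified] cmp_scl_right[of "untwist _", simplified])

end

section \<open>Twisted complexes as twisted matrices over shifted objects\<close>

lemma unshift_ent: "unshift (ent (untwist f) i j) = entry (src f) (tgt f) (deg f) (val f) i j"
  by (simp add: unshift_def ent_def entry_def ob_def sh_def)

lemma mat_shifts_simps:
  "scl (mat (shifts C)) = (\<lambda>c \<phi> i j. scl C c (\<phi> i j))"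
  "Hom (mat (shifts C)) (fst X) (fst Y) = matrices C X Y"
  "dif (mat (shifts C)) (untwist f) = mat_dif C (src f) (tgt f) (deg f) (val f)"
  "cmp (mat (shifts C)) (untwist g) (untwist f) = (\<lambda>i j. if i < len (src f) \<and> j < len (tgt g)
    then \<Sum>l<len (tgt f). cmp C (entry (tgt f) (tgt g) (deg g) (val g) l j) (entry (src f) (tgt f) (deg f) (val f) i l) else 0)"
  unfolding mat_def dg.simps shifts_simps unshift_ent
  by (auto simp: fun_eq_iff matrices_def mat_dif_def len_def ob_def sh_def entry_def unshift_Arr)

lemma mc_arr_untwist: "mc_arr X = untwist (Arr X X 1 (tw X))"
  by (simp add: mc_arr_def untwist_def tw_def)

lemma pretr_eq: "pretr C = twist (mat (shifts C)) (obs (pretr C))"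
proof (rule dg.equality)
  show "dif (pretr C) = dif (twist (mat (shifts C)) (obs (pretr C)))"
    by (rule ext) (simp add: pretr_def twist_def mc_arr_untwist mat_shifts_simps mat_mult_def cong: if_cong)
  show "cmp (pretr C) = cmp (twist (mat (shifts C)) (obs (pretr C)))"
    by (intro ext) (simp add: pretr_def twist_def mat_shifts_simps mat_mult_def cong: if_cong)
qed (simp_all add: twist_def mat_shifts_simps, simp_all add: pretr_def)

lemma obs_pretr: "obs (pretr C) \<subseteq> mc_set (mat (shifts C))"
proof
  fix X assume "X \<in> obs (pretr C)"
  then have X: "\<forall>(x, r)\<in>set (fst X). x \<in> obs C" "tw X \<in> matrices C X X 1"
      "mat_dif C X X 1 (tw X) + mat_mult C X X X 1 1 (tw X) (tw X) = 0"
    by (auto simp: pretr_def)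
  have "set (fst X) \<subseteq> obs (shifts C)"
    using X(1) by (auto simp: shifts_simps)
  then have "is_arr (mat (shifts C)) (mc_arr X)"
    using X(2) by (simp add: is_arr_def mat_shifts_simps) (simp add: mat_def tw_def)
  then show "X \<in> mc_set (mat (shifts C))"
    using X(3) by (simp add: mc_set_def mc_arr_untwist mat_shifts_simps mat_mult_def cong: if_cong)
qed

section \<open>Signed path sums\<close>
text \<open>Between shifted objects the degree is 1 whatever the shifts are. The reduced degree is
  therefore even, and inserting horizontal arrows does not change the parity of the reduced degree
  of a word.\<close>

definition horizontal :: "'s list \<times> (nat \<Rightarrow> nat \<Rightarrow> 'm) \<Rightarrow> nat \<Rightarrow> nat \<Rightarrow> ('s, 'm \<times> 'k::zero) arr" where
  "horizontal X k l = Arr (fst X ! k) (fst X ! l) 1 (snd X k l, 0)"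

definition essential ::
  "('s list \<times> (nat \<Rightarrow> nat \<Rightarrow> 'm), (nat \<Rightarrow> nat \<Rightarrow> 'm) \<times> 'k::zero) arr \<Rightarrow> nat \<Rightarrow> nat \<Rightarrow> ('s, 'm \<times> 'k) arr" where
  "essential f k l = Arr (fst (src f) ! k) (fst (tgt f) ! l) (deg f) (fst (val f) k l, if k = l then snd (val f) else 0)"

lemma horizontal_simps [simp]:
  "src (horizontal X k l) = fst X ! k" "tgt (horizontal X k l) = fst X ! l" "deg (horizontal X k l) = 1"
  "val (horizontal X k l) = (snd X k l, 0)"
  by (simp_all add: horizontal_def)

lemma essential_simps [simp]:
  "src (essential f k l) = fst (src f) ! k" "tgt (essential f k l) = fst (tgt f) ! l" "deg (essential f k l) = deg f"
  "val (essential f k l) = (fst (val f) k l, if k = l then snd (val f) else 0)"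
  by (simp_all add: essential_def)

text \<open>
  The exponent \<open>\<Sum>_s (deg \<phi>^s + 1) N_s\<close> is distributed over the horizontal arrows: one that precedes
  exactly the essential arrows of \<open>fs\<close> contributes \<open>rdegs fs\<close>.
\<close>

function words ::
  "('s list \<times> (nat \<Rightarrow> nat \<Rightarrow> 'm), (nat \<Rightarrow> nat \<Rightarrow> 'm) \<times> 'k::zero) arr list \<Rightarrow> 's list \<times> (nat \<Rightarrow> nat \<Rightarrow> 'm) \<Rightarrow>
   nat \<Rightarrow> nat \<Rightarrow> (int \<times> ('s, 'm \<times> 'k) arr list) list" where
  "words fs X a b =
    (case fs of [] \<Rightarrow> if a = b then [(0, [])] else []
      | f # gs \<Rightarrow> concat (map (\<lambda>c. map (\<lambda>(e, w). (e, essential f a c # w)) (words gs (tgt f) c b))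
          [0..<length (fst (tgt f))]))
    @ concat (map (\<lambda>c. map (\<lambda>(e, w). (rdegs fs + e, horizontal X a c # w)) (words fs X c b))
        [Suc a..<length (fst X)])"
  by pat_completeness auto
termination
  \<comment> \<open>An essential arrow shortens \<open>fs\<close>; a horizontal one keeps
    \<open>fs\<close> and \<open>X\<close> but increases the index \<open>a\<close>.\<close>
  by (relation "measures [\<lambda>(fs, X, a, b). length fs, \<lambda>(fs, X, a, b). length (fst X) - a]") auto

declare words.simps [simp del]

text \<open>The function \<open>G\<close> is an argument because stripping a first arrow
  \<open>h\<close> replaces \<open>G\<close> by \<open>\<lambda>w. G (h # w)\<close>; inductions
  along paths run over all \<open>G\<close> at once.\<close>

definition path_sum ::
  "('s list \<times> (nat \<Rightarrow> nat \<Rightarrow> 'm), (nat \<Rightarrow> nat \<Rightarrow> 'm) \<times> 'k::zero) arr list \<Rightarrow> 's list \<times> (nat \<Rightarrow> nat \<Rightarrow> 'm) \<Rightarrow>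
   nat \<Rightarrow> nat \<Rightarrow> (('s, 'm \<times> 'k) arr list \<Rightarrow> 'l::ab_group_add) \<Rightarrow> 'l" where
  "path_sum fs X a b G = (\<Sum>(e, w)\<leftarrow>words fs X a b. sg e (G w))"

text \<open>The contribution of the paths that do not begin with a horizontal arrow. If no essential
  arrow is left, the empty path is the only one of these.\<close>

definition ess_sum ::
  "('s list \<times> (nat \<Rightarrow> nat \<Rightarrow> 'm), (nat \<Rightarrow> nat \<Rightarrow> 'm) \<times> 'k::zero) arr list \<Rightarrow>
   nat \<Rightarrow> nat \<Rightarrow> (('s, 'm \<times> 'k) arr list \<Rightarrow> 'l::ab_group_add) \<Rightarrow> 'l" where
  "ess_sum fs a b G = (case fs of [] \<Rightarrow> if a = b then G [] else 0
     | f # gs \<Rightarrow> \<Sum>c<length (fst (tgt f)). path_sum gs (tgt f) c b (\<lambda>w. G (essential f a c # w)))"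

lemma ess_sum_simps:
  "ess_sum [] a b G = (if a = b then G [] else 0)"
  "ess_sum (f # fs) a b G = (\<Sum>c<length (fst (tgt f)). path_sum fs (tgt f) c b (\<lambda>w. G (essential f a c # w)))"
  by (simp_all add: ess_sum_def)

lemma sum_list_sg: "(\<Sum>x\<leftarrow>xs. sg e (h x)) = sg e (\<Sum>x\<leftarrow>xs. h x)"
  by (induction xs) (simp_all add: sg_add)

lemma sum_list_concat_map: "sum_list (map h (concat (map k xs))) = (\<Sum>x\<leftarrow>xs. sum_list (map h (k x)))"
  by (induction xs) simp_all

lemma path_sum_rec:
  "path_sum fs X a b G = ess_sum fs a b G
    + (\<Sum>c\<in>{Suc a..<length (fst X)}. sg (rdegs fs) (path_sum fs X c b (\<lambda>w. G (horizontal X a c # w))))"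
proof -
  have 1: "sum_list (map (\<lambda>(e, w). sg e (G w)) (map (\<lambda>(e, w). (r + e, h # w)) ws))
      = sg r (\<Sum>(e, w)\<leftarrow>ws. sg e (G (h # w)))" for r h ws
    by (simp add: case_prod_unfold comp_def sg_sg[symmetric] sum_list_sg)
  have 2: "sum_list (map (\<lambda>(e, w). sg e (G w)) (map (\<lambda>(e, w). (e, h # w)) ws))
      = (\<Sum>(e, w)\<leftarrow>ws. sg e (G (h # w)))" for h ws
    by (simp add: case_prod_unfold comp_def)
  show ?thesis
    unfolding path_sum_def ess_sum_def
    by (subst words.simps)
      (cases fs; simp only: map_append sum_list_append sum_list_concat_map 1 2 list.case
        interv_sum_list_conv_sum_set_nat split: if_splits; simp add: atLeast0LessThan)
qed

lemma path_sum_cong: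
  "(\<And>e w. (e, w) \<in> set (words fs X a b) \<Longrightarrow> G w = H w) \<Longrightarrow> path_sum fs X a b G = path_sum fs X a b H"
  unfolding path_sum_def by (intro arg_cong[of _ _ sum_list] map_cong) auto

lemma path_sum_0 [simp]: "path_sum fs X a b (\<lambda>w. 0) = 0"
  by (simp add: path_sum_def case_prod_unfold)

lemma path_sum_add: "path_sum fs X a b (\<lambda>w. G w + H w) = path_sum fs X a b G + path_sum fs X a b H"
  by (simp add: path_sum_def case_prod_unfold sg_add sum_list_addf)

lemma path_sum_sg: "path_sum fs X a b (\<lambda>w. sg e (G w)) = sg e (path_sum fs X a b G)"
  by (simp add: path_sum_def case_prod_unfold sum_list_sg[symmetric] sg_sg add.commute)

lemma path_sum_diff: "path_sum fs X a b (\<lambda>w. G w - H w) = path_sum fs X a b G - path_sum fs X a b H"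
  using path_sum_add[of fs X a b G "\<lambda>w. sg 1 (H w)"] path_sum_sg[of fs X a b 1 H] by (simp add: sg_def)

lemma path_sum_sum: "path_sum fs X a b (\<lambda>w. \<Sum>i\<in>I. G i w) = (\<Sum>i\<in>I. path_sum fs X a b (G i))"
  by (induction I rule: infinite_finite_induct) (simp_all add: path_sum_add)

section \<open>Cutting a path in two\<close>

definition at_stage :: "'x \<Rightarrow> ('x, 'n) arr list \<Rightarrow> nat \<Rightarrow> 'x" where
  "at_stage X fs i = (if i = 0 then X else tgt (fs ! (i - 1)))"

lemma at_stage_Cons: "at_stage X (f # fs) (Suc i) = at_stage (tgt f) fs i"
  by (cases i) (simp_all add: at_stage_def)

text \<open>Both sides may be empty. With the extreme cuts included, an arrow put in front of a word
  creates exactly one new cut, the one before it.\<close>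

definition cuts :: "('w list \<Rightarrow> 'w list \<Rightarrow> 'l::ab_group_add) \<Rightarrow> 'w list \<Rightarrow> 'l" where
  "cuts K w = (\<Sum>i\<le>length w. K (take i w) (drop i w))"

lemma cuts_simps: "cuts K [] = K [] []" "cuts K (f # w) = K [] (f # w) + cuts (\<lambda>u. K (f # u)) w"
  unfolding cuts_def by (simp, simp add: sum.atMost_Suc_shift del: sum.atMost_Suc)

text \<open>
  The sign makes up for the \<open>length u - i\<close> horizontal arrows of \<open>u\<close>, which also precede the essential
  arrows of \<open>drop i fs\<close>.
\<close>

definition cut_sum ::
  "('s list \<times> (nat \<Rightarrow> nat \<Rightarrow> 'm), (nat \<Rightarrow> nat \<Rightarrow> 'm) \<times> 'k::zero) arr list \<Rightarrow> 's list \<times> (nat \<Rightarrow> nat \<Rightarrow> 'm) \<Rightarrow>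
   nat \<Rightarrow> nat \<Rightarrow> (('s, 'm \<times> 'k) arr list \<Rightarrow> ('s, 'm \<times> 'k) arr list \<Rightarrow> 'l::ab_group_add) \<Rightarrow> nat \<Rightarrow> 'l" where
  "cut_sum fs X a b K i = (\<Sum>c<length (fst (at_stage X fs i)). path_sum (take i fs) X a c (\<lambda>u.
     sg ((int (length u) - int i) * rdegs (drop i fs)) (path_sum (drop i fs) (at_stage X fs i) c b (K u))))"

lemma rdegs_take_drop: "rdegs (take i fs) + rdegs (drop i fs) = rdegs fs"
  by (metis append_take_drop_id rdegs_simps(3))

text \<open>A path with a cut amounts to the number \<open>i\<close> of essential arrows before the
  cut, the index \<open>c\<close> at which it is made, and a path on either side. The induction
  separates the cuts whose left side begins with a horizontal arrow from the others, which make up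
  \<open>E\<close>.\<close>

lemma path_sum_cuts:
  fixes K :: "('s, 'm \<times> 'k::zero) arr list \<Rightarrow> ('s, 'm \<times> 'k) arr list \<Rightarrow> 'l::ab_group_add"
  assumes "a < length (fst X)"
  shows "path_sum fs X a b (cuts K) = (\<Sum>i\<le>length fs. cut_sum fs X a b K i)"
  using assms
proof (induction fs X a b arbitrary: K rule: words.induct)
  case (1 fs X a b)
  define H where "H c K u = K (horizontal X a c # u)"
    for c and K :: "('s, 'm \<times> 'k) arr list \<Rightarrow> ('s, 'm \<times> 'k) arr list \<Rightarrow> 'l" and u
  define E where "E i = (\<Sum>c<length (fst (at_stage X fs i)). ess_sum (take i fs) a c (\<lambda>u.
     sg ((int (length u) - int i) * rdegs (drop i fs)) (path_sum (drop i fs) (at_stage X fs i) c b (K u))))" for i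
  have cut: "cut_sum fs X a b K i = E i
      + (\<Sum>c\<in>{Suc a..<length (fst X)}. sg (rdegs fs) (cut_sum fs X c b (H c K) i))" for i
  proof -
    \<comment> \<open>A horizontal arrow at the front of the left side counts with
      \<open>rdegs (take i fs)\<close> in the path sum and, being one more arrow, with
      \<open>rdegs (drop i fs)\<close> in the correcting sign: together \<open>rdegs fs\<close>, its
      sign in the uncut path.\<close>
    have "sg (rdegs (take i fs)) (sg ((1 + int n - int i) * rdegs (drop i fs)) z)
        = sg (rdegs fs) (sg ((int n - int i) * rdegs (drop i fs)) z)" for n and z :: 'l
      unfolding sg_sg by (rule sg_parity) (auto simp: rdegs_take_drop[of i fs, symmetric])
    then show ?thesis
      unfolding cut_sum_def E_def
      by (subst path_sum_rec) (simp add: sum.distrib sg_sum sum.swap[of _ _ "{Suc a..<_}"] H_def path_sum_sg[symmetric])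
  qed
  have E0: "E 0 = path_sum fs X a b (K [])"
    using 1(3) by (simp add: E_def at_stage_def ess_sum_simps)
  \<comment> \<open>The cut in front of the whole path has an empty left side and is contained in
    \<open>E 0\<close>, hence the subtracted term.\<close>
  have ES: "(\<Sum>i<length fs. E (Suc i)) = ess_sum fs a b (cuts K) - ess_sum fs a b (K [])"
  proof (cases fs)
    case (Cons f gs)
    have "(\<Sum>i<length fs. E (Suc i)) = (\<Sum>i\<le>length gs. \<Sum>c<length (fst (tgt f)).
        cut_sum gs (tgt f) c b (\<lambda>u. K (essential f a c # u)) i)"
      unfolding E_def Cons at_stage_Cons cut_sum_def take_Suc_Cons drop_Suc_Cons ess_sum_simps
      by (simp add: lessThan_Suc_atMost sum.swap[of _ "{..<length (fst (tgt f))}"])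
    also have "\<dots> = (\<Sum>c<length (fst (tgt f)). path_sum gs (tgt f) c b (cuts (\<lambda>u. K (essential f a c # u))))"
      by (subst sum.swap) (rule sum.cong[OF refl], rule 1(1)[OF Cons, symmetric], auto)
    finally show ?thesis
      by (simp add: Cons ess_sum_simps cuts_simps path_sum_add sum.distrib)
  qed (simp add: ess_sum_simps cuts_simps)
  have "(\<Sum>i\<le>length fs. cut_sum fs X a b K i)
      = (\<Sum>i\<le>length fs. E i) + (\<Sum>c\<in>{Suc a..<length (fst X)}. sg (rdegs fs) (\<Sum>i\<le>length fs. cut_sum fs X c b (H c K) i))"
    unfolding cut sum.distrib sg_sum by (simp add: sum.swap[of _ _ "{Suc a..<_}"])
  also have "(\<Sum>c\<in>{Suc a..<length (fst X)}. sg (rdegs fs) (\<Sum>i\<le>length fs. cut_sum fs X c b (H c K) i))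
      = (\<Sum>c\<in>{Suc a..<length (fst X)}. sg (rdegs fs) (path_sum fs X c b (cuts (H c K))))"
    by (rule sum.cong[OF refl], rule arg_cong[of _ _ "sg _"], rule 1(2)[symmetric]) auto
  also have "(\<Sum>i\<le>length fs. E i) = path_sum fs X a b (K []) + ess_sum fs a b (cuts K) - ess_sum fs a b (K [])"
    using ES E0 by (simp add: lessThan_Suc_atMost[symmetric] sum.lessThan_Suc_shift del: sum.lessThan_Suc)
  also have "path_sum fs X a b (K []) = ess_sum fs a b (K [])
    + (\<Sum>c\<in>{Suc a..<length (fst X)}. sg (rdegs fs) (path_sum fs X c b (\<lambda>w. K [] (horizontal X a c # w))))"
    by (rule path_sum_rec)
  finally show ?case
    unfolding path_sum_rec[of fs X a b "cuts K"] cuts_simps H_def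
    by (simp add: path_sum_add sg_add sum.distrib)
qed

section \<open>Path sums and the bar differential\<close>
text \<open>Serves to collect, for a fixed end \<open>e\<close>, all composites that reach
  \<open>e\<close> through an earlier index \<open>c\<close>.\<close>

lemma sum_triangle:
  fixes F :: "nat \<Rightarrow> nat \<Rightarrow> 'a::comm_monoid_add"
  shows "(\<Sum>c\<in>{i..<n}. \<Sum>e\<in>{Suc c..<n}. F c e) = (\<Sum>e\<in>{i..<n}. \<Sum>c\<in>{i..<e}. F c e)"
proof (induction n)
  case (Suc n)
  show ?case
  proof (cases "i \<le> n")
    case True
    have "(\<Sum>c\<in>{i..<n}. \<Sum>e\<in>{Suc c..<Suc n}. F c e) = (\<Sum>c\<in>{i..<n}. (\<Sum>e\<in>{Suc c..<n}. F c e) + F c n)"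
      by (rule sum.cong) auto
    then show ?thesis
      using Suc True by (simp add: sum.distrib)
  qed simp
qed simp

lemma proj_arr_horizontal: "proj_arr (horizontal X k l) = ent (mc_arr X) k l"
  by (simp add: proj_arr_def ent_def)

lemma proj_arr_essential: "proj_arr (essential f k l) = ent (untwist (proj_arr f)) k l"
  by (simp add: proj_arr_def ent_def)

lemma dif_aug: "dif (aug C) f = (dif C (proj_arr f), 0)"
  by (simp add: aug_def)

lemma cmp_aug: "cmp (aug C) g f = (cmp C (proj_arr g) (proj_arr f)
    + scl C (snd (val g)) (fst (val f)) + scl C (snd (val f)) (fst (val g)), snd (val g) * snd (val f))"
  by (simp add: aug_def)

lemma obs_aug: "obs (aug C) = obs C"
  by (simp add: aug_def)

text \<open>The category \<open>C\<close> of this locale will be \<open>shifts\<close> of the given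
  one; hence no shifts and no shift signs appear in the arguments on paths.\<close>

locale twisted_complexes = nonunital_dg_category C
  for C :: "('k::field, 's, 'm::ab_group_add) dg" +
  fixes Q :: "('s list \<times> (nat \<Rightarrow> nat \<Rightarrow> 'm)) set"
  assumes Q_mc: "Q \<subseteq> mc_set (mat C)"
    and Q_upper: "X \<in> Q \<Longrightarrow> l \<le> k \<Longrightarrow> snd X k l = 0"
begin

abbreviation T where "T \<equiv> twist (mat C) Q"

sublocale M: nonunital_dg_category "mat C"
  by (rule mat_dg)

sublocale T: nonunital_dg_category T
  by (rule M.twist_dg[OF Q_mc])

sublocale aug_C: linear_dg "aug C"
  by (rule aug_linear)

sublocale aug_T: linear_dg "aug T"
  by (rule T.aug_linear)

lemma mc_arr_Q: "X \<in> Q \<Longrightarrow> is_arr (mat C) (mc_arr X)"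
  using Q_mc by (auto simp: mc_set_def)

lemma ent_mc_arr: "X \<in> Q \<Longrightarrow> k < length (fst X) \<Longrightarrow> l < length (fst X) \<Longrightarrow> is_arr C (ent (mc_arr X) k l)"
  using is_arr_ent[OF mc_arr_Q] by simp

lemma Q_obs: "X \<in> Q \<Longrightarrow> k < length (fst X) \<Longrightarrow> fst X ! k \<in> obs C"
  using mc_arr_Q[of X] by (auto simp: is_arr_mat subset_iff)

lemma is_arr_aug_T: "is_arr (aug T) f \<longleftrightarrow> src f \<in> Q \<and> tgt f \<in> Q \<and> is_arr (mat C) (untwist (proj_arr f))
    \<and> (snd (val f) \<noteq> 0 \<longrightarrow> src f = tgt f \<and> deg f = 0)"
  unfolding T.is_arr_aug M.is_arr_twist[OF Q_mc] by auto

lemma ent_essential: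
  "is_arr (aug T) f \<Longrightarrow> k < length (fst (src f)) \<Longrightarrow> l < length (fst (tgt f)) \<Longrightarrow>
    is_arr C (ent (untwist (proj_arr f)) k l)"
  unfolding is_arr_aug_T using is_arr_ent[of C "untwist (proj_arr f)" k l] by simp

lemma horizontal_arr:
  assumes "X \<in> Q" "k < length (fst X)" "l < length (fst X)"
  shows "is_arr (aug C) (horizontal X k l)"
  unfolding is_arr_aug proj_arr_horizontal using ent_mc_arr[OF assms] by simp

lemma essential_arr:
  assumes "is_arr (aug T) f" "k < length (fst (src f))" "l < length (fst (tgt f))"
  shows "is_arr (aug C) (essential f k l)"
  unfolding is_arr_aug proj_arr_essential using ent_essential[OF assms] assms(1) by (simp add: is_arr_aug_T)

text \<open>Each of the \<open>m\<close> horizontal arrows adds one to the length and one to the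
  total degree. Hence \<open>degs w - length w\<close>, and with it the degree of a Taylor component
  on \<open>w\<close>, is the same for all paths.\<close>

lemma words_props:
  assumes "seg (aug T) X Y fs" "X \<in> Q" "a < length (fst X)" "b < length (fst Y)" "(e, w) \<in> set (words fs X a b)"
  shows "seg (aug C) (fst X ! a) (fst Y ! b) w \<and> (\<exists>m. length w = length fs + m \<and> degs w = degs fs + int m)"
  using assms
proof (induction fs X a b arbitrary: e w rule: words.induct)
  case (1 fs X a b)
  from 1(7) consider (nil) "fs = []" "a = b" "w = []"
    | (ess) f gs c e' w' where "fs = f # gs" "c < length (fst (tgt f))" "w = essential f a c # w'"
        "(e', w') \<in> set (words gs (tgt f) c b)"
    | (hor) c e' w' where "a < c" "c < length (fst X)" "w = horizontal X a c # w'"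
        "(e', w') \<in> set (words fs X c b)"
    unfolding words.simps[of fs X a b] by (cases fs) (auto simp: Suc_le_eq split: if_splits)
  then show ?case
  proof cases
    case nil
    then show ?thesis
      using 1 by auto
  next
    case ess
    then have f: "is_arr (aug T) f" "src f = X" "seg (aug T) (tgt f) Y gs"
      using 1(3) by auto
    then have "tgt f \<in> Q"
      by (simp add: is_arr_aug_T)
    from 1(1)[OF ess(1) _ f(3) this ess(2) 1(6) ess(4)] ess(2) essential_arr[OF f(1), of a c]
    show ?thesis
      using f 1(5) by (auto simp: ess)
  next
    case hor
    from 1(2)[OF _ 1(3,4) hor(2) 1(6) hor(4)] hor(1,2) horizontal_arr[OF 1(4,5) hor(2)]
    show ?thesis
      by (auto simp: hor(3) intro: exI[of _ "Suc _"])
  qed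
qed

lemma words_parity:
  assumes "seg (aug T) X Y fs" "X \<in> Q" "a < length (fst X)" "b < length (fst Y)" "(e, w) \<in> set (words fs X a b)"
  shows "even (rdegs w + rdegs fs)"
  using words_props[OF assms] by (auto simp: rdegs_eq)

section \<open>Maurer-Cartan equation, twisted differential and composition in components\<close>

lemma cmp_ent_zero:
  "is_arr C g \<Longrightarrow> is_arr C f \<Longrightarrow> tgt f = src g \<Longrightarrow> val f = 0 \<or> val g = 0 \<Longrightarrow> cmp C g f = 0"
  using cmp_zero_left[of "src f" "tgt f" "deg f" "val f" "tgt g" "deg g"]
    cmp_zero_right[of "src g" "tgt g" "deg g" "val g" "src f" "deg f"]
    arr_obs[of f] arr_obs[of g]
  by (cases f; cases g) auto

text \<open>The entry \<open>(a, e)\<close> of the Maurer-Cartan equation, in which one-sidedness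
  leaves only the indices strictly between \<open>a\<close> and \<open>e\<close>.\<close>

lemma horizontal_mc:
  assumes X: "X \<in> Q" and a: "a < length (fst X)" and e: "e < length (fst X)"
  shows "dif (aug C) (horizontal X a e)
    + (\<Sum>c\<in>{Suc a..<e}. cmp (aug C) (horizontal X c e) (horizontal X a c)) = 0"
proof -
  have "dif (mat C) (mc_arr X) + cmp (mat C) (mc_arr X) (mc_arr X) = 0"
    using X Q_mc by (auto simp: mc_set_def)
  from this[THEN fun_cong, THEN fun_cong, of a e] have "dif C (ent (mc_arr X) a e) + (\<Sum>c<length (fst X). cmp C (ent (mc_arr X) c e) (ent (mc_arr X) a c)) = 0"
    using a e by (simp add: dif_mat cmp_mat)
  moreover have "(\<Sum>c<length (fst X). cmp C (ent (mc_arr X) c e) (ent (mc_arr X) a c))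
      = (\<Sum>c\<in>{Suc a..<e}. cmp C (ent (mc_arr X) c e) (ent (mc_arr X) a c))"
    using a e by (intro sum.mono_neutral_right ballI cmp_ent_zero)
      (auto simp: not_less_eq_eq not_less intro: ent_mc_arr X Q_upper)
  ultimately show ?thesis
    by (simp add: prod_eq_iff dif_aug cmp_aug fst_sum snd_sum proj_arr_horizontal)
qed

text \<open>On the morphism part this is the definition of the twisted differential, with the sums
  cut down by one-sidedness. A unit coefficient \<open>z \<noteq> 0\<close> adds
  \<open>z q_ae\<close> to the first sum and \<open>- z q_ae\<close> to the second, because it
  forces \<open>deg f = 0\<close> and \<open>src f = tgt f\<close>; so units contribute nothing, in
  agreement with \<open>d 1_X = 0\<close>.\<close>

lemma essential_dif:
  assumes f: "is_arr (aug T) f" and a: "a < length (fst (src f))" and e: "e < length (fst (tgt f))"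
  shows "val (essential (d_arr (aug T) f) a e) = dif (aug C) (essential f a e)
    + (\<Sum>c<e. cmp (aug C) (horizontal (tgt f) c e) (essential f a c))
    + (\<Sum>c\<in>{Suc a..<length (fst (src f))}. sg (deg f + 1) (cmp (aug C) (essential f c e) (horizontal (src f) a c)))"
proof -
  define g z where "g = untwist (proj_arr f)" and "z = snd (val f)"
  have Qs: "src f \<in> Q" "tgt f \<in> Q" and z: "z \<noteq> 0 \<longrightarrow> src f = tgt f \<and> deg f = 0"
    using f by (auto simp: is_arr_aug_T z_def)
  have 1: "(\<Sum>c<length (fst (tgt f)). cmp C (ent (mc_arr (tgt f)) c e) (ent g a c))
      = (\<Sum>c<e. cmp C (ent (mc_arr (tgt f)) c e) (ent g a c))"
    using a e unfolding g_def by (intro sum.mono_neutral_right ballI cmp_ent_zero)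
      (auto simp: not_less intro!: ent_mc_arr ent_essential Qs Q_upper f)
  have 2: "(\<Sum>c<length (fst (src f)). cmp C (ent g c e) (ent (mc_arr (src f)) a c))
      = (\<Sum>c\<in>{Suc a..<length (fst (src f))}. cmp C (ent g c e) (ent (mc_arr (src f)) a c))"
    using a e unfolding g_def by (intro sum.mono_neutral_right ballI cmp_ent_zero)
      (auto simp: not_less_eq_eq intro!: ent_mc_arr ent_essential Qs Q_upper f)
  have dT: "fst (val (d_arr (aug T) f)) a e = dif C (ent g a e)
      + (\<Sum>c<e. cmp C (ent (mc_arr (tgt f)) c e) (ent g a c))
      - sg (deg f) (\<Sum>c\<in>{Suc a..<length (fst (src f))}. cmp C (ent g c e) (ent (mc_arr (src f)) a c))"
    using a e unfolding 1[symmetric] 2[symmetric]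
    by (simp add: dif_aug twist_def g_def sg_apply dif_mat cmp_mat)
  \<comment> \<open>If \<open>a\<close> is not below \<open>e\<close>, the diagonal index is missing
    from the sum, and the right-hand side vanishes by one-sidedness.\<close>
  have 3: "(\<Sum>c<e. scl C (if a = c then z else 0) (snd (tgt f) c e)) = scl C z (snd (tgt f) a e)"
    using Q_upper[OF Qs(2), of e a] by (simp add: if_distrib[of "\<lambda>t. scl C t _"] if_distribR not_less cong: if_cong)
  have 4: "(\<Sum>c\<in>{Suc a..<length (fst (src f))}. scl C (if c = e then z else 0) (snd (src f) a c)) = scl C z (snd (src f) a e)"
    using Q_upper[OF Qs(1), of e a] e z
    by (cases "z = 0") (auto simp: if_distrib[of "\<lambda>t. scl C t _"] if_distribR not_less_eq_eq cong: if_cong)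
  have "fst (val (essential (d_arr (aug T) f) a e)) = dif C (ent g a e)
      + (\<Sum>c<e. cmp C (ent (mc_arr (tgt f)) c e) (ent g a c) + scl C (if a = c then z else 0) (snd (tgt f) c e))
      + (\<Sum>c\<in>{Suc a..<length (fst (src f))}. sg (deg f + 1)
          (cmp C (ent g c e) (ent (mc_arr (src f)) a c) + scl C (if c = e then z else 0) (snd (src f) a c)))"
    unfolding essential_simps fst_conv dT sum.distrib 3 sg_add sg_sum[symmetric] 4
    using z by (cases "z = 0") (auto simp: sg_def)
  then show ?thesis
    by (simp add: prod_eq_iff dif_aug cmp_aug fst_sum snd_sum fst_sg snd_sg proj_arr_horizontal proj_arr_essential
        cong: if_cong flip: g_def z_def)
qed

text \<open>A nonzero unit coefficient makes its morphism an endomorphism, so that the index picked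
  out by the Kronecker delta lies in the range of summation.\<close>

lemma essential_cmp:
  assumes f: "is_arr (aug T) f" and g: "is_arr (aug T) g" and fg: "tgt f = src g"
    and a: "a < length (fst (src f))" and e: "e < length (fst (tgt g))"
  shows "val (essential (cmp_arr (aug T) g f) a e)
    = (\<Sum>c<length (fst (tgt f)). cmp (aug C) (essential g c e) (essential f a c))"
proof -
  define zf zg where "zf = snd (val f)" and "zg = snd (val g)"
  have z: "zf \<noteq> 0 \<longrightarrow> src f = tgt f" "zg \<noteq> 0 \<longrightarrow> src g = tgt g"
    using f g by (auto simp: is_arr_aug_T zf_def zg_def)
  have 1: "(\<Sum>c<length (fst (tgt f)). scl C (if c = e then zg else 0) (fst (val f) a c)) = scl C zg (fst (val f) a e)"
    using z fg e by (cases "zg = 0") (auto simp: if_distrib[of "\<lambda>t. scl C t _"] if_distribR cong: if_cong)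
  have 2: "(\<Sum>c<length (fst (tgt f)). scl C (if a = c then zf else 0) (fst (val g) c e)) = scl C zf (fst (val g) a e)"
    using z a by (cases "zf = 0") (auto simp: if_distrib[of "\<lambda>t. scl C t _"] if_distribR cong: if_cong)
  have 3: "(\<Sum>c<length (fst (tgt f)). (if c = e then zg else 0) * (if a = c then zf else 0)) = (if a = e then zg * zf else 0)"
  proof (cases "zf = 0")
    case False
    then show ?thesis
      using z a by (simp add: if_distrib[of "\<lambda>t. _ * t"] cong: if_cong)
  qed (simp cong: if_cong)
  show ?thesis
    using a e fg
    by (intro prod_eqI) (simp_all add: cmp_aug fst_sum snd_sum proj_arr_essential twist_def cmp_mat sum.distrib scl_mat
        1[unfolded zg_def fg] 2[unfolded zf_def fg] 3[unfolded zf_def zg_def fg])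
qed

context
  fixes s :: "'k \<Rightarrow> 'l::ab_group_add \<Rightarrow> 'l"
  assumes s: "vector_space s"
begin

text \<open>The Maurer-Cartan equation inserted in the first slot of \<open>G\<close>. The two sorts
  of terms arise in \<open>bar_diff\<close> from one horizontal arrow and from two consecutive
  ones.\<close>

lemma multilinear_horizontal_mc:
  assumes X: "X \<in> Q" and a: "a < length (fst X)" and e: "e < length (fst X)"
    and G: "multilinear (aug C) s (fst X ! a) y G" and w: "seg (aug C) (fst X ! e) y w"
  shows "G (d_arr (aug C) (horizontal X a e) # w)
    + (\<Sum>c\<in>{Suc a..<e}. G (cmp_arr (aug C) (horizontal X c e) (horizontal X a c) # w)) = 0"
proof -
  have ob: "fst X ! a \<in> obs (aug C)" "fst X ! e \<in> obs (aug C)"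
    using Q_obs X a e by (auto simp: obs_aug)
  note ml = aug_C.multilinear_head[OF G s w ob]
  have arr: "dif (aug C) (horizontal X a e) \<in> Hom (aug C) (fst X ! a) (fst X ! e) 2"
    using aug_C.d_closed[OF horizontal_arr[OF X a e]] by (simp add: is_arr_def)
  have arr': "cmp (aug C) (horizontal X c e) (horizontal X a c) \<in> Hom (aug C) (fst X ! a) (fst X ! e) 2"
    if "c \<in> {Suc a..<e}" for c
    using aug_C.c_closed[OF horizontal_arr[OF X a, of c] horizontal_arr[OF X _ e, of c]] that e by (simp add: is_arr_def)
  have sum_arr: "(\<Sum>c\<in>{Suc a..<e}. cmp (aug C) (horizontal X c e) (horizontal X a c))
      \<in> Hom (aug C) (fst X ! a) (fst X ! e) 2"
    by (rule aug_C.Hom_sum[OF ob]) (rule arr')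
  have ml_sum: "G (Arr (fst X ! a) (fst X ! e) 2
        (\<Sum>c\<in>{Suc a..<e}. cmp (aug C) (horizontal X c e) (horizontal X a c)) # w)
      = (\<Sum>c\<in>{Suc a..<e}. G (Arr (fst X ! a) (fst X ! e) 2 (cmp (aug C) (horizontal X c e) (horizontal X a c)) # w))"
    by (rule ml(5)) (rule arr')
  have "G (d_arr (aug C) (horizontal X a e) # w)
    + (\<Sum>c\<in>{Suc a..<e}. G (cmp_arr (aug C) (horizontal X c e) (horizontal X a c) # w))
    = G (Arr (fst X ! a) (fst X ! e) 2 (dif (aug C) (horizontal X a e)
      + (\<Sum>c\<in>{Suc a..<e}. cmp (aug C) (horizontal X c e) (horizontal X a c))) # w)"
    unfolding ml(1)[OF arr sum_arr] ml_sum by (simp add: d_arr_def cmp_arr_def)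
  then show ?thesis
    unfolding horizontal_mc[OF X a e] by (simp add: ml(3))
qed

lemma multilinear_essential_dif:
  assumes f: "is_arr (aug T) f" and a: "a < length (fst (src f))" and e: "e < length (fst (tgt f))"
    and G: "multilinear (aug C) s (fst (src f) ! a) y G" and w: "seg (aug C) (fst (tgt f) ! e) y w"
  shows "G (essential (d_arr (aug T) f) a e # w) = G (d_arr (aug C) (essential f a e) # w)
    + (\<Sum>c<e. G (cmp_arr (aug C) (horizontal (tgt f) c e) (essential f a c) # w))
    + (\<Sum>c\<in>{Suc a..<length (fst (src f))}.
        sg (deg f + 1) (G (cmp_arr (aug C) (essential f c e) (horizontal (src f) a c) # w)))"
proof -
  have Qs: "src f \<in> Q" "tgt f \<in> Q"
    using f by (auto simp: is_arr_aug_T)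
  have ob: "fst (src f) ! a \<in> obs (aug C)" "fst (tgt f) ! e \<in> obs (aug C)"
    using Q_obs Qs a e by (auto simp: obs_aug)
  note ml = aug_C.multilinear_head[OF G s w ob]
  let ?H = "Hom (aug C) (fst (src f) ! a) (fst (tgt f) ! e) (deg f + 1)"
  have arr: "dif (aug C) (essential f a e) \<in> ?H"
    using aug_C.d_closed[OF essential_arr[OF f a e]] by (simp add: is_arr_def)
  have arr': "cmp (aug C) (horizontal (tgt f) c e) (essential f a c) \<in> ?H" if "c < e" for c
    using aug_C.c_closed[OF essential_arr[OF f a, of c] horizontal_arr[OF Qs(2) _ e, of c]] that e
    by (simp add: is_arr_def add.commute)
  have arr'': "cmp (aug C) (essential f c e) (horizontal (src f) a c) \<in> ?H" if "c \<in> {Suc a..<length (fst (src f))}" for c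
    using aug_C.c_closed[OF horizontal_arr[OF Qs(1) a, of c] essential_arr[OF f _ e, of c]] that
    by (simp add: is_arr_def)
  have "essential (d_arr (aug T) f) a e
      = Arr (fst (src f) ! a) (fst (tgt f) ! e) (deg f + 1) (val (essential (d_arr (aug T) f) a e))"
    by (rule Arr_collapse[symmetric]) simp_all
  moreover have "(\<Sum>c<e. cmp (aug C) (horizontal (tgt f) c e) (essential f a c)) \<in> ?H"
    by (rule aug_C.Hom_sum[OF ob]) (simp add: arr')
  moreover have "(\<Sum>c\<in>{Suc a..<length (fst (src f))}. sg (deg f + 1) (cmp (aug C) (essential f c e) (horizontal (src f) a c))) \<in> ?H"
    by (intro aug_C.Hom_sum[OF ob] aug_C.Hom_sg[OF ob] arr'')
  moreover have "G (Arr (fst (src f) ! a) (fst (tgt f) ! e) (deg f + 1)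
        (\<Sum>c<e. cmp (aug C) (horizontal (tgt f) c e) (essential f a c)) # w)
      = (\<Sum>c<e. G (cmp_arr (aug C) (horizontal (tgt f) c e) (essential f a c) # w))"
    by (subst ml(5), simp add: arr') (simp add: cmp_arr_def add.commute)
  moreover have "G (Arr (fst (src f) ! a) (fst (tgt f) ! e) (deg f + 1)
        (\<Sum>c\<in>{Suc a..<length (fst (src f))}. sg (deg f + 1) (cmp (aug C) (essential f c e) (horizontal (src f) a c))) # w)
      = (\<Sum>c\<in>{Suc a..<length (fst (src f))}.
        sg (deg f + 1) (G (cmp_arr (aug C) (essential f c e) (horizontal (src f) a c) # w)))"
    by (subst ml(5), rule aug_C.Hom_sg[OF ob arr''], assumption)
      (auto intro!: sum.cong simp: ml(4)[OF arr''] cmp_arr_def)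
  ultimately show ?thesis
    unfolding essential_dif[OF f a e]
    using arr ob by (simp add: ml(1) aug_C.Hom_add d_arr_def)
qed

lemma multilinear_essential_cmp:
  assumes f: "is_arr (aug T) f" and g: "is_arr (aug T) g" and fg: "tgt f = src g"
    and a: "a < length (fst (src f))" and e: "e < length (fst (tgt g))"
    and G: "multilinear (aug C) s (fst (src f) ! a) y G" and w: "seg (aug C) (fst (tgt g) ! e) y w"
  shows "G (essential (cmp_arr (aug T) g f) a e # w)
    = (\<Sum>c<length (fst (tgt f)). G (cmp_arr (aug C) (essential g c e) (essential f a c) # w))"
proof -
  have Qs: "src f \<in> Q" "tgt g \<in> Q"
    using f g by (auto simp: is_arr_aug_T)
  have ob: "fst (src f) ! a \<in> obs (aug C)" "fst (tgt g) ! e \<in> obs (aug C)"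
    using Q_obs Qs a e by (auto simp: obs_aug)
  note ml = aug_C.multilinear_head[OF G s w ob]
  have arr: "cmp (aug C) (essential g c e) (essential f a c) \<in> Hom (aug C) (fst (src f) ! a) (fst (tgt g) ! e) (deg g + deg f)"
    if "c < length (fst (tgt f))" for c
    using aug_C.c_closed[OF essential_arr[OF f a, of c] essential_arr[OF g _ e, of c]] that fg
    by (simp add: is_arr_def)
  have "essential (cmp_arr (aug T) g f) a e
      = Arr (fst (src f) ! a) (fst (tgt g) ! e) (deg g + deg f) (val (essential (cmp_arr (aug T) g f) a e))"
    by (rule Arr_collapse[symmetric]) simp_all
  then show ?thesis
    unfolding essential_cmp[OF f g fg a e]
    by (simp only:) (subst ml(5), simp_all add: arr cmp_arr_def)
qed

end

end

context twisted_complexes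
begin

context
  fixes s :: "'k \<Rightarrow> 'l::ab_group_add \<Rightarrow> 'l"
  assumes s: "vector_space s"
begin

text \<open>Both sides are expanded at the first arrow of the path. The terms acting beyond it agree
  by induction; for a leading horizontal arrow, \<open>bar_diff_sg\<close> turns its sign
  \<open>rdegs gs\<close> into the required minus sign. What remains are the terms that
  differentiate the first arrow or compose it with the second one.\<close>

lemma path_sum_bar_diff:
  fixes G :: "('s, 'm \<times> 'k) arr list \<Rightarrow> 'l"
  assumes "seg (aug T) X Y fs" "X \<in> Q" "a < length (fst X)" "b < length (fst Y)"
    and "multilinear (aug C) s (fst X ! a) (fst Y ! b) G"
  shows "path_sum fs X a b (bar_diff (aug C) G) = bar_diff (aug T) (\<lambda>gs. path_sum gs X a b G) fs"
  using assms
proof (induction fs X a b arbitrary: G rule: words.induct)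
  case (1 fs X a b)
  note fs = 1(3) and X = 1(4) and a = 1(5) and b = 1(6) and G = 1(7)
  let ?n = "length (fst X)"
  let ?y = "fst Y ! b"
  define H where "H c = (horizontal X a c :: ('s, 'm \<times> 'k) arr)" for c
  \<comment> \<open>The term of \<open>bar_diff\<close> that composes the first arrow
    \<open>h\<close> with its successor; on the empty word there is none.\<close>
  define merge where "merge h w = (case w of [] \<Rightarrow> 0 | g # r \<Rightarrow> G (cmp_arr (aug C) g h # r))" for h w
  have bar: "bar_diff (aug C) G (h # w) = sg (rdegs w) (G (d_arr (aug C) h # w)) + merge h w
      - bar_diff (aug C) (\<lambda>w. G (h # w)) w" for h w
    by (simp add: merge_def)
  have head: "path_sum gs Z c b (\<lambda>w. bar_diff (aug C) G (h # w))
      = sg (rdegs gs) (path_sum gs Z c b (\<lambda>w. G (d_arr (aug C) h # w))) + path_sum gs Z c b (merge h)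
        - bar_diff (aug T) (\<lambda>gs. path_sum gs Z c b (\<lambda>w. G (h # w))) gs"
    if gs: "seg (aug T) Z Y gs" "Z \<in> Q" "c < length (fst Z)"
      and IH: "path_sum gs Z c b (bar_diff (aug C) (\<lambda>w. G (h # w)))
        = bar_diff (aug T) (\<lambda>gs. path_sum gs Z c b (\<lambda>w. G (h # w))) gs" for gs Z c h
  proof -
    \<comment> \<open>All paths have the parity of \<open>rdegs gs\<close> as reduced degree, so the
      Koszul sign is constant and leaves the sum.\<close>
    have "path_sum gs Z c b (\<lambda>w. sg (rdegs w) (G (d_arr (aug C) h # w)))
        = path_sum gs Z c b (\<lambda>w. sg (rdegs gs) (G (d_arr (aug C) h # w)))"
      by (rule path_sum_cong, rule sg_parity, rule words_parity[OF gs b])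
    then show ?thesis
      unfolding bar path_sum_diff path_sum_add IH by (simp add: path_sum_sg)
  qed
  \<comment> \<open>The arrow composed with \<open>h\<close> is essential in the first summand and
    horizontal in the second.\<close>
  have mergeH: "path_sum gs Z c b (merge h) = ess_sum gs c b (merge h)
      + (\<Sum>e\<in>{Suc c..<length (fst Z)}. sg (rdegs gs)
          (path_sum gs Z e b (\<lambda>w. G (cmp_arr (aug C) (horizontal Z c e) h # w))))" for gs Z c h
    unfolding path_sum_rec[of gs Z c b "merge h"] by (simp add: merge_def)
  have Hc: "path_sum fs X c b (\<lambda>w. bar_diff (aug C) G (H c # w))
      = sg (rdegs fs) (path_sum fs X c b (\<lambda>w. G (d_arr (aug C) (H c) # w)))
        + (\<Sum>e\<in>{Suc c..<?n}. sg (rdegs fs) (path_sum fs X e b (\<lambda>w. G (cmp_arr (aug C) (horizontal X c e) (H c) # w))))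
        + ess_sum fs c b (merge (H c)) - bar_diff (aug T) (\<lambda>gs. path_sum gs X c b (\<lambda>w. G (H c # w))) fs"
    if c: "c \<in> {Suc a..<?n}" for c
  proof -
    have "multilinear (aug C) s (fst X ! c) ?y (\<lambda>w. G (H c # w))"
      using c a by (intro multilinear_Cons[OF G]) (auto simp: H_def intro: horizontal_arr X)
    then have "path_sum fs X c b (bar_diff (aug C) (\<lambda>w. G (H c # w)))
        = bar_diff (aug T) (\<lambda>gs. path_sum gs X c b (\<lambda>w. G (H c # w))) fs"
      using c b by (intro 1(2) fs X) auto
    from head[OF fs X _ this] show ?thesis
      using c by (simp add: mergeH)
  qed
  \<comment> \<open>Grouped by the end \<open>e\<close>, the differential of \<open>q_ae\<close>
    meets all composites \<open>q_ce q_ac\<close>. The sign of one horizontal arrow and the Koszul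
    sign of the differential, or the signs of two horizontal arrows, are both
    \<open>rdegs fs\<close> twice and disappear.\<close>
  have cancel: "(\<Sum>c\<in>{Suc a..<?n}. sg (rdegs fs) (sg (rdegs fs) (path_sum fs X c b (\<lambda>w. G (d_arr (aug C) (H c) # w)))
        + (\<Sum>e\<in>{Suc c..<?n}. sg (rdegs fs) (path_sum fs X e b (\<lambda>w. G (cmp_arr (aug C) (horizontal X c e) (H c) # w)))))) = 0"
  proof -
    have "path_sum fs X e b (\<lambda>w. G (d_arr (aug C) (H e) # w)
        + (\<Sum>c\<in>{Suc a..<e}. G (cmp_arr (aug C) (horizontal X c e) (H c) # w))) = 0" if "e \<in> {Suc a..<?n}" for e
    proof -
      have e: "e < ?n"
        using that by simp
      have "path_sum fs X e b (\<lambda>w. G (d_arr (aug C) (H e) # w)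
        + (\<Sum>c\<in>{Suc a..<e}. G (cmp_arr (aug C) (horizontal X c e) (H c) # w))) = path_sum fs X e b (\<lambda>w. 0)"
        unfolding H_def
        by (rule path_sum_cong, rule multilinear_horizontal_mc[OF s X a e G]) (use words_props[OF fs X e b] in blast)
      then show ?thesis
        by simp
    qed
    then have "(\<Sum>e\<in>{Suc a..<?n}. path_sum fs X e b (\<lambda>w. G (d_arr (aug C) (H e) # w)
        + (\<Sum>c\<in>{Suc a..<e}. G (cmp_arr (aug C) (horizontal X c e) (H c) # w)))) = 0"
      by simp
    moreover have "sg (rdegs fs) (sg (rdegs fs) z) = z" for z :: 'l
      by (simp add: sg_def)
    ultimately show ?thesis
      by (simp add: sg_add sg_sum sum.distrib path_sum_add path_sum_sum sum_triangle)
  qed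
  \<comment> \<open>The remaining paths begin with an essential arrow, or with a horizontal arrow
    that is composed with an essential one. Together they give the paths over the words of
    \<open>bar_diff (aug T)\<close> that begin with an essential arrow.\<close>
  have ess: "ess_sum fs a b (bar_diff (aug C) G) + (\<Sum>c\<in>{Suc a..<?n}. sg (rdegs fs) (ess_sum fs c b (merge (H c))))
      = bar_diff (aug T) (\<lambda>gs. ess_sum gs a b G) fs"
  proof (cases fs)
    case (Cons f gs)
    define N where "N = length (fst (tgt f))"
    have f: "is_arr (aug T) f" "src f = X" and gs: "seg (aug T) (tgt f) Y gs"
      using fs by (auto simp: Cons)
    have Z: "tgt f \<in> Q"
      using f by (simp add: is_arr_aug_T)
    have E: "path_sum gs (tgt f) c b (\<lambda>w. bar_diff (aug C) G (essential f a c # w))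
      = sg (rdegs gs) (path_sum gs (tgt f) c b (\<lambda>w. G (d_arr (aug C) (essential f a c) # w)))
        + (\<Sum>e\<in>{Suc c..<N}. sg (rdegs gs)
            (path_sum gs (tgt f) e b (\<lambda>w. G (cmp_arr (aug C) (horizontal (tgt f) c e) (essential f a c) # w))))
        + ess_sum gs c b (merge (essential f a c))
        - bar_diff (aug T) (\<lambda>gs. path_sum gs (tgt f) c b (\<lambda>w. G (essential f a c # w))) gs"
      if c: "c < N" for c
    proof -
      have "multilinear (aug C) s (fst (tgt f) ! c) ?y (\<lambda>w. G (essential f a c # w))"
        using c a by (intro multilinear_Cons[OF G]) (auto simp: f N_def intro: essential_arr)
      then have "path_sum gs (tgt f) c b (bar_diff (aug C) (\<lambda>w. G (essential f a c # w)))
          = bar_diff (aug T) (\<lambda>gs. path_sum gs (tgt f) c b (\<lambda>w. G (essential f a c # w))) gs"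
        using c b by (intro 1(1)[OF Cons _ gs Z]) (auto simp: N_def)
      from head[OF gs Z _ this] show ?thesis
        using c by (simp add: mergeH N_def)
    qed
    \<comment> \<open>The three parts of the twisted differential of \<open>f\<close>: the
      differential of a component, the composite with a following horizontal arrow, and the
      composite with a preceding one. The sign \<open>rdegs fs\<close> of the latter is
      \<open>rdegs gs\<close> plus \<open>deg f + 1\<close>, the sign of \<open>f q\<close> in the
      twisted differential.\<close>
    have dif: "(\<Sum>c<N. sg (rdegs gs) (path_sum gs (tgt f) c b (\<lambda>w. G (d_arr (aug C) (essential f a c) # w)))
        + (\<Sum>e\<in>{Suc c..<N}. sg (rdegs gs)
            (path_sum gs (tgt f) e b (\<lambda>w. G (cmp_arr (aug C) (horizontal (tgt f) c e) (essential f a c) # w)))))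
        + (\<Sum>c\<in>{Suc a..<?n}. sg (rdegs fs) (ess_sum fs c b (merge (H c))))
      = sg (rdegs gs) (ess_sum (d_arr (aug T) f # gs) a b G)"
    proof -
      have 1: "path_sum gs (tgt f) e b (\<lambda>w. G (essential (d_arr (aug T) f) a e # w))
         = path_sum gs (tgt f) e b (\<lambda>w. G (d_arr (aug C) (essential f a e) # w)
            + (\<Sum>c<e. G (cmp_arr (aug C) (horizontal (tgt f) c e) (essential f a c) # w))
            + (\<Sum>c\<in>{Suc a..<?n}. sg (deg f + 1) (G (cmp_arr (aug C) (essential f c e) (H c) # w))))"
        if "e < N" for e
      proof (rule path_sum_cong)
        fix r w assume "(r, w) \<in> set (words gs (tgt f) e b)"
        then have "seg (aug C) (fst (tgt f) ! e) ?y w"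
          using words_props[OF gs Z _ b] that by (auto simp: N_def)
        from multilinear_essential_dif[OF s f(1) _ _ _ this, of a G] that a G
        show "G (essential (d_arr (aug T) f) a e # w) = G (d_arr (aug C) (essential f a e) # w)
            + (\<Sum>c<e. G (cmp_arr (aug C) (horizontal (tgt f) c e) (essential f a c) # w))
            + (\<Sum>c\<in>{Suc a..<?n}. sg (deg f + 1) (G (cmp_arr (aug C) (essential f c e) (H c) # w)))"
          by (simp add: f N_def H_def)
      qed
      have 2: "(\<Sum>c<N. \<Sum>e\<in>{Suc c..<N}. F c e) = (\<Sum>e<N. \<Sum>c<e. F c e)" for F :: "nat \<Rightarrow> nat \<Rightarrow> 'l"
        using sum_triangle[where F = F and i = 0 and n = N] unfolding atLeast0LessThan .
      have 3: "sg (rdegs fs) z = sg (rdegs gs) (sg (deg f + 1) z)" for z :: 'l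
        by (simp add: Cons sg_sg add.commute)
      have "ess_sum (d_arr (aug T) f # gs) a b G = (\<Sum>e<N. path_sum gs (tgt f) e b (\<lambda>w. G (d_arr (aug C) (essential f a e) # w)))
          + (\<Sum>e<N. \<Sum>c<e. path_sum gs (tgt f) e b (\<lambda>w. G (cmp_arr (aug C) (horizontal (tgt f) c e) (essential f a c) # w)))
          + (\<Sum>e<N. \<Sum>c\<in>{Suc a..<?n}. sg (deg f + 1) (path_sum gs (tgt f) e b (\<lambda>w. G (cmp_arr (aug C) (essential f c e) (H c) # w))))"
        unfolding ess_sum_simps d_arr_simps N_def[symmetric] sum.distrib[symmetric]
        by (rule sum.cong) (simp_all add: 1 path_sum_add path_sum_sum path_sum_sg)
      moreover have "ess_sum fs c b (merge (H c))
          = (\<Sum>e<N. path_sum gs (tgt f) e b (\<lambda>w. G (cmp_arr (aug C) (essential f c e) (H c) # w)))" for c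
        by (simp add: Cons ess_sum_simps merge_def N_def)
      ultimately show ?thesis
        unfolding sum.distrib 2 3 by (simp add: sg_add sg_sum sum.swap[of _ "{..<N}" "{Suc a..<?n}"])
    qed
    \<comment> \<open>Composites of two adjacent essential arrows, summed over the index
      \<open>c\<close> between them, are the entries of the matrix product.\<close>
    have cmp: "(\<Sum>c<N. ess_sum gs c b (merge (essential f a c)))
        = (case gs of [] \<Rightarrow> 0 | g # hs \<Rightarrow> ess_sum (cmp_arr (aug T) g f # hs) a b G)"
    proof (cases gs)
      case Nil
      then show ?thesis
        by (simp add: ess_sum_simps merge_def)
    next
      case (Cons g hs)
      have g: "is_arr (aug T) g" "src g = tgt f" and hs: "seg (aug T) (tgt g) Y hs"
        using gs by (auto simp: Cons)
      have gQ: "tgt g \<in> Q"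
        using g by (simp add: is_arr_aug_T)
      have "path_sum hs (tgt g) e b (\<lambda>w. G (essential (cmp_arr (aug T) g f) a e # w))
          = path_sum hs (tgt g) e b (\<lambda>w. \<Sum>c<N. G (cmp_arr (aug C) (essential g c e) (essential f a c) # w))"
        if "e < length (fst (tgt g))" for e
      proof (rule path_sum_cong)
        fix r w assume "(r, w) \<in> set (words hs (tgt g) e b)"
        then have "seg (aug C) (fst (tgt g) ! e) ?y w"
          using words_props[OF hs gQ that b] by auto
        from multilinear_essential_cmp[OF s f(1) g(1) _ _ that _ this, of a G] a G
        show "G (essential (cmp_arr (aug T) g f) a e # w)
            = (\<Sum>c<N. G (cmp_arr (aug C) (essential g c e) (essential f a c) # w))"
          by (simp add: f g N_def)
      qed
      then show ?thesis
        by (simp add: Cons ess_sum_simps merge_def path_sum_sum sum.swap[of _ "{..<N}"])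
    qed
    have "ess_sum fs a b (bar_diff (aug C) G) = (\<Sum>c<N. path_sum gs (tgt f) c b (\<lambda>w. bar_diff (aug C) G (essential f a c # w)))"
      by (simp add: Cons ess_sum_simps N_def)
    also have "\<dots> = (\<Sum>c<N. sg (rdegs gs) (path_sum gs (tgt f) c b (\<lambda>w. G (d_arr (aug C) (essential f a c) # w)))
        + (\<Sum>e\<in>{Suc c..<N}. sg (rdegs gs)
            (path_sum gs (tgt f) e b (\<lambda>w. G (cmp_arr (aug C) (horizontal (tgt f) c e) (essential f a c) # w)))))
        + (\<Sum>c<N. ess_sum gs c b (merge (essential f a c)))
        - bar_diff (aug T) (\<lambda>hs. ess_sum (f # hs) a b G) gs"
      unfolding ess_sum_simps bar_diff_sum N_def[symmetric] sum.distrib[symmetric] sum_subtractf[symmetric]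
      by (rule sum.cong) (simp_all add: E del: bar_diff.simps)
    finally have SS: "ess_sum fs a b (bar_diff (aug C) G) = \<dots>" .
    have "ess_sum fs a b (bar_diff (aug C) G) + (\<Sum>c\<in>{Suc a..<?n}. sg (rdegs fs) (ess_sum fs c b (merge (H c))))
        = sg (rdegs gs) (ess_sum (d_arr (aug T) f # gs) a b G) + (\<Sum>c<N. ess_sum gs c b (merge (essential f a c)))
        - bar_diff (aug T) (\<lambda>hs. ess_sum (f # hs) a b G) gs"
      unfolding dif[symmetric] SS by (simp only: algebra_simps)
    then show ?thesis
      unfolding cmp Cons bar_diff.simps .
  qed (simp add: ess_sum_simps merge_def)
  \<comment> \<open>The summand 0 brings the sign into the form treated by
    \<open>bar_diff_sg\<close>.\<close>
  have rec: "(\<lambda>gs. path_sum gs X a b G)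
      = (\<lambda>gs. ess_sum gs a b G + (\<Sum>c\<in>{Suc a..<?n}. sg (0 + rdegs gs) (path_sum gs X c b (\<lambda>w. G (H c # w)))))"
    by (rule ext) (simp add: path_sum_rec[of _ X a b G] H_def)
  have "path_sum fs X a b (bar_diff (aug C) G) = ess_sum fs a b (bar_diff (aug C) G)
      + (\<Sum>c\<in>{Suc a..<?n}. sg (rdegs fs) (path_sum fs X c b (\<lambda>w. bar_diff (aug C) G (H c # w))))"
    unfolding H_def by (rule path_sum_rec)
  also have "(\<Sum>c\<in>{Suc a..<?n}. sg (rdegs fs) (path_sum fs X c b (\<lambda>w. bar_diff (aug C) G (H c # w))))
      = (\<Sum>c\<in>{Suc a..<?n}. sg (rdegs fs) (sg (rdegs fs) (path_sum fs X c b (\<lambda>w. G (d_arr (aug C) (H c) # w)))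
        + (\<Sum>e\<in>{Suc c..<?n}. sg (rdegs fs) (path_sum fs X e b (\<lambda>w. G (cmp_arr (aug C) (horizontal X c e) (H c) # w))))))
        + (\<Sum>c\<in>{Suc a..<?n}. sg (rdegs fs) (ess_sum fs c b (merge (H c))))
        - (\<Sum>c\<in>{Suc a..<?n}. sg (rdegs fs) (bar_diff (aug T) (\<lambda>gs. path_sum gs X c b (\<lambda>w. G (H c # w))) fs))"
    unfolding sum.distrib[symmetric] sum_subtractf[symmetric]
    by (rule sum.cong) (simp_all add: Hc sg_add sg_diff del: bar_diff.simps)
  finally show ?case
    unfolding rec bar_diff_add bar_diff_sum bar_diff_sg ess[symmetric] cancel
    by (simp add: sum_negf)
qed

end

end

section \<open>Path sums of a structure functor\<close>
text \<open>Differentials and compositions do not move the ends of a word, so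
  \<open>bar_diff\<close> evaluates its argument only on words with the ends of
  \<open>fs\<close>.\<close>

lemma bar_diff_cong:
  assumes "\<And>gs. gs \<noteq> [] \<Longrightarrow> src (hd gs) = src (hd fs) \<Longrightarrow> tgt (last gs) = tgt (last fs) \<Longrightarrow> G gs = H gs"
  shows "bar_diff A G fs = bar_diff A H fs"
  using assms
proof (induction fs arbitrary: G H)
  case (Cons f fs)
  have "bar_diff A (\<lambda>gs. G (f # gs)) fs = bar_diff A (\<lambda>gs. H (f # gs)) fs"
    by (cases "fs = []") (auto intro!: Cons.IH Cons.prems)
  moreover have "G (d_arr A f # fs) = H (d_arr A f # fs)"
    by (rule Cons.prems) auto
  moreover have "G (cmp_arr A g f # gs) = H (cmp_arr A g f # gs)" if "fs = g # gs" for g gs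
    using that by (intro Cons.prems) auto
  ultimately show ?case
    by (auto split: list.splits)
qed simp

lemma bar_diff_apply2: "bar_diff A G fs i j = bar_diff A (\<lambda>gs. G gs i j) fs"
  by (induction fs arbitrary: G) (auto simp: sg_apply split: list.splits)

text \<open>The map \<open>h\<close> is additive only on \<open>V\<close>: differential and
  composition are linear on single graded pieces, not on the ambient space.\<close>

lemma path_sum_hom:
  assumes V: "0 \<in> V" "\<And>u v. u \<in> V \<Longrightarrow> v \<in> V \<Longrightarrow> u + v \<in> V" "\<And>e u. u \<in> V \<Longrightarrow> sg e u \<in> V"
    and h: "h 0 = 0" "\<And>u v. u \<in> V \<Longrightarrow> v \<in> V \<Longrightarrow> h (u + v) = h u + h v" "\<And>e u. u \<in> V \<Longrightarrow> h (sg e u) = sg e (h u)"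
    and G: "\<And>e w. (e, w) \<in> set (words fs X a b) \<Longrightarrow> G w \<in> V"
  shows "path_sum fs X a b G \<in> V \<and> h (path_sum fs X a b G) = path_sum fs X a b (\<lambda>w. h (G w))"
proof -
  have "(\<Sum>(e, w)\<leftarrow>ws. sg e (G w)) \<in> V \<and> h (\<Sum>(e, w)\<leftarrow>ws. sg e (G w)) = (\<Sum>(e, w)\<leftarrow>ws. sg e (h (G w)))"
    if "set ws \<subseteq> set (words fs X a b)" for ws
    using that by (induction ws) (use G in \<open>auto simp: V h\<close>)
  then show ?thesis
    unfolding path_sum_def by blast
qed

lemma path_sum_Nil_if: "path_sum fs X a b (\<lambda>w. if w = [] then z else 0) = (if fs = [] \<and> a = b then z else 0)"
  by (subst path_sum_rec) (cases fs; simp add: ess_sum_simps)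

lemma path_sum_empty:
  assumes "\<And>e w. (e, w) \<in> set (words fs X a b) \<Longrightarrow> w \<noteq> [] \<Longrightarrow> G w = 0"
  shows "path_sum fs X a b G = (if fs = [] \<and> a = b then G [] else 0)"
proof -
  have "path_sum fs X a b G = path_sum fs X a b (\<lambda>w. if w = [] then G [] else 0)"
    by (rule path_sum_cong) (use assms in auto)
  then show ?thesis
    by (simp add: path_sum_Nil_if)
qed

lemma words_horizontal:
  "(e, w) \<in> set (words fs X c b) \<Longrightarrow> a < c \<Longrightarrow> c < length (fst X) \<Longrightarrow>
    (rdegs fs + e, horizontal X a c # w) \<in> set (words fs X a b)"
  by (subst words.simps) force

text \<open>A path of length one without essential arrows is the horizontal arrow from
  \<open>a\<close> to \<open>b\<close> itself, which exists only for \<open>a < b\<close>.\<close>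

lemma path_sum_short:
  assumes G: "\<And>e w. (e, w) \<in> set (words [] X a b) \<Longrightarrow> length w \<noteq> 1 \<Longrightarrow> G w = 0" and b: "b < length (fst X)"
  shows "path_sum [] X a b G = (if a < b then G [horizontal X a b] else 0)"
proof -
  have "path_sum [] X c b (\<lambda>w. G (horizontal X a c # w)) = (if c = b then G [horizontal X a c] else 0)"
    if "c \<in> {Suc a..<length (fst X)}" for c
    using that by (subst path_sum_empty) (auto intro!: G words_horizontal[of _ _ "[]", simplified])
  moreover have "G [] = 0" if "a = b"
    using that by (intro G[of 0]) (subst words.simps, auto)
  ultimately show ?thesis
    using b by (subst path_sum_rec) (simp add: ess_sum_simps Suc_le_eq)
qed

lemma words_incl:
  "\<forall>f\<in>set fs. snd (val f) = 0 \<Longrightarrow> (e, w) \<in> set (words fs X a b) \<Longrightarrow> \<forall>f\<in>set w. snd (val f) = 0"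
proof (induction fs X a b arbitrary: e w rule: words.induct)
  case (1 fs X a b)
  from 1(4) consider (nil) "w = []"
    | (ess) f gs c e' w' where "fs = f # gs" "c < length (fst (tgt f))" "w = essential f a c # w'"
        "(e', w') \<in> set (words gs (tgt f) c b)"
    | (hor) c e' w' where "a < c" "c < length (fst X)" "w = horizontal X a c # w'"
        "(e', w') \<in> set (words fs X c b)"
    unfolding words.simps[of fs X a b] by (cases fs) (auto simp: Suc_le_eq split: if_splits)
  then show ?case
  proof cases
    case ess
    then show ?thesis
      using 1(1)[OF ess(1) _ _ ess(4)] 1(3) by auto
  next
    case hor
    then show ?thesis
      using 1(2)[OF _ 1(3) hor(4)] by auto
  qed simp
qed

context nonunital_dg_category
begin

lemma path_sum_Hom:
  assumes "x \<in> obs C" "y \<in> obs C" "\<And>e w. (e, w) \<in> set (words fs X a b) \<Longrightarrow> G w \<in> Hom C x y k"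
  shows "path_sum fs X a b G \<in> Hom C x y k"
  using path_sum_hom[of "Hom C x y k" "\<lambda>u. u" fs X a b G] assms by (simp add: Hom_zero Hom_add Hom_sg)

lemma path_sum_dif:
  assumes "x \<in> obs C" "y \<in> obs C" "\<And>e w. (e, w) \<in> set (words fs X a b) \<Longrightarrow> G w \<in> Hom C x y k"
  shows "dif C (Arr x y k (path_sum fs X a b G)) = path_sum fs X a b (\<lambda>w. dif C (Arr x y k (G w)))"
proof -
  have *: "is_arr C (Arr x y k u) \<longleftrightarrow> u \<in> Hom C x y k" for u
    using assms(1,2) by (simp add: is_arr_def)
  show ?thesis
    using path_sum_hom[of "Hom C x y k" "\<lambda>u. dif C (Arr x y k u)" fs X a b G] assms
    by (simp add: Hom_zero Hom_add Hom_sg dif_add dif_sg dif_zero *)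
qed

lemma path_sum_cmp_left:
  assumes "is_arr C f" "tgt f = y" "z \<in> obs C" "\<And>e w. (e, w) \<in> set (words fs X a b) \<Longrightarrow> G w \<in> Hom C y z k"
  shows "cmp C (Arr y z k (path_sum fs X a b G)) f = path_sum fs X a b (\<lambda>w. cmp C (Arr y z k (G w)) f)"
proof -
  have y: "y \<in> obs C"
    using assms arr_obs by blast
  have *: "is_arr C (Arr y z k u) \<longleftrightarrow> u \<in> Hom C y z k" for u
    using assms(3) y by (simp add: is_arr_def)
  show ?thesis
    using path_sum_hom[of "Hom C y z k" "\<lambda>u. cmp C (Arr y z k u) f" fs X a b G] assms y
      cmp_add_left[of f z k] cmp_zero_left[of "src f" y "deg f" "val f" z k]
    by (simp add: Hom_zero Hom_add Hom_sg cmp_sg_left Arr_collapse *)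
qed

lemma path_sum_cmp_right:
  assumes "is_arr C f" "src f = y" "x \<in> obs C" "\<And>e w. (e, w) \<in> set (words fs X a b) \<Longrightarrow> G w \<in> Hom C x y k"
  shows "cmp C f (Arr x y k (path_sum fs X a b G)) = path_sum fs X a b (\<lambda>w. cmp C f (Arr x y k (G w)))"
proof -
  have y: "y \<in> obs C"
    using assms arr_obs by blast
  have *: "is_arr C (Arr x y k u) \<longleftrightarrow> u \<in> Hom C x y k" for u
    using assms(3) y by (simp add: is_arr_def)
  show ?thesis
    using path_sum_hom[of "Hom C x y k" "\<lambda>u. cmp C f (Arr x y k u)" fs X a b G] assms y
      cmp_add_right[of f x k] cmp_zero_right[of y "tgt f" "deg f" "val f" x k]
    by (simp add: Hom_zero Hom_add Hom_sg cmp_sg_right Arr_collapse *)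
qed

end

lemma path_sum_scl:
  assumes "vector_space s"
  shows "path_sum fs X a b (\<lambda>w. s c (G w)) = s c (path_sum fs X a b G)"
proof -
  interpret vector_space s by fact
  show ?thesis
    using path_sum_hom[of UNIV "s c" fs X a b G] by (simp add: scale_right_distrib sg_def)
qed

context twisted_complexes
begin

lemma essential_lin:
  "essential (Arr X Y k (scl (aug T) \<alpha> u + scl (aug T) \<beta> v)) i j
    = Arr (fst X ! i) (fst Y ! j) k (scl (aug C) \<alpha> (val (essential (Arr X Y k u) i j))
        + scl (aug C) \<beta> (val (essential (Arr X Y k v) i j)))"
  by (simp add: essential_def aug_def twist_def mat_def)

text \<open>Each path contains exactly one component of the varied letter, linear in it, and the
  signs see only degrees. The induction reaches that letter either at once, for empty
  \<open>us\<close>, or after a first arrow that is held fixed.\<close>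

lemma path_sum_lin:
  assumes s: "vector_space s"
    and "seg (aug T) X Y (us @ Arr x y k u # vs)" "seg (aug T) X Y (us @ Arr x y k v # vs)"
      "X \<in> Q" "a < length (fst X)" "b < length (fst Y)"
      "multilinear (aug C) s (fst X ! a) (fst Y ! b) G"
  shows "path_sum (us @ Arr x y k (scl (aug T) \<alpha> u + scl (aug T) \<beta> v) # vs) X a b G
    = s \<alpha> (path_sum (us @ Arr x y k u # vs) X a b G) + s \<beta> (path_sum (us @ Arr x y k v # vs) X a b G)"
  using assms(2-)
proof (induction "us @ Arr x y k u # vs" X a b arbitrary: us G rule: words.induct)
  case (1 X a b)
  interpret s: vector_space s by (rule s)
  note segs = 1(3,4) and X = 1(5) and a = 1(6) and b = 1(7) and G = 1(8)
  let ?uv = "scl (aug T) \<alpha> u + scl (aug T) \<beta> v"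
  have rd: "rdegs (us @ Arr x y k ?uv # vs) = rdegs (us @ Arr x y k u # vs)"
      "rdegs (us @ Arr x y k v # vs) = rdegs (us @ Arr x y k u # vs)"
    by simp_all
  have hor: "path_sum (us @ Arr x y k ?uv # vs) X c b (\<lambda>w. G (horizontal X a c # w))
      = s \<alpha> (path_sum (us @ Arr x y k u # vs) X c b (\<lambda>w. G (horizontal X a c # w)))
        + s \<beta> (path_sum (us @ Arr x y k v # vs) X c b (\<lambda>w. G (horizontal X a c # w)))"
    if c: "c \<in> {Suc a..<length (fst X)}" for c
    using c a b by (intro 1(2) segs X multilinear_Cons[OF G]) (auto intro: horizontal_arr X)
  have ess: "ess_sum (us @ Arr x y k ?uv # vs) a b G
      = s \<alpha> (ess_sum (us @ Arr x y k u # vs) a b G) + s \<beta> (ess_sum (us @ Arr x y k v # vs) a b G)"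
  proof (cases us)
    case Nil
    have xX: "x = X" and yQ: "y \<in> Q" and vs: "seg (aug T) y Y vs"
      and uv: "is_arr (aug T) (Arr X y k u)" "is_arr (aug T) (Arr X y k v)"
      using segs by (auto simp: Nil is_arr_aug_T)
    have "path_sum vs y c b (\<lambda>w. G (essential (Arr X y k ?uv) a c # w))
        = path_sum vs y c b (\<lambda>w. s \<alpha> (G (essential (Arr X y k u) a c # w)) + s \<beta> (G (essential (Arr X y k v) a c # w)))"
      if c: "c < length (fst y)" for c
    proof (rule path_sum_cong)
      fix e w assume "(e, w) \<in> set (words vs y c b)"
      then have w: "seg (aug C) (fst y ! c) (fst Y ! b) w"
        using words_props[OF vs yQ c b] by auto
      have arr: "is_arr (aug C) (essential (Arr X y k u) a c)" "is_arr (aug C) (essential (Arr X y k v) a c)"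
        using uv a c by (auto intro: essential_arr)
      have collapse: "Arr (fst X ! a) (fst y ! c) k (val (essential (Arr X y k t) a c)) = essential (Arr X y k t) a c" for t
        by (simp add: essential_def)
      show "G (essential (Arr X y k ?uv) a c # w)
          = s \<alpha> (G (essential (Arr X y k u) a c # w)) + s \<beta> (G (essential (Arr X y k v) a c # w))"
        using G[unfolded multilinear_def, rule_format, of "[]" "fst X ! a" "fst y ! c" k
            "val (essential (Arr X y k u) a c)" w "val (essential (Arr X y k v) a c)" \<alpha> \<beta>] w arr
        unfolding essential_lin collapse by simp
    qed
    then show ?thesis
      by (simp add: Nil xX ess_sum_simps path_sum_add path_sum_scl[OF s] sum.distrib s.scale_sum_right)
  next
    case (Cons f us')
    have f: "is_arr (aug T) f" "src f = X" and fQ: "tgt f \<in> Q"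
      and segs': "seg (aug T) (tgt f) Y (us' @ Arr x y k u # vs)" "seg (aug T) (tgt f) Y (us' @ Arr x y k v # vs)"
      using segs by (auto simp: Cons is_arr_aug_T)
    have "path_sum (us' @ Arr x y k ?uv # vs) (tgt f) c b (\<lambda>w. G (essential f a c # w))
        = s \<alpha> (path_sum (us' @ Arr x y k u # vs) (tgt f) c b (\<lambda>w. G (essential f a c # w)))
          + s \<beta> (path_sum (us' @ Arr x y k v # vs) (tgt f) c b (\<lambda>w. G (essential f a c # w)))"
      if c: "c < length (fst (tgt f))" for c
    proof -
      have arr: "is_arr (aug C) (essential f a c)"
        by (rule essential_arr) (simp_all add: f a c)
      have ml: "multilinear (aug C) s (fst (tgt f) ! c) (fst Y ! b) (\<lambda>w. G (essential f a c # w))"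
        by (rule multilinear_Cons[OF G arr]) (simp_all add: f)
      show ?thesis
        by (rule 1(1)[of f us' c, OF _ _ segs' fQ c b ml]) (simp_all add: Cons c)
    qed
    then show ?thesis
      by (simp add: Cons ess_sum_simps sum.distrib s.scale_sum_right)
  qed
  have scl_sg: "s c (sg e z) = sg e (s c z)" for c e z
    by (simp add: sg_def)
  show ?case
    unfolding path_sum_rec[of "us @ _ # vs" X a b G] ess rd
    by (simp add: hor sum.distrib sg_add s.scale_right_distrib s.scale_sum_right scl_sg)
qed

end

section \<open>The functor on twisted complexes and its A-infinity equation\<close>

lemma seg_at_stage:
  "seg A X Y fs \<Longrightarrow> i \<le> length fs \<Longrightarrow> seg A X (at_stage X fs i) (take i fs) \<and> seg A (at_stage X fs i) Y (drop i fs)"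
proof (induction fs arbitrary: X i)
  case (Cons f fs)
  then show ?case
    by (cases i) (simp add: at_stage_def, simp add: at_stage_Cons)
qed (simp add: at_stage_def)

lemma at_stage_length: "seg A X Y fs \<Longrightarrow> at_stage X fs (length fs) = Y"
  using seg_at_stage[of A X Y fs "length fs"] by simp

locale twisted_functor = twisted_complexes C Q
  for C :: "('k::field, 's, 'm::ab_group_add) dg" and Q +
  fixes idt :: "'s \<Rightarrow> 'm" and F :: "('s, 'm \<times> 'k) arr list \<Rightarrow> 'm"
  assumes F_structure: "structure_functor C idt F"
begin

definition P :: "('s list \<times> (nat \<Rightarrow> nat \<Rightarrow> 'm), (nat \<Rightarrow> nat \<Rightarrow> 'm) \<times> 'k) arr list \<Rightarrow> nat \<Rightarrow> nat \<Rightarrow> 'm" where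
  "P fs = (\<lambda>i j. if i < length (fst (src (hd fs))) \<and> j < length (fst (tgt (last fs)))
    then path_sum fs (src (hd fs)) i j F else 0)"

lemma F_arr: "composable (aug C) w \<Longrightarrow> is_arr C (taylor_arr (\<lambda>x. x) F w)"
  and F_lin: "multilinear (aug C) (scl C) x y F"
  and F_rel: "composable (aug C) w \<Longrightarrow> dif C (taylor_arr (\<lambda>x. x) F w)
      + (\<Sum>b\<in>{1..<length w}. sg ((int b - 1) * rdegs (drop b w))
        (cmp C (taylor_arr (\<lambda>x. x) F (drop b w)) (taylor_arr (\<lambda>x. x) F (take b w)))) = bar_diff (aug C) F w"
  using F_structure unfolding structure_functor_def ainf_functor_iff[OF aug_linear linear_dg_axioms] by blast+

lemma F_incl: "composable C w \<Longrightarrow> F (map incl_arr w) = id_functor w"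
  using F_structure unfolding structure_functor_def by blast

text \<open>Such a word is the image under \<open>i\<close> of a word of \<open>C\<close>, and
  \<open>p \<circ> i = id\<close> leaves only the linear component.\<close>

lemma F_no_units:
  assumes w: "seg (aug C) x y w" "w \<noteq> []" and no_units: "\<forall>f\<in>set w. snd (val f) = 0"
  shows "F w = (if length w = 1 then fst (val (hd w)) else 0)"
proof -
  have "seg C x y (map proj_arr w)"
    using w(1) by (induction w arbitrary: x) (auto simp: is_arr_aug)
  then have "composable C (map proj_arr w)"
    using w(2) by (auto intro: seg_imp_composable)
  moreover have "map incl_arr (map proj_arr w) = w"
    using no_units by (auto simp: incl_arr_def proj_arr_def prod_eq_iff arr.expand intro!: map_idI)
  ultimately have "F w = id_functor (map proj_arr w)"
    using F_incl by metis
  then show ?thesis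
    using w(2) by (simp add: id_functor_def hd_map)
qed

text \<open>Truncating at the empty word makes the extreme cuts, at \<open>0\<close> and \<open>length fs\<close>, contribute the twisting terms.\<close>

definition F0 :: "('s, 'm \<times> 'k) arr list \<Rightarrow> 'm" where
  "F0 w = (if w = [] then 0 else F w)"

text \<open>For empty \<open>fs\<close> the value is 1, the degree of a Maurer-Cartan element; so
  the extreme cuts obey the same degree formula as the others.\<close>

definition pdeg :: "('x, 'n) arr list \<Rightarrow> int" where
  "pdeg fs = degs fs + 1 - int (length fs)"

lemma taylor_word:
  assumes "seg (aug T) X Y fs" "X \<in> Q" "a < length (fst X)" "b < length (fst Y)" "(e, w) \<in> set (words fs X a b)" "w \<noteq> []"
  shows "taylor_arr (\<lambda>x. x) F w = Arr (fst X ! a) (fst Y ! b) (pdeg fs) (F0 w)"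
    "is_arr C (taylor_arr (\<lambda>x. x) F w)"
proof -
  have w: "seg (aug C) (fst X ! a) (fst Y ! b) w" "degs w + 1 - int (length w) = pdeg fs"
    using words_props[OF assms(1-5)] by (auto simp: pdeg_def)
  show "taylor_arr (\<lambda>x. x) F w = Arr (fst X ! a) (fst Y ! b) (pdeg fs) (F0 w)"
    using seg_ends[OF w(1) assms(6)] w(2) assms(6) by (simp add: taylor_arr_def F0_def)
  show "is_arr C (taylor_arr (\<lambda>x. x) F w)"
    by (rule F_arr[OF seg_imp_composable[OF w(1) assms(6)]])
qed

lemma seg_Q: "seg (aug T) X Y fs \<Longrightarrow> X \<in> Q \<Longrightarrow> Y \<in> Q"
proof (induction fs arbitrary: X)
  case (Cons f fs)
  then show ?case
    using Cons.IH[of "tgt f"] by (simp add: is_arr_aug_T)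
qed simp

lemma F0_Hom:
  assumes "seg (aug T) X Y fs" "X \<in> Q" "a < length (fst X)" "b < length (fst Y)" "(e, w) \<in> set (words fs X a b)"
  shows "F0 w \<in> Hom C (fst X ! a) (fst Y ! b) (pdeg fs)"
proof (cases "w = []")
  case True
  have "fst X ! a \<in> obs C" "fst Y ! b \<in> obs C"
    using Q_obs assms seg_Q[OF assms(1,2)] by auto
  then show ?thesis
    by (simp add: True F0_def Hom_zero)
next
  case False
  with taylor_word[OF assms this] show ?thesis
    by (simp add: is_arr_def)
qed

lemma path_sum_F0:
  assumes "seg (aug T) X Y fs" "X \<in> Q" "a < length (fst X)" "b < length (fst Y)" "fs \<noteq> []"
  shows "path_sum fs X a b F0 = path_sum fs X a b F"
proof (rule path_sum_cong)
  fix e w assume "(e, w) \<in> set (words fs X a b)"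
  then show "F0 w = F w"
    using words_props[OF assms(1-4)] assms(5) by (cases w) (fastforce simp: F0_def)+
qed

text \<open>The sum of all \<open>F_n(q,...,q)\<close> is \<open>q\<close>: the functor takes the
  Maurer-Cartan element of \<open>X\<close> to itself, as it must in order to be the identity on
  objects.\<close>

lemma path_sum_F0_Nil:
  assumes X: "X \<in> Q" and a: "a < length (fst X)" and b: "b < length (fst X)"
  shows "path_sum [] X a b F0 = snd X a b"
proof -
  have "path_sum [] X a b F0 = (if a < b then F0 [horizontal X a b] else 0)"
  proof (rule path_sum_short[OF _ b])
    fix e and w :: "('s, 'm \<times> 'k) arr list"
    assume w: "(e, w) \<in> set (words [] X a b)" "length w \<noteq> 1"
    show "F0 w = 0"
      using words_props[OF _ X a b w(1)] words_incl[OF _ w(1)] w(2) F_no_units[of _ _ w]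
      by (auto simp: F0_def)
  qed
  moreover have "F [horizontal X a b] = snd X a b"
    using F_no_units[of "fst X ! a" "fst X ! b" "[horizontal X a b]"] horizontal_arr[OF X a b] by simp
  ultimately show ?thesis
    using Q_upper[OF X, of b a] by (simp add: F0_def)
qed

definition F_cut :: "('s, 'm \<times> 'k) arr list \<Rightarrow> ('s, 'm \<times> 'k) arr list \<Rightarrow> 'm" where
  "F_cut u v = (if u = [] \<or> v = [] then 0 else sg ((int (length u) - 1) * rdegs v)
     (cmp C (taylor_arr (\<lambda>x. x) F v) (taylor_arr (\<lambda>x. x) F u)))"

lemma F_rel_cuts:
  assumes "composable (aug C) w"
  shows "dif C (taylor_arr (\<lambda>x. x) F w) + cuts F_cut w = bar_diff (aug C) F w"
proof -
  have "cuts F_cut w = (\<Sum>i\<in>{1..<length w}. F_cut (take i w) (drop i w))"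
    unfolding cuts_def by (rule sum.mono_neutral_right) (auto simp: F_cut_def)
  also have "\<dots> = (\<Sum>b\<in>{1..<length w}. sg ((int b - 1) * rdegs (drop b w))
        (cmp C (taylor_arr (\<lambda>x. x) F (drop b w)) (taylor_arr (\<lambda>x. x) F (take b w))))"
    by (rule sum.cong) (auto simp: F_cut_def)
  finally show ?thesis
    using F_rel[OF assms] by simp
qed

text \<open>The exponents \<open>length u - 1\<close> of the A-infinity equation of \<open>F\<close>
  and \<open>length u - i\<close> of \<open>cut_sum\<close> add up to \<open>i - 1\<close> modulo 2.
  The sign no longer depends on the path, and the double sum becomes a product of two path
  sums.\<close>

lemma cut_sum_F:
  assumes fs: "seg (aug T) X Y fs" and X: "X \<in> Q" and a: "a < length (fst X)" and b: "b < length (fst Y)"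
    and i: "i \<le> length fs"
  defines "Z \<equiv> at_stage X fs i"
  shows "cut_sum fs X a b F_cut i = sg ((int i - 1) * rdegs (drop i fs)) (\<Sum>c<length (fst Z).
    cmp C (Arr (fst Z ! c) (fst Y ! b) (pdeg (drop i fs)) (path_sum (drop i fs) Z c b F0))
      (Arr (fst X ! a) (fst Z ! c) (pdeg (take i fs)) (path_sum (take i fs) X a c F0)))"
proof -
  have segs: "seg (aug T) X Z (take i fs)" "seg (aug T) Z Y (drop i fs)"
    using seg_at_stage[OF fs i] by (auto simp: Z_def)
  have Z: "Z \<in> Q" and Y: "Y \<in> Q"
    using seg_Q[OF segs(1) X] seg_Q[OF fs X] by auto
  let ?r = "rdegs (drop i fs)"
  have "path_sum (take i fs) X a c (\<lambda>u. sg ((int (length u) - int i) * ?r) (path_sum (drop i fs) Z c b (F_cut u)))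
      = sg ((int i - 1) * ?r) (cmp C (Arr (fst Z ! c) (fst Y ! b) (pdeg (drop i fs)) (path_sum (drop i fs) Z c b F0))
      (Arr (fst X ! a) (fst Z ! c) (pdeg (take i fs)) (path_sum (take i fs) X a c F0)))"
    if c: "c < length (fst Z)" for c
  proof -
    define A1 :: "'m \<Rightarrow> ('s, 'm) arr" where "A1 = Arr (fst X ! a) (fst Z ! c) (pdeg (take i fs))"
    define A2 :: "'m \<Rightarrow> ('s, 'm) arr" where "A2 = Arr (fst Z ! c) (fst Y ! b) (pdeg (drop i fs))"
    have ob: "fst X ! a \<in> obs C" "fst Z ! c \<in> obs C" "fst Y ! b \<in> obs C"
      using Q_obs X Y Z a b c by auto
    note hom1 = F0_Hom[OF segs(1) X a c] and hom2 = F0_Hom[OF segs(2) Z c b]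
    have arr1: "is_arr C (A1 (F0 u))" if "(e, u) \<in> set (words (take i fs) X a c)" for e u
      using hom1[OF that] ob by (simp add: is_arr_def A1_def)
    have arr2: "is_arr C (A2 (F0 v))" if "(e, v) \<in> set (words (drop i fs) Z c b)" for e v
      using hom2[OF that] ob by (simp add: is_arr_def A2_def)
    have F_cut: "F_cut u v = sg ((int (length u) - 1) * ?r) (cmp C (A2 (F0 v)) (A1 (F0 u)))"
      if u: "(e, u) \<in> set (words (take i fs) X a c)" and v: "(e', v) \<in> set (words (drop i fs) Z c b)" for u v e e'
    proof (cases "u = [] \<or> v = []")
      \<comment> \<open>On an empty side the value of \<open>F0\<close> is 0, so the product formula
        also covers the cuts at the ends of a word.\<close>
      case True
      then have "cmp C (A2 (F0 v)) (A1 (F0 u)) = 0"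
        by (intro cmp_ent_zero arr1[OF u] arr2[OF v]) (auto simp: A1_def A2_def F0_def)
      then show ?thesis
        using True by (auto simp: F_cut_def)
    next
      case False
      have "even (rdegs v + ?r)"
        by (rule words_parity[OF segs(2) Z c b v])
      then show ?thesis
        using False taylor_word(1)[OF segs(1) X a c u] taylor_word(1)[OF segs(2) Z c b v]
        by (auto simp: F_cut_def A1_def A2_def intro!: sg_parity)
    qed
    have "path_sum (take i fs) X a c (\<lambda>u. sg ((int (length u) - int i) * ?r) (path_sum (drop i fs) Z c b (F_cut u)))
        = path_sum (take i fs) X a c (\<lambda>u. sg ((int i - 1) * ?r) (cmp C (A2 (path_sum (drop i fs) Z c b F0)) (A1 (F0 u))))"
    proof (rule path_sum_cong)
      fix e u assume u: "(e, u) \<in> set (words (take i fs) X a c)"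
      have "path_sum (drop i fs) Z c b (F_cut u)
          = path_sum (drop i fs) Z c b (\<lambda>v. sg ((int (length u) - 1) * ?r) (cmp C (A2 (F0 v)) (A1 (F0 u))))"
        by (rule path_sum_cong) (rule F_cut[OF u])
      also have "\<dots> = sg ((int (length u) - 1) * ?r) (cmp C (A2 (path_sum (drop i fs) Z c b F0)) (A1 (F0 u)))"
        unfolding path_sum_sg A2_def
        by (subst path_sum_cmp_left[OF arr1[OF u] _ ob(3) hom2]) (auto simp: A1_def)
      finally show "sg ((int (length u) - int i) * ?r) (path_sum (drop i fs) Z c b (F_cut u))
          = sg ((int i - 1) * ?r) (cmp C (A2 (path_sum (drop i fs) Z c b F0)) (A1 (F0 u)))"
        by (auto simp: sg_sg intro!: sg_parity)
    qed
    also have "\<dots> = sg ((int i - 1) * ?r) (cmp C (A2 (path_sum (drop i fs) Z c b F0)) (A1 (path_sum (take i fs) X a c F0)))"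
    proof -
      have "is_arr C (A2 (path_sum (drop i fs) Z c b F0))"
        using path_sum_Hom[OF ob(2,3) hom2] ob by (simp add: A2_def is_arr_def)
      then show ?thesis
        unfolding path_sum_sg A1_def
        by (subst path_sum_cmp_right[OF _ _ ob(1) hom1]) (auto simp: A2_def)
    qed
    finally show ?thesis
      unfolding A1_def A2_def .
  qed
  then show ?thesis
    unfolding cut_sum_def Z_def[symmetric] sg_sum by (intro sum.cong) auto
qed

text \<open>The A-infinity equation of \<open>F\<close>, summed with signs over all paths from
  \<open>a\<close> to \<open>b\<close>.\<close>

lemma path_sum_relation:
  assumes fs: "seg (aug T) X Y fs" "fs \<noteq> []" and X: "X \<in> Q" and a: "a < length (fst X)" and b: "b < length (fst Y)"
  shows "dif C (Arr (fst X ! a) (fst Y ! b) (pdeg fs) (path_sum fs X a b F0)) + (\<Sum>i\<le>length fs. cut_sum fs X a b F_cut i)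
    = bar_diff (aug T) (\<lambda>gs. path_sum gs X a b F) fs"
proof -
  have ob: "fst X ! a \<in> obs C" "fst Y ! b \<in> obs C"
    using Q_obs X a b seg_Q[OF fs(1) X] by auto
  have "bar_diff (aug T) (\<lambda>gs. path_sum gs X a b F) fs = path_sum fs X a b (bar_diff (aug C) F)"
    by (rule path_sum_bar_diff[OF vec fs(1) X a b F_lin, symmetric])
  also have "\<dots> = path_sum fs X a b (\<lambda>w. dif C (Arr (fst X ! a) (fst Y ! b) (pdeg fs) (F0 w)) + cuts F_cut w)"
  proof (rule path_sum_cong)
    fix e w assume w: "(e, w) \<in> set (words fs X a b)"
    have sw: "seg (aug C) (fst X ! a) (fst Y ! b) w" "w \<noteq> []"
      using words_props[OF fs(1) X a b w] fs(2) by auto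
    show "bar_diff (aug C) F w = dif C (Arr (fst X ! a) (fst Y ! b) (pdeg fs) (F0 w)) + cuts F_cut w"
      using F_rel_cuts[OF seg_imp_composable[OF sw]] taylor_word(1)[OF fs(1) X a b w sw(2)] by simp
  qed
  also have "\<dots> = dif C (Arr (fst X ! a) (fst Y ! b) (pdeg fs) (path_sum fs X a b F0)) + (\<Sum>i\<le>length fs. cut_sum fs X a b F_cut i)"
    unfolding path_sum_add path_sum_cuts[OF a] by (subst path_sum_dif[OF ob F0_Hom[OF fs(1) X a b]]) auto
  finally show ?thesis ..
qed

lemma taylor_P:
  assumes "seg (aug T) X Y fs" "fs \<noteq> []"
  shows "taylor_arr (\<lambda>X. X) P fs = Arr X Y (pdeg fs) (P fs)"
  using seg_ends[OF assms] by (simp add: taylor_arr_def pdeg_def)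

lemma P_entry:
  assumes "seg (aug T) X Y fs" "fs \<noteq> []" "X \<in> Q"
  shows "P fs i j = (if i < length (fst X) \<and> j < length (fst Y) then path_sum fs X i j F0 else 0)"
  using seg_ends[OF assms(1,2)] path_sum_F0[OF assms(1,3) _ _ assms(2)] by (auto simp: P_def)

lemma P_arr:
  assumes fs: "seg (aug T) X Y fs" "fs \<noteq> []" and X: "X \<in> Q"
  shows "is_arr T (Arr X Y (pdeg fs) (P fs))"
proof -
  have Y: "Y \<in> Q"
    by (rule seg_Q[OF fs(1) X])
  have "set (fst X) \<subseteq> obs C" "set (fst Y) \<subseteq> obs C"
    using mc_arr_Q[OF X] mc_arr_Q[OF Y] by (auto simp: is_arr_mat)
  moreover have "path_sum fs X i j F0 \<in> Hom C (fst X ! i) (fst Y ! j) (pdeg fs)"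
    if "i < length (fst X)" "j < length (fst Y)" for i j
    using that Q_obs X Y by (intro path_sum_Hom F0_Hom[OF fs(1) X]) auto
  ultimately show ?thesis
    unfolding M.is_arr_twist[OF Q_mc]
    using X Y Q_obs by (auto simp: is_arr_mat untwist_Arr ent_Arr P_entry[OF fs X]) (auto simp: is_arr_def)
qed

lemma P_relation:
  assumes fs: "seg (aug T) X Y fs" "fs \<noteq> []" and X: "X \<in> Q"
  shows "dif T (taylor_arr (\<lambda>X. X) P fs) + (\<Sum>i\<in>{1..<length fs}. sg ((int i - 1) * rdegs (drop i fs))
      (cmp T (taylor_arr (\<lambda>X. X) P (drop i fs)) (taylor_arr (\<lambda>X. X) P (take i fs)))) = bar_diff (aug T) P fs"
proof (intro ext)
  fix a b
  have Y: "Y \<in> Q"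
    by (rule seg_Q[OF fs(1) X])
  define n where "n = length fs"
  have n: "0 < n"
    using fs(2) by (simp add: n_def)
  note ends = seg_ends[OF fs]
  let ?Z = "at_stage X fs"
  have segs: "seg (aug T) X (?Z i) (take i fs)" "seg (aug T) (?Z i) Y (drop i fs)" "take i fs \<noteq> []" "drop i fs \<noteq> []"
    if "i \<in> {1..<n}" for i
    using seg_at_stage[OF fs(1), of i] that by (auto simp: n_def)
  have ZQ: "?Z i \<in> Q" if "i \<in> {1..<n}" for i
    by (rule seg_Q[OF segs(1)[OF that] X])
  note taylor = taylor_P[OF fs] taylor_P[OF segs(1,3)] taylor_P[OF segs(2,4)]
  show "(dif T (taylor_arr (\<lambda>X. X) P fs) + (\<Sum>i\<in>{1..<length fs}. sg ((int i - 1) * rdegs (drop i fs))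
      (cmp T (taylor_arr (\<lambda>X. X) P (drop i fs)) (taylor_arr (\<lambda>X. X) P (take i fs))))) a b = bar_diff (aug T) P fs a b"
  proof (cases "a < length (fst X) \<and> b < length (fst Y)")
    case False
    have "bar_diff (aug T) P fs a b = bar_diff (aug T) (\<lambda>gs. 0) fs"
      unfolding bar_diff_apply2 by (rule bar_diff_cong) (use ends False in \<open>auto simp: P_def\<close>)
    moreover have "cmp T (taylor_arr (\<lambda>X. X) P (drop i fs)) (taylor_arr (\<lambda>X. X) P (take i fs)) a b = 0"
      if "i \<in> {1..<n}" for i
      using False that by (auto simp: taylor cmp_twist untwist_Arr cmp_mat)
    moreover have "dif T (taylor_arr (\<lambda>X. X) P fs) a b = 0"
      using False by (auto simp: taylor twist_def untwist_Arr mc_arr_def cmp_mat dif_mat sg_apply)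
    ultimately show ?thesis
      by (simp add: sum_apply2 sg_apply n_def)
  next
    case True
    then have a: "a < length (fst X)" and b: "b < length (fst Y)"
      by auto
    let ?A = "\<lambda>c. Arr (fst X ! a) (fst Y ! c) (pdeg fs) (path_sum fs X a c F0)"
    let ?B = "\<lambda>c. Arr (fst X ! c) (fst Y ! b) (pdeg fs) (path_sum fs X c b F0)"
    have "bar_diff (aug T) P fs a b = bar_diff (aug T) (\<lambda>gs. path_sum gs X a b F) fs"
      unfolding bar_diff_apply2 by (rule bar_diff_cong) (use ends True in \<open>auto simp: P_def\<close>)
    also have "\<dots> = dif C (?A b) + (\<Sum>i\<le>n. cut_sum fs X a b F_cut i)"
      unfolding n_def by (rule path_sum_relation[OF fs X a b, symmetric])
    also have "(\<Sum>i\<le>n. cut_sum fs X a b F_cut i)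
        = cut_sum fs X a b F_cut 0 + (\<Sum>i\<in>{1..<n}. cut_sum fs X a b F_cut i) + cut_sum fs X a b F_cut n"
    proof -
      have "{..n} = insert 0 (insert n {1..<n})"
        using n by auto
      then show ?thesis
        using n by (simp add: add_ac)
    qed
    \<comment> \<open>The left side of this cut is purely horizontal and sums to the Maurer-Cartan
      element of \<open>X\<close>. The exponent \<open>- rdegs fs\<close> differs from the degree of
      \<open>P fs\<close> by an odd number, which gives the sign of the term \<open>\<phi> q\<close>
      in the twisted differential.\<close>
    also have "cut_sum fs X a b F_cut 0 = - sg (pdeg fs) (\<Sum>c<length (fst X). cmp C (?B c) (ent (mc_arr X) a c))"
    proof -
      have "sg (- rdegs fs) z = - sg (pdeg fs) z" for z :: 'm
        by (rule sg_parity_minus) (simp add: rdegs_eq pdeg_def)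
      moreover have "Arr (fst X ! a) (fst X ! c) (pdeg ([] :: ('s list \<times> (nat \<Rightarrow> nat \<Rightarrow> 'm), (nat \<Rightarrow> nat \<Rightarrow> 'm) \<times> 'k) arr list))
          (path_sum [] X a c F0) = ent (mc_arr X) a c"
        if "c < length (fst X)" for c
        using that by (simp add: path_sum_F0_Nil[OF X a] ent_def pdeg_def)
      ultimately show ?thesis
        using cut_sum_F[OF fs(1) X a b, of 0] by (simp add: at_stage_def)
    qed
    \<comment> \<open>Here the right side is purely horizontal. The reduced degree of
      \<open>drop n fs\<close> is 0, so the term \<open>q' \<phi>\<close> carries no sign.\<close>
    also have "cut_sum fs X a b F_cut n = (\<Sum>c<length (fst Y). cmp C (ent (mc_arr Y) c b) (?A c))"
    proof -
      have "Arr (fst Y ! c) (fst Y ! b) (pdeg ([] :: ('s list \<times> (nat \<Rightarrow> nat \<Rightarrow> 'm), (nat \<Rightarrow> nat \<Rightarrow> 'm) \<times> 'k) arr list))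
          (path_sum [] Y c b F0) = ent (mc_arr Y) c b"
        if "c < length (fst Y)" for c
        using that by (simp add: path_sum_F0_Nil[OF Y _ b] ent_def pdeg_def)
      then show ?thesis
        using cut_sum_F[OF fs(1) X a b, of n] by (simp add: at_stage_length[OF fs(1)] n_def)
    qed
    also have "(\<Sum>i\<in>{1..<n}. cut_sum fs X a b F_cut i) = (\<Sum>i\<in>{1..<n}. sg ((int i - 1) * rdegs (drop i fs))
      (cmp T (taylor_arr (\<lambda>X. X) P (drop i fs)) (taylor_arr (\<lambda>X. X) P (take i fs)))) a b"
      unfolding sum_apply2
    proof (rule sum.cong[OF refl])
      fix i assume i: "i \<in> {1..<n}"
      have "cmp T (taylor_arr (\<lambda>X. X) P (drop i fs)) (taylor_arr (\<lambda>X. X) P (take i fs)) a b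
        = (\<Sum>c<length (fst (?Z i)).
        cmp C (Arr (fst (?Z i) ! c) (fst Y ! b) (pdeg (drop i fs)) (path_sum (drop i fs) (?Z i) c b F0))
          (Arr (fst X ! a) (fst (?Z i) ! c) (pdeg (take i fs)) (path_sum (take i fs) X a c F0)))"
        using a b i by (simp add: taylor cmp_twist untwist_Arr cmp_mat ent_Arr P_entry[OF segs(1,3)[OF i] X]
            P_entry[OF segs(2,4)[OF i] ZQ[OF i]])
      then show "cut_sum fs X a b F_cut i = sg ((int i - 1) * rdegs (drop i fs))
        (cmp T (taylor_arr (\<lambda>X. X) P (drop i fs)) (taylor_arr (\<lambda>X. X) P (take i fs))) a b"
        using cut_sum_F[OF fs(1) X a b, of i] i by (simp add: sg_apply n_def)
    qed
    also have "dif T (taylor_arr (\<lambda>X. X) P fs) a b = dif C (?A b)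
        + (\<Sum>c<length (fst Y). cmp C (ent (mc_arr Y) c b) (?A c))
        - sg (pdeg fs) (\<Sum>c<length (fst X). cmp C (?B c) (ent (mc_arr X) a c))"
      using a b by (simp add: taylor twist_def untwist_Arr cmp_mat dif_mat sg_apply ent_Arr P_entry[OF fs X])
    ultimately show ?thesis
      by (simp add: n_def)
  qed
qed

lemma P_multilinear: "multilinear (aug T) (scl T) X Y P"
  unfolding multilinear_def
proof (intro allI impI)
  fix us vs :: "('s list \<times> (nat \<Rightarrow> nat \<Rightarrow> 'm), (nat \<Rightarrow> nat \<Rightarrow> 'm) \<times> 'k) arr list"
    and x y k u v \<alpha> \<beta>
  let ?l = "\<lambda>u. us @ Arr x y k u # vs"
  let ?uv = "scl (aug T) \<alpha> u + scl (aug T) \<beta> v"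
  assume u: "seg (aug T) X Y (?l u)" and v: "seg (aug T) X Y (?l v)"
  have uv: "seg (aug T) X Y (?l ?uv)"
    using u v by (auto simp: seg_append is_arr_def intro!: aug_T.Hom_add aug_T.Hom_scl)
  have X: "X \<in> Q"
    using u by (cases us) (auto simp: is_arr_aug_T)
  show "P (?l ?uv) = scl T \<alpha> (P (?l u)) + scl T \<beta> (P (?l v))"
  proof (intro ext)
    fix a b
    show "P (?l ?uv) a b = (scl T \<alpha> (P (?l u)) + scl T \<beta> (P (?l v))) a b"
      using path_sum_lin[OF vec u v X _ _ F_lin, of a b \<alpha> \<beta>]
        seg_ends[OF u] seg_ends[OF v] seg_ends[OF uv]
      by (auto simp: P_def scl_twist scl_mat)
  qed
qed

lemma P_ainf: "ainf_functor (aug T) T (\<lambda>X. X) P"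
proof -
  have seg: "seg (aug T) (src (hd fs)) (tgt (last fs)) fs \<and> fs \<noteq> [] \<and> src (hd fs) \<in> Q" if "composable (aug T) fs" for fs
    using composable_imp_seg[OF that] that by (cases fs) (auto simp: composable_def is_arr_aug_T)
  have arr: "is_arr T (taylor_arr (\<lambda>X. X) P fs)" if "composable (aug T) fs" for fs
    using P_arr taylor_P seg[OF that] by metis
  have rel: "dif T (taylor_arr (\<lambda>X. X) P fs) + (\<Sum>i\<in>{1..<length fs}. sg ((int i - 1) * rdegs (drop i fs))
      (cmp T (taylor_arr (\<lambda>X. X) P (drop i fs)) (taylor_arr (\<lambda>X. X) P (take i fs)))) = bar_diff (aug T) P fs"
    if "composable (aug T) fs" for fs
    using P_relation seg[OF that] by blast
  show ?thesis
    unfolding ainf_functor_iff[OF aug_T.linear_dg_axioms T.linear_dg_axioms]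
    by (intro conjI allI impI ballI arr rel P_multilinear) (simp_all add: obs_aug)
qed

text \<open>Without units \<open>F\<close> is nonzero only on words of length one. A path has at
  least as many arrows as \<open>fs\<close> has letters, so only single letters survive, and for
  these only the path without horizontal arrows.\<close>

lemma P_incl:
  assumes fs: "composable T fs"
  shows "P (map incl_arr fs) = id_functor fs"
proof -
  let ?fs = "map incl_arr fs :: ('s list \<times> (nat \<Rightarrow> nat \<Rightarrow> 'm), (nat \<Rightarrow> nat \<Rightarrow> 'm) \<times> 'k) arr list"
  define X Y where "X = src (hd fs)" and "Y = tgt (last fs)"
  have ne: "fs \<noteq> []"
    using fs by (auto simp: composable_def)
  have "seg (aug T) x y (map incl_arr gs)" if "seg T x y gs" for x y gs
    using that by (induction gs arbitrary: x) (auto simp: T.is_arr_aug incl_arr_def proj_arr_def Arr_collapse)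
  then have seg: "seg (aug T) X Y ?fs"
    using composable_imp_seg[OF fs] by (simp add: X_def Y_def)
  have "is_arr T (hd fs)"
    using fs ne by (simp add: composable_def)
  then have X: "X \<in> Q" and hd: "is_arr (mat C) (untwist (hd fs))"
    using M.is_arr_twist[OF Q_mc] by (auto simp: X_def)
  have no_units: "\<forall>f\<in>set ?fs. snd (val f) = 0"
    by (auto simp: incl_arr_def)
  show ?thesis
  proof (intro ext)
    fix a b
    show "P ?fs a b = id_functor fs a b"
    proof (cases "a < length (fst X) \<and> b < length (fst Y)")
      case True
      then have a: "a < length (fst X)" and b: "b < length (fst Y)"
        by auto
      have F: "F w = (if length w = 1 then fst (val (hd w)) else 0)" if "(e, w) \<in> set (words ?fs X a b)" for e w
        using words_props[OF seg X a b that] words_incl[OF no_units that] ne by (intro F_no_units) auto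
      have "P ?fs a b = path_sum ?fs X a b F"
        using seg_ends[OF seg] ne True by (simp add: P_def)
      also have "\<dots> = path_sum ?fs X a b (\<lambda>w. if length w = 1 then fst (val (hd w)) else 0)"
        by (rule path_sum_cong) (rule F)
      also have "\<dots> = id_functor fs a b"
      proof (cases "length fs = 1")
        case True
        then obtain f where f: "fs = [f]"
          by (auto simp: length_Suc_conv)
        have hor: "path_sum ?fs X c b (\<lambda>w. if length (horizontal X a c # w) = 1
            then fst (val (hd (horizontal X a c # w))) else 0) = 0" for c
          using path_sum_empty[of ?fs X c b "\<lambda>w. if length (horizontal X a c # w) = 1
            then fst (val (hd (horizontal X a c # w))) else (0 :: 'm)"] ne by simp
        show ?thesis
          unfolding path_sum_rec[of ?fs X a b] hor
          using b by (simp add: f ess_sum_simps path_sum_Nil_if incl_arr_def id_functor_def Y_def cong: if_cong)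
      next
        case False
        have "path_sum ?fs X a b (\<lambda>w. if length w = 1 then fst (val (hd w)) else 0) = path_sum ?fs X a b (\<lambda>w. 0 :: 'm)"
        proof (rule path_sum_cong)
          fix e and w :: "('s, 'm \<times> 'k) arr list"
          assume "(e, w) \<in> set (words ?fs X a b)"
          from words_props[OF seg X a b this] have "length fs \<le> length w"
            by auto
          moreover have "length fs \<noteq> 0"
            using ne by simp
          ultimately have "length w \<noteq> 1"
            using False by linarith
          then show "(if length w = 1 then fst (val (hd w)) else 0) = 0"
            by simp
        qed
        then show ?thesis
          using False by (simp add: id_functor_def)
      qed
      finally show ?thesis .
    next
      case False
      \<comment> \<open>\<open>P\<close> is 0 outside the index range by definition, and so is the
        matrix of a morphism.\<close>
      have "val (hd fs) a b = 0" if "length fs = 1"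
      proof -
        have "tgt (hd fs) = Y"
          using that by (cases fs) (auto simp: Y_def)
        then have "if a < length (fst X) \<and> b < length (fst Y) then is_arr C (ent (untwist (hd fs)) a b)
            else val (untwist (hd fs)) a b = 0"
          using hd unfolding is_arr_mat untwist_simps X_def by blast
        then show ?thesis
          using False by simp
      qed
      then show ?thesis
        using False seg_ends[OF seg] ne by (auto simp: P_def id_functor_def)
    qed
  qed
qed

lemma P_structure: "structure_functor T (\<lambda>X. P [unit_arr X]) P"
  unfolding structure_functor_def
  using P_ainf P_incl by (auto simp: id_functor_def)

text \<open>That \<open>P_1(1_X)\<close> is closed is the A-infinity equation for
  \<open>n = 1\<close>, because \<open>1_X\<close> is closed in the augmentation.\<close>

lemma P_weakly_unital: "weakly_unital T (\<lambda>X. P [unit_arr X])"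
  unfolding weakly_unital_def
proof (intro conjI ballI exI)
  show "nonunital_dg_category T"
    by (rule T.nonunital_dg_category_axioms)
  show "structure_functor T (\<lambda>X. P [unit_arr X]) P"
    by (rule P_structure)
  fix X assume "X \<in> obs T"
  then have X: "X \<in> Q"
    by (simp add: twist_def)
  have obT: "X \<in> obs (aug T)"
    using X by (simp add: obs_aug twist_def)
  have "is_arr (mat C) (Arr (fst X) (fst X) 0 0)"
    using mc_arr_Q[OF X] by (intro M.arr_zero) (auto simp: is_arr_def)
  then have "is_arr (aug T) (unit_arr X :: (_, _ \<times> 'k) arr)"
    using X unfolding is_arr_aug_T by (simp add: unit_arr_def untwist_def)
  then have seg: "seg (aug T) X X [unit_arr X]"
    by (simp add: unit_arr_def)
  have deg: "pdeg [unit_arr X :: (_, _ \<times> 'k) arr] = 0"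
    by (simp add: pdeg_def unit_arr_def)
  show "P [unit_arr X] \<in> Hom T X X 0"
    using P_arr[OF seg _ X] by (simp add: is_arr_def deg)
  have "dif (aug T) (unit_arr X) = 0"
    using T.dif_zero[of X X 0] X by (simp add: dif_aug proj_arr_def unit_arr_def zero_prod_def twist_def)
  then have "bar_diff (aug T) P [unit_arr X] = P [Arr X X 1 0]"
    by (simp add: d_arr_def) (simp add: unit_arr_def)
  also have "\<dots> = 0"
    by (rule aug_T.multilinear_zero[OF P_multilinear T.vec _ obT obT]) simp
  finally show "dif T (Arr X X 0 (P [unit_arr X])) = 0"
    using P_relation[OF seg _ X] taylor_P[OF seg] by (simp add: deg)
qed

end

section \<open>Index paths\<close>
lemma unshift_horizontal: "unshift (horizontal X k l) = hor X k l"
  by (simp add: unshift_def horizontal_def hor_def ob_def sh_def tw_def)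

lemma unshift_essential: "unshift (essential f k l) = ess f k l"
  by (simp add: unshift_def essential_def ess_def ob_def sh_def)

definition horizontals :: "'s list \<times> (nat \<Rightarrow> nat \<Rightarrow> 'm) \<Rightarrow> nat list \<Rightarrow> ('s, 'm \<times> 'k::zero) arr list" where
  "horizontals X ks = map (\<lambda>(k, l). horizontal X k l) (zip ks (tl ks))"

text \<open>A form of \<open>path_arrows\<close> that recurses on \<open>fs\<close> with the current
  object as an argument and keeps the arrows between shifted objects.\<close>

fun arrows ::
  "('s list \<times> (nat \<Rightarrow> nat \<Rightarrow> 'm), (nat \<Rightarrow> nat \<Rightarrow> 'm) \<times> 'k::zero) arr list \<Rightarrow> 's list \<times> (nat \<Rightarrow> nat \<Rightarrow> 'm) \<Rightarrow>
   nat list list \<Rightarrow> ('s, 'm \<times> 'k) arr list" where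
  "arrows [] X w = horizontals X (hd w)"
| "arrows (f # fs) X w = horizontals X (hd w) @ essential f (last (hd w)) (hd (hd (tl w))) # arrows fs (tgt f) (tl w)"

definition chain :: "'s list \<times> (nat \<Rightarrow> nat \<Rightarrow> 'm) \<Rightarrow> nat list \<Rightarrow> bool" where
  "chain X ks \<longleftrightarrow> ks \<noteq> [] \<and> sorted_wrt (<) ks \<and> set ks \<subseteq> {..<length (fst X)}"

fun is_path ::
  "('s list \<times> (nat \<Rightarrow> nat \<Rightarrow> 'm), (nat \<Rightarrow> nat \<Rightarrow> 'm) \<times> 'k::zero) arr list \<Rightarrow> 's list \<times> (nat \<Rightarrow> nat \<Rightarrow> 'm) \<Rightarrow>
   nat list list \<Rightarrow> bool" where
  "is_path [] X w \<longleftrightarrow> (\<exists>ks. w = [ks] \<and> chain X ks)"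
| "is_path (f # fs) X w \<longleftrightarrow> (\<exists>ks w'. w = ks # w' \<and> chain X ks \<and> is_path fs (tgt f) w')"

definition index_paths ::
  "('s list \<times> (nat \<Rightarrow> nat \<Rightarrow> 'm), (nat \<Rightarrow> nat \<Rightarrow> 'm) \<times> 'k::zero) arr list \<Rightarrow> 's list \<times> (nat \<Rightarrow> nat \<Rightarrow> 'm) \<Rightarrow>
   nat \<Rightarrow> nat \<Rightarrow> nat list list set" where
  "index_paths fs X a b = {w. is_path fs X w \<and> hd (hd w) = a \<and> last (last w) = b}"

lemma is_path_iff:
  "is_path fs X w \<longleftrightarrow> length w = length fs + 1 \<and> (\<forall>s\<le>length fs. chain (at_stage X fs s) (w ! s))"
proof (induction fs arbitrary: X w)
  case Nil
  then show ?case
    by (auto simp: at_stage_def length_Suc_conv)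
next
  case (Cons f fs)
  have "(\<forall>s\<le>length (f # fs). chain (at_stage X (f # fs) s) ((ks # w') ! s))
      \<longleftrightarrow> chain X ks \<and> (\<forall>s\<le>length fs. chain (at_stage (tgt f) fs s) (w' ! s))" for ks w'
    unfolding list.size(4) add.right_neutral add_Suc_right All_less_Suc2[unfolded less_Suc_eq_le]
    by (auto simp: at_stage_Cons at_stage_def[of _ _ 0] less_Suc_eq_le[symmetric] All_less_Suc2)
  then show ?case
    by (cases w) (auto simp: Cons.IH)
qed

lemma is_path_ne: "is_path fs X w \<Longrightarrow> w \<noteq> [] \<and> hd w \<noteq> [] \<and> chain X (hd w)"
  by (cases fs) (auto simp: chain_def)

lemma paths_eq: "paths fs a b = index_paths fs (src (hd fs)) a b"
proof -
  have "stage fs s = at_stage (src (hd fs)) fs s" for s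
    by (simp add: stage_def at_stage_def)
  then have *: "w \<in> paths fs a b \<longleftrightarrow> is_path fs (src (hd fs)) w \<and> hd (w ! 0) = a \<and> last (w ! length fs) = b" for w
    by (auto simp: paths_def is_path_iff chain_def len_def)
  have "w \<noteq> [] \<and> last w = w ! length fs" if "is_path fs (src (hd fs)) w" for w
  proof -
    have "length w = Suc (length fs)"
      using that by (simp add: is_path_iff)
    then show ?thesis
      by (cases "w = []") (auto simp: last_conv_nth)
  qed
  then show ?thesis
    unfolding index_paths_def set_eq_iff * by (auto simp: hd_conv_nth)
qed

lemma path_exponent_Nil: "path_exponent [] w = 0"
  by (simp add: path_exponent_def)

text \<open>The \<open>length ks - 1\<close> horizontal arrows of the first stage precede every
  essential arrow, so each of them enters all the \<open>N_s\<close> and contributes the whole sum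
  of the \<open>deg \<phi>^s + 1\<close>.\<close>

lemma path_exponent_Cons:
  "path_exponent (f # fs) (ks # w) = int (length ks - 1) * rdegs (f # fs) + path_exponent fs w"
proof -
  have "rdegs fs = (\<Sum>s<length fs. deg (fs ! s) + 1)"
    unfolding rdegs_def by (simp add: sum_list_sum_nth atLeast0LessThan)
  then show ?thesis
    unfolding path_exponent_def list.size(4) add.right_neutral add_Suc_right sum.lessThan_Suc_shift
    by (simp add: sum.atMost_Suc_shift algebra_simps sum.distrib sum_distrib_left sum_distrib_right del: sum.atMost_Suc)
qed

lemma path_exponent_horizontal:
  assumes "w \<noteq> []" "hd w \<noteq> []"
  shows "path_exponent fs ((a # hd w) # tl w) = rdegs fs + path_exponent fs w"
proof (cases fs)
  case (Cons f gs)
  obtain k ks w' where w: "w = (k # ks) # w'"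
    using assms by (cases w; cases "hd w") auto
  show ?thesis
    unfolding Cons w list.sel path_exponent_Cons by (simp add: algebra_simps)
qed (simp add: path_exponent_Nil)

lemma arrows_horizontal:
  assumes "hd w \<noteq> []"
  shows "arrows fs X ((a # hd w) # tl w) = horizontal X a (hd (hd w)) # arrows fs X w"
  using assms by (cases fs; cases "hd w") (auto simp: horizontals_def)

text \<open>The recursion of \<open>words\<close> for index lists: the first list is either
  \<open>[a]\<close>, and the path continues with an essential arrow, or it has a second index
  \<open>c\<close>, the end of a first horizontal arrow.\<close>

lemma index_paths_rec:
  assumes "a < length (fst X)"
  shows "index_paths fs X a b =
    (case fs of [] \<Rightarrow> if a = b then {[[a]]} else {}
      | f # gs \<Rightarrow> \<Union>c<length (fst (tgt f)). (\<lambda>w. [a] # w) ` index_paths gs (tgt f) c b)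
    \<union> (\<Union>c\<in>{Suc a..<length (fst X)}. (\<lambda>w. (a # hd w) # tl w) ` index_paths fs X c b)" (is "_ = ?E \<union> ?H")
proof (intro subset_antisym subsetI)
  fix w assume w: "w \<in> index_paths fs X a b"
  then obtain ks w' where ks: "w = (a # ks) # w'" "chain X (a # ks)"
    using is_path_ne[of fs X w] by (cases w; cases "hd w") (auto simp: index_paths_def)
  show "w \<in> ?E \<union> ?H"
  proof (cases ks)
    case Nil
    show ?thesis
    proof (cases fs)
      case (Cons f gs)
      have p: "is_path gs (tgt f) w'" "last (last w) = b"
        using w by (auto simp: ks Cons index_paths_def)
      then have "w' \<in> index_paths gs (tgt f) (hd (hd w')) b" "hd (hd w') < length (fst (tgt f))"
        using is_path_ne[OF p(1)] by (auto simp: index_paths_def ks chain_def subset_iff)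
      then show ?thesis
        by (auto simp: ks Nil Cons)
    qed (use w in \<open>auto simp: ks Nil index_paths_def\<close>)
  next
    case (Cons c ks')
    have "is_path fs X (ks # w')"
      using w by (cases fs) (auto simp: ks Cons index_paths_def chain_def)
    then have "ks # w' \<in> index_paths fs X c b"
      using w by (cases w') (auto simp: index_paths_def ks Cons)
    moreover have "c \<in> {Suc a..<length (fst X)}"
      using ks(2) by (auto simp: chain_def Cons)
    ultimately have "w \<in> ?H"
      unfolding ks(1) by (intro UN_I[of c] image_eqI[of _ _ "ks # w'"]) auto
    then show ?thesis ..
  qed
next
  fix w assume "w \<in> ?E \<union> ?H"
  then show "w \<in> index_paths fs X a b"
  proof
    assume "w \<in> ?E"
    show ?thesis
    proof (cases fs)
      case Nil
      then have "w = [[a]]" "a = b"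
        using \<open>w \<in> ?E\<close> by (auto split: if_splits)
      then show ?thesis
        using assms by (simp add: Nil index_paths_def chain_def)
    next
      case (Cons f gs)
      then obtain c w' where "w = [a] # w'" "w' \<in> index_paths gs (tgt f) c b"
        using \<open>w \<in> ?E\<close> by auto
      moreover from this have "w' \<noteq> []"
        using is_path_ne[of gs "tgt f" w'] by (simp add: index_paths_def)
      ultimately show ?thesis
        using assms by (simp add: Cons index_paths_def chain_def)
    qed
  next
    assume "w \<in> ?H"
    then obtain c u where c: "a < c" "c < length (fst X)" and u: "u \<in> index_paths fs X c b" "w = (a # hd u) # tl u"
      using Suc_le_eq by fastforce
    have p: "is_path fs X u" "hd (hd u) = c" "last (last u) = b"
      using u by (auto simp: index_paths_def)
    obtain ks u' where ku: "u = (c # ks) # u'" "chain X (c # ks)"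
      using is_path_ne[OF p(1)] p(2) by (cases u; cases "hd u") auto
    have "chain X (a # c # ks)"
      using ku(2) c by (auto simp: chain_def)
    then show ?thesis
      using p by (cases fs) (auto simp: index_paths_def u ku)
  qed
qed

text \<open>Paths form a set, \<open>words\<close> a list, so each piece of the recursion has to be
  shown disjoint from the others. The second index of the first stage tells them apart; it is absent
  in \<open>E\<close> and equal to \<open>c\<close> in \<open>H c\<close>. Finiteness is carried
  along because splitting the sum over a union requires it.\<close>

lemma index_paths_sum:
  assumes "a < length (fst X)"
  shows "finite (index_paths fs X a b) \<and>
    (\<Sum>w\<in>index_paths fs X a b. sg (path_exponent fs w) (G (arrows fs X w))) = path_sum fs X a b G"
  using assms
proof (induction fs X a b arbitrary: G rule: words.induct)
  case (1 fs X a b)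
  note a = 1(3)
  let ?\<Phi> = "\<lambda>fs X G w. sg (path_exponent fs w) (G (arrows fs X w))"
  define E where "E = (case fs of [] \<Rightarrow> if a = b then {[[a]]} else {}
      | f # gs \<Rightarrow> \<Union>c<length (fst (tgt f)). (\<lambda>w. [a] # w) ` index_paths gs (tgt f) c b)"
  define H where "H c = (\<lambda>w. (a # hd w) # tl w) ` index_paths fs X c b" for c
  have ne: "w \<noteq> [] \<and> hd w \<noteq> [] \<and> hd (hd w) = c" if "w \<in> index_paths gs Y c b" for gs Y c w
    using that is_path_ne[of gs Y w] by (simp add: index_paths_def)
  have inj: "inj_on (\<lambda>w. (a # hd w) # tl w) (index_paths fs X c b)" for c
    by (rule inj_onI, rule list.expand) (auto dest: ne[of _ fs X])
  have inj': "H c \<inter> H c' = {}" if "c \<noteq> c'" for c c'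
  proof -
    have "hd (tl (hd w)) = c" if "w \<in> H c" for w c
      using that by (auto simp: H_def dest: ne)
    then show ?thesis
      using that by auto
  qed
  have EH: "E \<inter> H c = {}" for c
  proof -
    have "tl (hd w) = []" if "w \<in> E" for w
      using that by (auto simp: E_def split: list.splits if_splits)
    moreover have "tl (hd w) \<noteq> []" if "w \<in> H c" for w
      using that by (auto simp: H_def dest: ne)
    ultimately show ?thesis
      by blast
  qed
  have H: "finite (H c) \<and> sum (?\<Phi> fs X G) (H c) = sg (rdegs fs) (path_sum fs X c b (\<lambda>w. G (horizontal X a c # w)))"
    if c: "c \<in> {Suc a..<length (fst X)}" for c
  proof -
    have "finite (index_paths fs X c b) \<and> (\<Sum>w\<in>index_paths fs X c b. ?\<Phi> fs X (\<lambda>w. G (horizontal X a c # w)) w)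
        = path_sum fs X c b (\<lambda>w. G (horizontal X a c # w))"
      using c by (intro 1(2)) auto
    moreover have "sum (?\<Phi> fs X G) (H c) = (\<Sum>w\<in>index_paths fs X c b. sg (rdegs fs) (?\<Phi> fs X (\<lambda>w. G (horizontal X a c # w)) w))"
      unfolding H_def sum.reindex[OF inj] comp_def
      by (rule sum.cong) (auto simp: path_exponent_horizontal arrows_horizontal sg_sg dest: ne[of _ fs X])
    ultimately show ?thesis
      by (simp add: H_def flip: sg_sum)
  qed
  have E: "finite E \<and> sum (?\<Phi> fs X G) E = ess_sum fs a b G"
  proof (cases fs)
    case Nil
    then show ?thesis
      by (simp add: E_def ess_sum_simps path_exponent_Nil horizontals_def)
  next
    case (Cons f gs)
    have IH: "finite (index_paths gs (tgt f) c b) \<and> (\<Sum>w\<in>index_paths gs (tgt f) c b. ?\<Phi> gs (tgt f) (\<lambda>w. G (essential f a c # w)) w)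
        = path_sum gs (tgt f) c b (\<lambda>w. G (essential f a c # w))" if "c < length (fst (tgt f))" for c
      using that by (intro 1(1)[OF Cons]) auto
    have "sum (?\<Phi> fs X G) ((\<lambda>w. [a] # w) ` index_paths gs (tgt f) c b)
        = path_sum gs (tgt f) c b (\<lambda>w. G (essential f a c # w))" if c: "c < length (fst (tgt f))" for c
    proof -
      have "sum (?\<Phi> fs X G) ((\<lambda>w. [a] # w) ` index_paths gs (tgt f) c b)
          = (\<Sum>w\<in>index_paths gs (tgt f) c b. ?\<Phi> gs (tgt f) (\<lambda>w. G (essential f a c # w)) w)"
        by (subst sum.reindex) (auto simp: Cons path_exponent_Cons horizontals_def dest: ne intro!: sum.cong)
      then show ?thesis
        using IH[OF c] by simp
    qed
    moreover have "sum (?\<Phi> fs X G) E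
        = (\<Sum>c<length (fst (tgt f)). sum (?\<Phi> fs X G) ((\<lambda>w. [a] # w) ` index_paths gs (tgt f) c b))"
      unfolding E_def Cons list.case
      by (rule sum.UNION_disjoint) (use IH in \<open>auto dest: ne\<close>)
    ultimately show ?thesis
      using IH by (simp add: E_def Cons ess_sum_simps)
  qed
  have "index_paths fs X a b = E \<union> (\<Union>c\<in>{Suc a..<length (fst X)}. H c)"
    unfolding E_def H_def by (rule index_paths_rec[OF a])
  moreover have "sum (?\<Phi> fs X G) (E \<union> (\<Union>c\<in>{Suc a..<length (fst X)}. H c))
      = sum (?\<Phi> fs X G) E + sum (?\<Phi> fs X G) (\<Union>c\<in>{Suc a..<length (fst X)}. H c)"
    by (rule sum.union_disjoint) (use E H EH in auto)
  moreover have "sum (?\<Phi> fs X G) (\<Union>c\<in>{Suc a..<length (fst X)}. H c)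
      = (\<Sum>c\<in>{Suc a..<length (fst X)}. sum (?\<Phi> fs X G) (H c))"
    by (rule sum.UNION_disjoint) (use H inj' in auto)
  ultimately show ?case
    using E H by (simp add: path_sum_rec[of fs X a b G])
qed

lemma path_arrows_eq:
  assumes "fs \<noteq> []" "length w = length fs + 1"
  shows "path_arrows fs w = map unshift (arrows fs (src (hd fs)) w)"
proof -
  have hors: "map unshift (horizontals X ks) = hors X ks" for X :: "('o, 'm) twisted" and ks
    by (simp add: horizontals_def hors_def case_prod_unfold unshift_horizontal)
  have "map unshift (arrows fs X w) = hors X (w ! 0) @
     concat (map (\<lambda>s. ess (fs ! s) (last (w ! s)) (hd (w ! Suc s)) # hors (tgt (fs ! s)) (w ! Suc s)) [0..<length fs])"
    if "length w = length fs + 1" for X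
    using that
  proof (induction fs arbitrary: X w)
    case Nil
    then show ?case
      by (auto simp: hors length_Suc_conv)
  next
    case (Cons f fs)
    then obtain ks l w' where "w = ks # l # w'"
      by (auto simp: length_Suc_conv)
    then show ?case
      using Cons.IH[of "l # w'" "tgt f"] Cons.prems
      by (simp add: hors unshift_essential upt_conv_Cons map_Suc_upt[symmetric] comp_def del: upt_Suc)
  qed
  from this[OF assms(2)] show ?thesis
    by (simp add: path_arrows_def stage_def)
qed

section \<open>Comparison of \<open>P_pretr\<close> with path sums over shifted objects\<close>

lemma words_Nil: "(e, []) \<in> set (words fs X a b) \<Longrightarrow> fs = [] \<and> a = b"
  by (subst (asm) words.simps) (auto split: list.splits if_splits)

text \<open>Identifies the shift that \<open>shift_functor\<close> reads off the last arrow with the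
  shift of the \<open>b\<close>-th summand in \<open>P_pretr\<close>.\<close>

lemma words_last:
  "(e, w) \<in> set (words fs X a b) \<Longrightarrow> w \<noteq> [] \<Longrightarrow> tgt (last w) = fst (at_stage X fs (length fs)) ! b"
proof (induction fs X a b arbitrary: e w rule: words.induct)
  case (1 fs X a b)
  from 1(3,4) consider (ess) f gs c e' w' where "fs = f # gs" "c < length (fst (tgt f))" "w = essential f a c # w'"
        "(e', w') \<in> set (words gs (tgt f) c b)"
    | (hor) c e' w' where "a < c" "c < length (fst X)" "w = horizontal X a c # w'"
        "(e', w') \<in> set (words fs X c b)"
    unfolding words.simps[of fs X a b] by (cases fs) (auto simp: Suc_le_eq split: if_splits)
  then show ?case
  proof cases
    case ess
    show ?thesis
    proof (cases "w' = []")
      case True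
      then show ?thesis
        using ess words_Nil[of e' gs "tgt f" c b] by (auto simp: at_stage_def)
    next
      case False
      then show ?thesis
        using 1(1)[OF ess(1) _ ess(4)] ess by (auto simp: at_stage_Cons)
    qed
  next
    case hor
    show ?thesis
    proof (cases "w' = []")
      case True
      then show ?thesis
        using hor words_Nil[of e' fs X c b] by (auto simp: at_stage_def)
    next
      case False
      then show ?thesis
        using 1(2)[OF _ hor(4)] hor by auto
    qed
  qed
qed

text \<open>The sign of \<open>shifted\<close>, with \<open>r\<close> taken from the target of the
  last arrow, so that the value depends on the word alone.\<close>

definition shift_functor :: "(('o, 'm \<times> 'k) arr list \<Rightarrow> 'm) \<Rightarrow> ('o \<times> int, 'm \<times> 'k) arr list \<Rightarrow> 'm::ab_group_add" where
  "shift_functor p w = sg ((int (length w) - 1) * snd (tgt (last w))) (p (map unshift w))"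

lemma P_pretr_eq:
  assumes "fs \<noteq> []"
  shows "P_pretr p fs = (\<lambda>i j. if i < length (fst (src (hd fs))) \<and> j < length (fst (tgt (last fs)))
    then path_sum fs (src (hd fs)) i j (shift_functor p) else 0)"
proof (intro ext)
  fix a b
  let ?X = "src (hd fs)"
  have Y: "stage fs (length fs) = tgt (last fs)" "at_stage ?X fs (length fs) = tgt (last fs)"
    using assms by (auto simp: stage_def at_stage_def last_conv_nth)
  have "(\<Sum>w\<in>paths fs a b. sg (path_exponent fs w) (shifted p (sh (stage fs (length fs)) b) (path_arrows fs w)))
      = path_sum fs ?X a b (shift_functor p)" if a: "a < length (fst ?X)"
  proof -
    define G where "G w = shifted p (sh (stage fs (length fs)) b) (map unshift w)" for w
    have "(\<Sum>w\<in>paths fs a b. sg (path_exponent fs w) (shifted p (sh (stage fs (length fs)) b) (path_arrows fs w)))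
      = (\<Sum>w\<in>index_paths fs ?X a b. sg (path_exponent fs w) (G (arrows fs ?X w)))"
      unfolding paths_eq
      by (rule sum.cong) (auto simp: G_def index_paths_def is_path_iff path_arrows_eq[OF assms])
    also have "\<dots> = path_sum fs ?X a b G"
      using index_paths_sum[OF a] by blast
    also have "\<dots> = path_sum fs ?X a b (shift_functor p)"
    proof (rule path_sum_cong)
      fix e w assume w: "(e, w) \<in> set (words fs ?X a b)"
      then have "w \<noteq> []"
        using words_Nil assms by blast
      from words_last[OF w this] show "G w = shift_functor p w"
        by (simp add: G_def shift_functor_def shifted_def sh_def Y)
    qed
    finally show ?thesis .
  qed
  moreover have "stage fs 0 = ?X"
    by (simp add: stage_def)
  ultimately show "P_pretr p fs a b = (if a < length (fst ?X) \<and> b < length (fst (tgt (last fs)))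
    then path_sum fs ?X a b (shift_functor p) else 0)"
    by (simp add: P_pretr_def len_def Y(1))
qed

section \<open>Passage to shifted objects\<close>
text \<open>\<open>P\<close> and \<open>P_pretr\<close> are compared on nonempty lists. This
  suffices, as composable words and both sides of the cuts in the A-infinity equation are
  nonempty.\<close>

lemma ainf_functor_cong:
  assumes "ainf_functor A D F0 F" and eq: "\<And>fs. fs \<noteq> [] \<Longrightarrow> F fs = F' fs"
  shows "ainf_functor A D F0 F'"
proof -
  have t: "taylor_arr F0 F fs = taylor_arr F0 F' fs" if "fs \<noteq> []" for fs
    using eq[OF that] by (simp add: taylor_arr_def)
  have c: "fs \<noteq> []" if "composable A fs" for fs
    using that by (simp add: composable_def)
  have sum: "(\<Sum>b\<in>{1..<length fs}. sg ((int b - 1) * (int (length fs - b) + degs (drop b fs)))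
               (cmp D (taylor_arr F0 F (drop b fs)) (taylor_arr F0 F (take b fs))))
      = (\<Sum>b\<in>{1..<length fs}. sg ((int b - 1) * (int (length fs - b) + degs (drop b fs)))
               (cmp D (taylor_arr F0 F' (drop b fs)) (taylor_arr F0 F' (take b fs))))" for fs
  proof (rule sum.cong[OF refl])
    fix b assume "b \<in> {1..<length fs}"
    then have "take b fs \<noteq> []" "drop b fs \<noteq> []"
      by auto
    then show "sg ((int b - 1) * (int (length fs - b) + degs (drop b fs)))
               (cmp D (taylor_arr F0 F (drop b fs)) (taylor_arr F0 F (take b fs)))
      = sg ((int b - 1) * (int (length fs - b) + degs (drop b fs)))
               (cmp D (taylor_arr F0 F' (drop b fs)) (taylor_arr F0 F' (take b fs)))"
      by (simp add: t)
  qed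
  show ?thesis
    using assms(1) unfolding ainf_functor_def Let_def sum by (simp add: eq t c)
qed

lemma structure_functor_cong:
  assumes "structure_functor A idt F" and eq: "\<And>fs. fs \<noteq> [] \<Longrightarrow> F fs = F' fs"
  shows "structure_functor A idt F'"
  using assms(1) ainf_functor_cong[OF _ eq, of "aug A" A "\<lambda>x. x"] eq
  unfolding structure_functor_def by (auto simp: composable_def)

lemma degs_unshift: "seg A x y w \<Longrightarrow> degs (map unshift w) = degs w + snd y - snd x"
proof (induction w arbitrary: x)
  case (Cons f w)
  show ?case
    using Cons.IH[of "tgt f"] Cons.prems by simp
qed simp

lemma rdegs_unshift: "seg A x y w \<Longrightarrow> rdegs (map unshift w) = rdegs w + snd y - snd x"
  by (simp add: rdegs_eq degs_unshift)

lemma proj_arr_unshift: "proj_arr (unshift f) = unshift (proj_arr f)"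
  by (simp add: proj_arr_def unshift_def)

lemma unshift_cmp_arr_aug:
  "tgt f = src g \<Longrightarrow> unshift (cmp_arr (aug (shifts C)) g f) = cmp_arr (aug C) (unshift g) (unshift f)"
  by (simp add: cmp_arr_def unshift_def cmp_aug shifts_simps proj_arr_def)

lemma unshift_d_arr_aug: "unshift (d_arr (aug (shifts C)) f)
    = Arr (fst (src f)) (fst (tgt f)) (deg (unshift f) + 1) (sg (snd (tgt f)) (dif (aug C) (unshift f)))"
  by (simp add: d_arr_def unshift_def dif_aug shifts_simps proj_arr_def sg_def)

context nonunital_dg_category
begin

lemma is_arr_aug_shifts: "is_arr (aug (shifts C)) f \<Longrightarrow> is_arr (aug C) (unshift f)"
proof -
  interpret S: nonunital_dg_category "shifts C"
    by (rule shifts_dg)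
  assume "is_arr (aug (shifts C)) f"
  then show ?thesis
    by (auto simp: S.is_arr_aug is_arr_aug is_arr_shifts proj_arr_unshift)
qed

lemma seg_unshift: "seg (aug (shifts C)) x y w \<Longrightarrow> seg (aug C) (fst x) (fst y) (map unshift w)"
  by (induction w arbitrary: x) (auto intro: is_arr_aug_shifts)

text \<open>The number \<open>m\<close> grows by one with every letter stripped off in the
  induction. A composition shortens the word by one, so the exponents differ by
  \<open>2 * snd y\<close>. A differential contributes \<open>snd (tgt f)\<close>, and the reduced
  degree of the tail changes by \<open>snd y - snd (tgt f)\<close>; modulo 2 this amounts to the
  additional \<open>snd y\<close>.\<close>

lemma bar_diff_unshift:
  assumes "vector_space s"
  shows "seg (aug (shifts C)) x y w \<Longrightarrow> multilinear (aug C) s (fst x) (fst y) G \<Longrightarrow>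
    bar_diff (aug (shifts C)) (\<lambda>w. sg ((int (length w) + m) * snd y) (G (map unshift w))) w
    = sg ((int (length w) + m + 1) * snd y) (bar_diff (aug C) G (map unshift w))"
proof (induction w arbitrary: x G m)
  case (Cons f w)
  interpret aug_C: linear_dg "aug C"
    by (rule aug_linear)
  have f: "is_arr (aug (shifts C)) f" "src f = x" and w: "seg (aug (shifts C)) (tgt f) y w"
    using Cons.prems(1) by auto
  note f' = is_arr_aug_shifts[OF f(1)]
  have "G (unshift (d_arr (aug (shifts C)) f) # map unshift w)
      = sg (snd (tgt f)) (G (d_arr (aug C) (unshift f) # map unshift w))"
    unfolding unshift_d_arr_aug
    using aug_C.multilinear_sg[OF _ assms seg_unshift[OF w], of "fst x" G] Cons.prems(2)
      aug_C.d_closed[OF f'] f' f(2)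
    by (simp add: d_arr_def is_arr_def)
  then have 1: "sg (rdegs w) (sg ((int (length (d_arr (aug (shifts C)) f # w)) + m) * snd y)
        (G (map unshift (d_arr (aug (shifts C)) f # w))))
      = sg ((int (length (f # w)) + m + 1) * snd y)
        (sg (rdegs (map unshift w)) (G (d_arr (aug C) (unshift f) # map unshift w)))"
    by (simp add: sg_sg rdegs_unshift[OF w]) (rule sg_parity, auto)
  have 2: "sg ((int (length (cmp_arr (aug (shifts C)) g f # u)) + m) * snd y) (G (unshift (cmp_arr (aug (shifts C)) g f) # map unshift u))
      = sg ((int (length (f # w)) + m + 1) * snd y) (G (cmp_arr (aug C) (unshift g) (unshift f) # map unshift u))"
    if "w = g # u" for g u
    using w that by (simp add: unshift_cmp_arr_aug) (rule sg_parity, auto)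
  have 3: "bar_diff (aug (shifts C)) (\<lambda>w. sg ((int (length (f # w)) + m) * snd y) (G (map unshift (f # w)))) w
      = sg ((int (length (f # w)) + m + 1) * snd y) (bar_diff (aug C) (\<lambda>w. G (unshift f # w)) (map unshift w))"
    using Cons.IH[OF w, of "\<lambda>w. G (unshift f # w)" "m + 1"] multilinear_Cons[OF Cons.prems(2) f'] f(2)
    by (simp add: algebra_simps)
  show ?case
    unfolding bar_diff.simps(2) 1 3 list.map(2)[of unshift f w] sg_diff sg_add
    by (cases w) (simp_all only: list.case list.map 2 sg_zero)
qed simp

text \<open>On a word of length \<open>n\<close> whose target is shifted by \<open>r\<close>, every
  term of the A-infinity equation of \<open>p\<close> acquires the same sign (-1)^(n r).\<close>

lemma shift_functor_structure:
  assumes "structure_functor C idt p"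
  shows "structure_functor (shifts C) (\<lambda>x. idt (fst x)) (shift_functor p)"
proof -
  interpret S: nonunital_dg_category "shifts C"
    by (rule shifts_dg)
  have p_arr: "is_arr C (taylor_arr (\<lambda>x. x) p w)"
    and p_rel: "dif C (taylor_arr (\<lambda>x. x) p w) + (\<Sum>b\<in>{1..<length w}. sg ((int b - 1) * rdegs (drop b w))
        (cmp C (taylor_arr (\<lambda>x. x) p (drop b w)) (taylor_arr (\<lambda>x. x) p (take b w)))) = bar_diff (aug C) p w"
    if "composable (aug C) w" for w
    using assms that unfolding structure_functor_def ainf_functor_iff[OF aug_linear linear_dg_axioms] by blast+
  have p_lin: "multilinear (aug C) (scl C) x y p" for x y
    using assms unfolding structure_functor_def ainf_functor_iff[OF aug_linear linear_dg_axioms] by blast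
  have p_incl: "p (map incl_arr w) = id_functor w" if "composable C w" for w
    using assms that unfolding structure_functor_def by blast
  let ?t = "taylor_arr (\<lambda>x. x) (shift_functor p)"
  have taylor: "unshift (?t w) = Arr (fst x) (fst y) (degs (map unshift w) + 1 - int (length w))
        (sg ((int (length w) - 1) * snd y) (p (map unshift w)))"
      "taylor_arr (\<lambda>x. x) p (map unshift w) = Arr (fst x) (fst y) (degs (map unshift w) + 1 - int (length w)) (p (map unshift w))"
      "is_arr C (taylor_arr (\<lambda>x. x) p (map unshift w))"
    if "seg (aug (shifts C)) x y w" "w \<noteq> []" for x y w
    using seg_ends[OF that] seg_ends[OF seg_unshift[OF that(1)]] that
      p_arr[OF seg_imp_composable[OF seg_unshift[OF that(1)]]]
    by (auto simp: taylor_arr_def unshift_def degs_unshift[OF that(1)] shift_functor_def)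
  have arr: "is_arr (shifts C) (?t w)" if "composable (aug (shifts C)) w" for w
    using taylor[OF composable_imp_seg[OF that]] that
    by (auto simp: is_arr_shifts composable_def intro!: arr_sg)
  have lin: "multilinear (aug (shifts C)) (scl (shifts C)) x y (shift_functor p)" for x y
    unfolding multilinear_def
  proof (intro allI impI)
    fix us vs :: "('o \<times> int, 'm \<times> 'k) arr list" and x' y' k u v \<alpha> \<beta>
    let ?l = "\<lambda>u. us @ Arr x' y' k u # vs"
    assume segs: "seg (aug (shifts C)) x y (?l u)" "seg (aug (shifts C)) x y (?l v)"
    let ?uv = "scl (aug (shifts C)) \<alpha> u + scl (aug (shifts C)) \<beta> v"
    have last: "tgt (last (?l ?uv)) = tgt (last (?l u))" "tgt (last (?l v)) = tgt (last (?l u))"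
      by auto
    have "p (map unshift (?l ?uv)) = scl C \<alpha> (p (map unshift (?l u))) + scl C \<beta> (p (map unshift (?l v)))"
      using p_lin[of "fst x" "fst y", unfolded multilinear_def, rule_format, of "map unshift us" "fst x'" "fst y'"
          "k + snd y' - snd x'" u "map unshift vs" v \<alpha> \<beta>] segs[THEN seg_unshift]
      by (simp add: unshift_Arr aug_def shifts_simps)
    then show "shift_functor p (?l ?uv) = scl (shifts C) \<alpha> (shift_functor p (?l u)) + scl (shifts C) \<beta> (shift_functor p (?l v))"
      unfolding shift_functor_def last by (simp add: sg_add scl_sg shifts_simps)
  qed
  have rel: "dif (shifts C) (?t w) + (\<Sum>b\<in>{1..<length w}. sg ((int b - 1) * rdegs (drop b w))
        (cmp (shifts C) (?t (drop b w)) (?t (take b w)))) = bar_diff (aug (shifts C)) (shift_functor p) w"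
    if w: "composable (aug (shifts C)) w" for w
  proof -
    define x y where "x = src (hd w)" and "y = tgt (last w)"
    have seg: "seg (aug (shifts C)) x y w" and ne: "w \<noteq> []"
      using composable_imp_seg[OF w] w by (auto simp: x_def y_def composable_def)
    let ?e = "int (length w) * snd y"
    have tgt_t: "tgt (?t w) = y"
      by (simp add: taylor_arr_def y_def)
    have 1: "dif (shifts C) (?t w) = sg ?e (dif C (taylor_arr (\<lambda>x. x) p (map unshift w)))"
      using taylor[OF seg ne] unfolding shifts_simps tgt_t
      by (simp add: dif_sg sg_sg) (rule sg_parity, auto)
    \<comment> \<open>The shift of the object \<open>z\<close> at the cut enters with the factor
      \<open>b - 1\<close> through the sign of the left part and again through the reduced degree of
      the right part, so it cancels and the common sign remains.\<close>
    have 2: "sg ((int b - 1) * rdegs (drop b w)) (cmp (shifts C) (?t (drop b w)) (?t (take b w)))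
        = sg ?e (sg ((int b - 1) * rdegs (drop b (map unshift w)))
          (cmp C (taylor_arr (\<lambda>x. x) p (drop b (map unshift w))) (taylor_arr (\<lambda>x. x) p (take b (map unshift w)))))"
      if b: "b \<in> {1..<length w}" for b
    proof -
      obtain z where z: "seg (aug (shifts C)) x z (take b w)" "seg (aug (shifts C)) z y (drop b w)"
        using seg_take_drop[OF seg, of b] b by auto
      have ne': "take b w \<noteq> []" "drop b w \<noteq> []"
        using b by auto
      note t1 = taylor[OF z(1) ne'(1)] and t2 = taylor[OF z(2) ne'(2)]
      have "cmp (shifts C) (?t (drop b w)) (?t (take b w))
          = sg ((int (length w) - int b - 1) * snd y + (int b - 1) * snd z)
            (cmp C (taylor_arr (\<lambda>x. x) p (map unshift (drop b w))) (taylor_arr (\<lambda>x. x) p (map unshift (take b w))))"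
        unfolding shifts_simps t1(1) t2(1)
        using t1(3)[unfolded t1(2)] t2(3)[unfolded t2(2)] b
        by (simp add: cmp_sg_left cmp_sg_right arr_sg sg_sg t1(2) t2(2) of_nat_diff min_def add.commute)
      then show ?thesis
        by (simp add: sg_sg drop_map take_map rdegs_unshift[OF z(2)]) (rule sg_parity, auto)
    qed
    have "bar_diff (aug (shifts C)) (shift_functor p) w
        = bar_diff (aug (shifts C)) (\<lambda>w. sg ((int (length w) + - 1) * snd y) (p (map unshift w))) w"
      by (rule bar_diff_cong) (simp add: shift_functor_def y_def)
    also have "\<dots> = sg ?e (bar_diff (aug C) p (map unshift w))"
      using bar_diff_unshift[OF vec seg p_lin, of "- 1"] by simp
    finally show ?thesis
      using p_rel[OF seg_imp_composable[OF seg_unshift[OF seg]]] ne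
      unfolding 1 by (simp add: 2 flip: sg_sum sg_add)
  qed
  have incl: "shift_functor p (map incl_arr w) = id_functor w" if w: "composable (shifts C) w" for w
  proof -
    have "composable C (map unshift w)"
      using w by (auto simp: composable_def is_arr_shifts)
    moreover have "map unshift (map incl_arr w) = map incl_arr (map unshift w)"
      by (simp add: incl_arr_def unshift_def)
    ultimately have "p (map unshift (map incl_arr w)) = id_functor (map unshift w)"
      using p_incl by metis
    moreover have "w \<noteq> []"
      using w by (simp add: composable_def)
    ultimately show ?thesis
      by (simp add: shift_functor_def id_functor_def hd_map)
  qed
  have units: "shift_functor p [unit_arr x] = idt (fst x)" if "x \<in> obs (shifts C)" for x
    using assms that by (auto simp: structure_functor_def shift_functor_def unit_arr_def unshift_def shifts_simps)
  show ?thesis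
    unfolding structure_functor_def ainf_functor_iff[OF S.aug_linear S.linear_dg_axioms]
    using arr lin rel incl units by (auto simp: obs_aug id_functor_def)
qed

end

theorem proposition3p3:
  fixes C :: "('k::field, 'o, 'm::ab_group_add) dg"
    and idt :: "'o \<Rightarrow> 'm"
    and p :: "('o, 'm \<times> 'k) arr list \<Rightarrow> 'm"
  assumes "weakly_unital C idt"
    and "structure_functor C idt p"
  shows "ainf_functor (aug (pretr C)) (pretr C) (\<lambda>X. X) (P_pretr p) \<and>
    structure_functor (pretr C) (\<lambda>X. P_pretr p [unit_arr X]) (P_pretr p) \<and>
    weakly_unital (pretr C) (\<lambda>X. P_pretr p [unit_arr X])"
proof -
  interpret C: nonunital_dg_category C
    using assms(1) by (simp add: weakly_unital_def)
  interpret S: nonunital_dg_category "shifts C"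
    by (rule C.shifts_dg)
  \<comment> \<open>The twisting set is \<open>obs (pretr C)\<close> itself, so that
    \<open>pretr_eq\<close> turns the results into statements on \<open>pretr C\<close>.\<close>
  interpret twisted_functor "shifts C" "obs (pretr C)" "\<lambda>x. idt (fst x)" "shift_functor p"
  proof
    show "obs (pretr C) \<subseteq> mc_set (mat (shifts C))"
      by (rule obs_pretr)
    show "snd X k l = 0" if "X \<in> obs (pretr C)" "l \<le> k" for X k l
      using that by (auto simp: pretr_def tw_def)
    show "structure_functor (shifts C) (\<lambda>x. idt (fst x)) (shift_functor p)"
      by (rule C.shift_functor_structure[OF assms(2)])
  qed
  have P: "P fs = P_pretr p fs" if "fs \<noteq> []" for fs
    unfolding P_pretr_eq[OF that] by (simp add: P_def)
  have T: "twist (mat (shifts C)) (obs (pretr C)) = pretr C"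
    by (rule pretr_eq[symmetric])
  have "structure_functor (pretr C) (\<lambda>X. P_pretr p [unit_arr X]) (P_pretr p)"
    using structure_functor_cong[OF P_structure P] by (simp add: T P)
  moreover from this have "ainf_functor (aug (pretr C)) (pretr C) (\<lambda>X. X) (P_pretr p)"
    unfolding structure_functor_def by blast
  moreover have "weakly_unital (pretr C) (\<lambda>X. P_pretr p [unit_arr X])"
    using P_weakly_unital by (simp add: T P)
  ultimately show ?thesis
    by blast
qed

end
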